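(* If $G$ is a decomposable graph, then $\chi'_{\rm irr}(G) \leq 328$.
   Context: All graphs are finite and simple. A graph is locally irregular if any two adjacent vertices have distinct degrees. A locally irregular edge-colouring of $G$ is a (not necessarily proper) colouring of the edges of $G$ such that, for each colour, the subgraph formed by the edges of that colour (with their endpoints) is locally irregular. $G$ is decomposable if it admits a locally irregular edge-colouring, and for decomposable $G$ the irregular chromatic index $\chi'_{\rm irr}(G)$ is the least number of colours in such a colouring (equivalently, the least number of locally irregular subgraphs into which $E(G)$ can be partitioned). *)

theory Defs
  imports Main
begin

definition simple_graph :: "'a set \<Rightarrow> 'a set set \<Rightarrow> bool" where
  "simple_graph V E \<longleftrightarrow> finite V \<and> (\<forall>e\<in>E. e \<subseteq> V \<and> card e = 2)"

definition degree :: "'a set set \<Rightarrow> 'a \<Rightarrow> nat" where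
  "degree E v = card {e \<in> E. v \<in> e}"

definition locally_irregular :: "'a set \<Rightarrow> 'a set set \<Rightarrow> bool" where
  "locally_irregular V E \<longleftrightarrow>
     (\<forall>u\<in>V. \<forall>v\<in>V. {u, v} \<in> E \<longrightarrow> degree E u \<noteq> degree E v)"

definition colour_class :: "'a set set \<Rightarrow> ('a set \<Rightarrow> nat) \<Rightarrow> nat \<Rightarrow> 'a set set" where
  "colour_class E c i = {e \<in> E. c e = i}"

text \<open>
  The subgraph formed by a set \<open>F\<close> of edges has the endpoints \<open>\<Union>F\<close> as its vertices.
  Colours are natural numbers, which is no restriction since graphs are finite.
  The notions below depend on a graph only through its edge set.
\<close>

definition locally_irregular_edge_colouring :: "'a set set \<Rightarrow> ('a set \<Rightarrow> nat) \<Rightarrow> bool" where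
  "locally_irregular_edge_colouring E c \<longleftrightarrow>
     (\<forall>i. locally_irregular (\<Union>(colour_class E c i)) (colour_class E c i))"

definition decomposable :: "'a set set \<Rightarrow> bool" where
  "decomposable E \<longleftrightarrow> (\<exists>c. locally_irregular_edge_colouring E c)"

text \<open>
  The number of colours of a colouring is the number of colours that occur on an edge;
  the value of the index is meaningful only for decomposable graphs.
\<close>

definition irregular_chromatic_index :: "'a set set \<Rightarrow> nat" where
  "irregular_chromatic_index E =
     (LEAST k. \<exists>c. locally_irregular_edge_colouring E c \<and> card (c ` E) = k)"

end

theory Submission
  imports Defs
begin

text \<open>
  If every edge joins a vertex of even degree to a vertex of odd degree, a graph is locally irregular.
  In a connected bipartite graph a spanning tree corrects all parities but one, and the exception can be
  placed at a leaf; so a bipartite graph is of this kind up to a few star forests, and a graph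
  with a proper vertex colouring by \<open>2^t\<close> colours splits into \<open>4 * t\<close> locally irregular graphs
  up to a remainder of bounded degree.

  For an arbitrary graph, take a locally optimal cut, so that every vertex has far more neighbours in each
  other class than in its own subclass. To treat the edges within the subclasses of one class \<open>A\<close>, run through
  \<open>A\<close> in some order and use the edges to a class \<open>B\<close> to make the degree of each vertex odd and
  different from the degrees of its earlier neighbours, while the last edge at each vertex of \<open>B\<close> keeps its
  degree even. A vertex without freedom because it comes last too often has freedom in the reverse
  order, and wrong parities are corrected by a few edges to a third class. What remains is multipartite.

  The remainder of bounded degree is absorbed by a spanning tree reserved at the start: together they
  have, after removing one small locally irregular graph, an orientation with even out-degrees, and so
  fall into even stars. This needs a vertex of degree four; in graphs of maximum degree three, which are
  the only place where decomposability is used, the given decomposition is cut into small pieces.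
  Altogether 128 colours suffice.
\<close>

text \<open>In each component the number of vertices of odd degree is even, so one parity stays open
  and a few edges may be left over. These cannot be treated alone, since a single edge is not
  decomposable; they have to be attached to something connected, and that is why a tree is set aside
  before anything else. The constants: five is the least number of classes in which each class can
  be assigned two others with no pair used twice, since this takes 2 * 5 pairs. The factor 16 makes
  up for the two thirds of the edges that may be blocked. Classes, subclasses and the two orders
  give 5 * 16 * 2 = 160 \<le> 2^8 parts, so t = 8: the orders cost 2 * 5 colours, the multipartite
  rest 4 * 8, and the remainder has degree at most 3 * 8 = 24. Paths of length two cover it up to a
  matching with 3 * 24 + 1 colours. Tree and matching together take one irregular graph and 12
  further colours: 42 + 73 + 13 = 128.\<close>

definition fgraph :: "'a set set \<Rightarrow> bool" where
  "fgraph E \<longleftrightarrow> finite E \<and> (\<forall>e\<in>E. card e = 2)"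

text \<open>This is \<open>locally_irregular (\<Union>E) E\<close>, see
  \<open>locally_irregular_Union\<close>; edge sets can then be cut up without keeping track of
  vertices.\<close>

definition irregular :: "'a set set \<Rightarrow> bool" where
  "irregular E \<longleftrightarrow> (\<forall>u v. {u, v} \<in> E \<longrightarrow> degree E u \<noteq> degree E v)"

text \<open>Bounding the colours by \<open>n\<close>, instead of counting those that occur, makes
  the numbers add up in \<open>splits_Un\<close> by a shift.\<close>

definition splits :: "nat \<Rightarrow> 'a set set \<Rightarrow> bool" where
  "splits n E \<longleftrightarrow> (\<exists>c. (\<forall>e\<in>E. c e < n) \<and> (\<forall>i. irregular {e \<in> E. c e = i}))"

definition adj :: "'a set set \<Rightarrow> ('a \<times> 'a) set" where
  "adj E = {(u, v). {u, v} \<in> E}"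

section \<open>Degrees, their parities, and splittings into irregular graphs\<close>

lemma fgraph_subset: "fgraph E \<Longrightarrow> F \<subseteq> E \<Longrightarrow> fgraph F"
  unfolding fgraph_def using finite_subset by blast

lemma fgraph_Un: "fgraph E \<Longrightarrow> fgraph F \<Longrightarrow> fgraph (E \<union> F)"
  unfolding fgraph_def by auto

lemma fgraph_edgeE:
  assumes "fgraph E" "e \<in> E" "u \<in> e"
  obtains v where "e = {u, v}" "u \<noteq> v"
  using assms unfolding fgraph_def by (metis card_2_iff insert_commute insertE singletonD)

lemma fgraph_edgeE2:
  assumes "fgraph E" "e \<in> E"
  obtains u v where "e = {u, v}" "u \<noteq> v"
  using assms unfolding fgraph_def by (metis card_2_iff)

lemma fgraph_neq: "fgraph E \<Longrightarrow> {u, v} \<in> E \<Longrightarrow> u \<noteq> v"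
  unfolding fgraph_def by fastforce

lemma fgraph_empty_notin: "fgraph E \<Longrightarrow> {} \<notin> E"
  unfolding fgraph_def by force

lemma finite_Union_fgraph: "fgraph E \<Longrightarrow> finite (\<Union>E)"
  unfolding fgraph_def by (metis finite_Union card.infinite zero_neq_numeral)

lemma degree_Un: "finite E \<Longrightarrow> finite F \<Longrightarrow> E \<inter> F = {} \<Longrightarrow> degree (E \<union> F) v = degree E v + degree F v"
  unfolding degree_def
  by (subst card_Un_disjoint [symmetric]) (auto intro!: arg_cong [where f = card])

lemma degree_mono: "finite E \<Longrightarrow> F \<subseteq> E \<Longrightarrow> degree F v \<le> degree E v"
  unfolding degree_def by (rule card_mono) auto

lemma degree_cong: "{e \<in> E. v \<in> e} = {e \<in> F. v \<in> e} \<Longrightarrow> degree E v = degree F v"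
  unfolding degree_def by simp

lemma degree_eq_0: "finite E \<Longrightarrow> degree E v = 0 \<longleftrightarrow> v \<notin> \<Union>E"
  unfolding degree_def by auto

lemma degree_pos: "finite E \<Longrightarrow> e \<in> E \<Longrightarrow> v \<in> e \<Longrightarrow> degree E v \<ge> 1"
  using degree_eq_0[of E v] by (metis One_nat_def UnionI less_one linorder_not_le)

lemma degree_le_1:
  assumes "finite E" "\<And>e e'. e \<in> E \<Longrightarrow> e' \<in> E \<Longrightarrow> v \<in> e \<Longrightarrow> v \<in> e' \<Longrightarrow> e = e'"
  shows "degree E v \<le> 1"
  unfolding degree_def using assms by (intro card_le_Suc0_iff_eq[THEN iffD2, simplified One_nat_def[symmetric]]) auto

lemma degree_le_1D:
  "finite E \<Longrightarrow> degree E v \<le> 1 \<Longrightarrow> e \<in> E \<Longrightarrow> e' \<in> E \<Longrightarrow> v \<in> e \<Longrightarrow> v \<in> e' \<Longrightarrow> e = e'"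
  unfolding degree_def using card_le_Suc0_iff_eq[of "{e \<in> E. v \<in> e}"] by auto

lemma degree_neighbours:
  assumes "fgraph E" shows "degree E v = card {u. {v, u} \<in> E}"
proof -
  have "bij_betw (\<lambda>u. {v, u}) {u. {v, u} \<in> E} {e \<in> E. v \<in> e}"
    unfolding bij_betw_def
  proof
    show "inj_on (\<lambda>u. {v, u}) {u. {v, u} \<in> E}" by (auto simp: inj_on_def doubleton_eq_iff)
    show "(\<lambda>u. {v, u}) ` {u. {v, u} \<in> E} = {e \<in> E. v \<in> e}"
    proof (intro equalityI subsetI)
      fix e assume "e \<in> {e \<in> E. v \<in> e}"
      then obtain u where "e = {v, u}" "e \<in> E" using fgraph_edgeE[OF assms, of e v] by blast
      then show "e \<in> (\<lambda>u. {v, u}) ` {u. {v, u} \<in> E}" by blast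
    qed auto
  qed
  from bij_betw_same_card[OF this] show ?thesis unfolding degree_def by simp
qed

text \<open>Symmetric difference is addition modulo two. Walks are superposed and orientations are
  reversed in this way throughout.\<close>

lemma card_sym_diff_parity:
  assumes "finite X" "finite Y"
  shows "odd (card ((X - Y) \<union> (Y - X))) \<longleftrightarrow> odd (card X) \<noteq> odd (card Y)"
proof -
  have "card ((X - Y) \<union> (Y - X)) = card (X - Y) + card (Y - X)"
    using assms by (intro card_Un_disjoint) auto
  moreover have "card X = card (X - Y) + card (X \<inter> Y)" "card Y = card (Y - X) + card (X \<inter> Y)"
    using assms by (metis Int_commute card_Diff_subset_Int card_Int_Diff finite_Int add.commute)+
  ultimately show ?thesis by auto
qed

lemma degree_sym_diff_parity:
  assumes "finite E" "finite F"
  shows "odd (degree ((E - F) \<union> (F - E)) v) \<longleftrightarrow> odd (degree E v) \<noteq> odd (degree F v)"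
proof -
  have "{e \<in> (E - F) \<union> (F - E). v \<in> e} = ({e \<in> E. v \<in> e} - {e \<in> F. v \<in> e}) \<union> ({e \<in> F. v \<in> e} - {e \<in> E. v \<in> e})"
    by auto
  then show ?thesis unfolding degree_def using assms by (simp add: card_sym_diff_parity)
qed

lemma irregular_empty [simp]: "irregular {}" by (simp add: irregular_def)

lemma liI: "(\<And>u v. {u, v} \<in> E \<Longrightarrow> degree E u \<noteq> degree E v) \<Longrightarrow> irregular E"
  by (simp add: irregular_def)

lemma irregular_parityI:
  assumes "\<And>e. e \<in> E \<Longrightarrow> \<exists>u v. e = {u, v} \<and> even (degree E u) \<and> odd (degree E v)"
  shows "irregular E"
proof (rule liI)
  fix u v assume "{u, v} \<in> E"
  from assms[OF this] show "degree E u \<noteq> degree E v" by (auto simp: doubleton_eq_iff)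
qed

lemma splits_mono: "splits m E \<Longrightarrow> m \<le> n \<Longrightarrow> splits n E"
  unfolding splits_def by (meson order_less_le_trans)

lemma splits_irregular: "irregular E \<Longrightarrow> splits 1 E"
proof -
  assume "irregular E"
  then have "irregular {e \<in> E. 0 = i}" for i :: nat by (cases "i = 0") auto
  then show "splits 1 E" unfolding splits_def by (intro exI[of _ "\<lambda>_. 0"]) simp
qed

lemma splits_empty: "splits n {}"
  unfolding splits_def by auto

lemma splits_Un:
  assumes "splits m E" "splits n F" "E \<inter> F = {}"
  shows "splits (m + n) (E \<union> F)"
proof -
  obtain c d where c: "\<forall>e\<in>E. c e < m" "\<forall>i. irregular {e \<in> E. c e = i}"
    and d: "\<forall>e\<in>F. d e < n" "\<forall>i. irregular {e \<in> F. d e = i}"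
    using assms unfolding splits_def by blast
  let ?f = "\<lambda>e. if e \<in> E then c e else m + d e"
  have "{e \<in> E \<union> F. ?f e = i} = (if i < m then {e \<in> E. c e = i} else {e \<in> F. d e = i - m})" for i
    using assms(3) c(1) by auto
  then have "\<forall>i. irregular {e \<in> E \<union> F. ?f e = i}" using c(2) d(2) by simp
  moreover have "\<forall>e\<in>E \<union> F. ?f e < m + n" using c(1) d(1) by auto
  ultimately show ?thesis unfolding splits_def by (intro exI[of _ ?f]) blast
qed

lemma splits_UN:
  assumes "\<And>i. i < (k::nat) \<Longrightarrow> splits n (K i)" "\<And>i j. i < k \<Longrightarrow> j < k \<Longrightarrow> i \<noteq> j \<Longrightarrow> K i \<inter> K j = {}"
  shows "splits (n * k) (\<Union>i<k. K i)"
  using assms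
proof (induction k)
  case 0 show ?case by (simp add: splits_empty)
next
  case (Suc k)
  have "splits (n * k + n) ((\<Union>i<k. K i) \<union> K k)"
  proof (rule splits_Un)
    show "splits (n * k) (\<Union>i<k. K i)" using Suc by (meson less_SucI)
    show "splits n (K k)" using Suc.prems(1) by blast
    have "K i \<inter> K k = {}" if "i < k" for i using Suc.prems(2)[of i k] that by auto
    then show "(\<Union>i<k. K i) \<inter> K k = {}" by blast
  qed
  moreover have "(\<Union>i<Suc k. K i) = (\<Union>i<k. K i) \<union> K k" by (auto simp: less_Suc_eq)
  ultimately show ?case by (simp add: add.commute)
qed

text \<open>No edge of another part meets the vertices of \<open>K i\<close>, so degrees within a
  colour are those within \<open>K i\<close>, and all parts can use the same \<open>n\<close>
  colours.\<close>

lemma splits_vertex_disjoint: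
  assumes "\<And>i. i \<in> I \<Longrightarrow> splits n (K i)"
    and "\<And>i j e f. i \<in> I \<Longrightarrow> j \<in> I \<Longrightarrow> e \<in> K i \<Longrightarrow> f \<in> K j \<Longrightarrow> e \<inter> f \<noteq> {} \<Longrightarrow> i = j"
    and "\<And>i. i \<in> I \<Longrightarrow> {} \<notin> K i"
  shows "splits n (\<Union>i\<in>I. K i)"
proof -
  obtain c where c: "\<And>i. i \<in> I \<Longrightarrow> (\<forall>e\<in>K i. c i e < n) \<and> (\<forall>k. irregular {e \<in> K i. c i e = k})"
    using assms(1) unfolding splits_def by metis
  have "\<forall>e. \<exists>i. e \<in> (\<Union>i\<in>I. K i) \<longrightarrow> i \<in> I \<and> e \<in> K i" by blast
  then obtain ix where ix: "\<And>e. e \<in> (\<Union>i\<in>I. K i) \<Longrightarrow> ix e \<in> I \<and> e \<in> K (ix e)" by metis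
  define d where "d e = c (ix e) e" for e
  have ixeq: "ix e = i" if "e \<in> K i" "i \<in> I" for e i
    using assms(2)[of "ix e" i e e] assms(3) that ix[of e] by force
  let ?C = "\<lambda>k. {e \<in> (\<Union>i\<in>I. K i). d e = k}"
  have deg: "degree (?C k) v = degree {e \<in> K i. c i e = k} v"
    if "e \<in> K i" "i \<in> I" "v \<in> e" for e i v k
  proof (rule degree_cong)
    have "j = i" if "f \<in> K j" "j \<in> I" "v \<in> f" for f j
      using assms(2)[of i j e f] that \<open>e \<in> K i\<close> \<open>i \<in> I\<close> \<open>v \<in> e\<close> by auto
    then show "{f \<in> ?C k. v \<in> f} = {f \<in> {e \<in> K i. c i e = k}. v \<in> f}"
      using \<open>i \<in> I\<close> ixeq unfolding d_def by auto
  qed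
  have "irregular (?C k)" for k
  proof (rule liI)
    fix u v assume uv: "{u, v} \<in> ?C k"
    then obtain i where i: "i \<in> I" "{u, v} \<in> K i" by auto
    then have "c i {u, v} = k" using uv ixeq unfolding d_def by auto
    then have "degree {e \<in> K i. c i e = k} u \<noteq> degree {e \<in> K i. c i e = k} v"
      using c[OF i(1)] i(2) unfolding irregular_def by blast
    then show "degree (?C k) u \<noteq> degree (?C k) v"
      using deg[OF i(2,1)] by simp
  qed
  moreover have "\<forall>e\<in>(\<Union>i\<in>I. K i). d e < n" using c ix unfolding d_def by blast
  ultimately show ?thesis unfolding splits_def by blast
qed

section \<open>Greedy colouring\<close>

text \<open>Remove an element with at most \<open>n\<close> conflicts, colour the rest, and give it
  a free colour. The hypothesis is degeneracy and not a bound on all conflict numbers, because in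
  \<open>forest_matching_splits\<close> only the average number of conflicts is small.\<close>

lemma degenerate_colouring:
  assumes "finite P"
    and sym: "\<And>p q. R p q \<Longrightarrow> R q p"
    and "\<And>Q. Q \<subseteq> P \<Longrightarrow> Q \<noteq> {} \<Longrightarrow> \<exists>p\<in>Q. card {q \<in> Q. q \<noteq> p \<and> R p q} \<le> n"
  shows "\<exists>\<chi>. (\<forall>p\<in>P. \<chi> p < Suc n) \<and> (\<forall>p\<in>P. \<forall>q\<in>P. p \<noteq> q \<longrightarrow> R p q \<longrightarrow> \<chi> p \<noteq> \<chi> q)"
  using assms(1,3)
proof (induction "card P" arbitrary: P)
  case 0
  then show ?case by auto
next
  case (Suc m)
  then obtain p where p: "p \<in> P" "card {q \<in> P. q \<noteq> p \<and> R p q} \<le> n"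
    using Suc.prems(2)[of P] by fastforce
  let ?P = "P - {p}"
  have "m = card ?P" using Suc.hyps(2) Suc.prems(1) p(1) by simp
  moreover have "finite ?P" using Suc.prems(1) by simp
  moreover have "\<exists>p\<in>Q. card {q \<in> Q. q \<noteq> p \<and> R p q} \<le> n" if "Q \<subseteq> ?P" "Q \<noteq> {}" for Q
    using Suc.prems(2)[of Q] that by blast
  ultimately have "\<exists>\<chi>. (\<forall>p\<in>?P. \<chi> p < Suc n) \<and> (\<forall>p\<in>?P. \<forall>q\<in>?P. p \<noteq> q \<longrightarrow> R p q \<longrightarrow> \<chi> p \<noteq> \<chi> q)"
    by (rule Suc.hyps(1))
  then obtain \<chi> where \<chi>: "\<forall>p\<in>?P. \<chi> p < Suc n"
    "\<forall>p\<in>?P. \<forall>q\<in>?P. p \<noteq> q \<longrightarrow> R p q \<longrightarrow> \<chi> p \<noteq> \<chi> q" by blast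
  have "card (\<chi> ` {q \<in> P. q \<noteq> p \<and> R p q}) \<le> n"
    using p(2) card_image_le[of "{q \<in> P. q \<noteq> p \<and> R p q}" \<chi>] Suc.prems(1) by simp
  then have "\<not> {..<Suc n} \<subseteq> \<chi> ` {q \<in> P. q \<noteq> p \<and> R p q}"
    using Suc.prems(1) card_mono[of "\<chi> ` {q \<in> P. q \<noteq> p \<and> R p q}" "{..<Suc n}"] by fastforce
  then obtain k where k: "k < Suc n" "k \<notin> \<chi> ` {q \<in> P. q \<noteq> p \<and> R p q}" by blast
  let ?\<psi> = "\<chi>(p := k)"
  have "?\<psi> q \<noteq> ?\<psi> r" if "q \<in> P" "r \<in> P" "q \<noteq> r" "R q r" for q r
  proof (cases "q = p \<or> r = p")
    case True
    have "k \<noteq> \<chi> t" if "t \<in> P" "t \<noteq> p" "R p t" for t using k(2) that by blast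
    then show ?thesis using True that sym[of q r] by auto
  next
    case False
    then show ?thesis using \<chi>(2) that by simp
  qed
  moreover have "\<forall>q\<in>P. ?\<psi> q < Suc n" using \<chi>(1) k(1) by simp
  ultimately show ?case by blast
qed

text \<open>Pieces meeting a common vertex are in conflict; all other pieces may share a colour.\<close>

lemma splits_pieces:
  assumes "finite P" "\<And>p. p \<in> P \<Longrightarrow> irregular p" "\<And>p. p \<in> P \<Longrightarrow> fgraph p"
    and disj: "\<And>p q. p \<in> P \<Longrightarrow> q \<in> P \<Longrightarrow> p \<noteq> q \<Longrightarrow> p \<inter> q = {}"
    and small: "\<And>p. p \<in> P \<Longrightarrow> card (\<Union>p) \<le> s"
    and deg: "\<And>v. degree (\<Union>P) v \<le> D"
  shows "splits (s * D + 1) (\<Union>P)"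
proof -
  define R where "R p q \<longleftrightarrow> \<Union>p \<inter> \<Union>q \<noteq> {}" for p q :: "'a set set"
  have finP: "finite (\<Union>P)" using assms(1,3) unfolding fgraph_def by auto
  have pv: "card {q \<in> P. v \<in> \<Union>q} \<le> D" for v
  proof -
    have "\<forall>q. \<exists>e. q \<in> P \<and> v \<in> \<Union>q \<longrightarrow> e \<in> q \<and> v \<in> e" by blast
    then obtain f where f: "\<And>q. q \<in> P \<Longrightarrow> v \<in> \<Union>q \<Longrightarrow> f q \<in> q \<and> v \<in> f q" by metis
    have "inj_on f {q \<in> P. v \<in> \<Union>q}"
    proof (rule inj_onI)
      fix q r assume qr: "q \<in> {q \<in> P. v \<in> \<Union>q}" "r \<in> {q \<in> P. v \<in> \<Union>q}" "f q = f r"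
      then have "f q \<in> q \<inter> r" using f[of q] f[of r] by simp
      then show "q = r" using disj[of q r] qr by auto
    qed
    moreover have "f ` {q \<in> P. v \<in> \<Union>q} \<subseteq> {e \<in> \<Union>P. v \<in> e}" using f by auto
    moreover have "finite {e \<in> \<Union>P. v \<in> e}" by (rule finite_subset[OF _ finP]) auto
    ultimately have "card {q \<in> P. v \<in> \<Union>q} \<le> degree (\<Union>P) v"
      unfolding degree_def by (rule card_inj_on_le)
    then show ?thesis using deg[of v] by linarith
  qed
  \<comment> \<open>A piece has at most \<open>s\<close> vertices, and each of them lies in at most
    \<open>D\<close> pieces.\<close>
  have cnt: "card {q \<in> Q. q \<noteq> p \<and> R p q} \<le> s * D" if "Q \<subseteq> P" "p \<in> Q" for Q p
  proof -
    have finp: "finite (\<Union>p)" using assms(3) that finite_Union_fgraph by blast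
    have "{q \<in> Q. q \<noteq> p \<and> R p q} \<subseteq> (\<Union>v\<in>\<Union>p. {q \<in> P. v \<in> \<Union>q})"
      unfolding R_def using that by blast
    then have "card {q \<in> Q. q \<noteq> p \<and> R p q} \<le> card (\<Union>v\<in>\<Union>p. {q \<in> P. v \<in> \<Union>q})"
      using assms(1) by (intro card_mono finite_UN_I[OF finp]) (auto simp del: UN_simps)
    also have "\<dots> \<le> (\<Sum>v\<in>\<Union>p. card {q \<in> P. v \<in> \<Union>q})" by (rule card_UN_le[OF finp])
    also have "\<dots> \<le> card (\<Union>p) * D" using sum_bounded_above[of "\<Union>p" _ D] pv by simp
    also have "\<dots> \<le> s * D" using small that by (intro mult_right_mono) auto
    finally show ?thesis .
  qed
  have "\<exists>\<chi>. (\<forall>p\<in>P. \<chi> p < Suc (s * D)) \<and> (\<forall>p\<in>P. \<forall>q\<in>P. p \<noteq> q \<longrightarrow> R p q \<longrightarrow> \<chi> p \<noteq> \<chi> q)"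
  proof (rule degenerate_colouring[OF assms(1)])
    show "R q p" if "R p q" for p q using that unfolding R_def by (simp add: Int_commute)
    show "\<exists>p\<in>Q. card {q \<in> Q. q \<noteq> p \<and> R p q} \<le> s * D" if Q: "Q \<subseteq> P" "Q \<noteq> {}" for Q
    proof -
      from Q(2) obtain p where "p \<in> Q" by blast
      then show ?thesis using cnt[OF Q(1)] by blast
    qed
  qed
  then obtain \<chi> where \<chi>: "\<forall>p\<in>P. \<chi> p < Suc (s * D)" "\<forall>p\<in>P. \<forall>q\<in>P. p \<noteq> q \<longrightarrow> R p q \<longrightarrow> \<chi> p \<noteq> \<chi> q"
    by blast
  have "splits (1 * Suc (s * D)) (\<Union>k<Suc (s * D). \<Union>p\<in>{p\<in>P. \<chi> p = k}. p)"
  proof (rule splits_UN)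
    fix k assume "k < Suc (s * D)"
    show "splits 1 (\<Union>p\<in>{p\<in>P. \<chi> p = k}. p)"
    proof (rule splits_vertex_disjoint)
      show "splits 1 i" if "i \<in> {p \<in> P. \<chi> p = k}" for i using that assms(2) splits_irregular by blast
      show "i = j" if "i \<in> {p \<in> P. \<chi> p = k}" "j \<in> {p \<in> P. \<chi> p = k}" "e \<in> i" "f \<in> j" "e \<inter> f \<noteq> {}" for i j e f
        using that \<chi>(2) unfolding R_def by blast
      show "{} \<notin> i" if "i \<in> {p \<in> P. \<chi> p = k}" for i using that assms(3) fgraph_empty_notin by blast
    qed
  next
    fix i j assume "i \<noteq> (j::nat)"
    then show "(\<Union>p\<in>{p\<in>P. \<chi> p = i}. p) \<inter> (\<Union>p\<in>{p\<in>P. \<chi> p = j}. p) = {}"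
    proof (intro equalityI subsetI)
      fix e assume "e \<in> (\<Union>p\<in>{p\<in>P. \<chi> p = i}. p) \<inter> (\<Union>p\<in>{p\<in>P. \<chi> p = j}. p)"
      then obtain p q where "p \<in> P" "q \<in> P" "e \<in> p \<inter> q" "\<chi> p = i" "\<chi> q = j" by blast
      then show "e \<in> {}" using disj[of p q] \<open>i \<noteq> j\<close> by blast
    qed simp
  qed
  moreover have "(\<Union>k<Suc (s * D). \<Union>p\<in>{p\<in>P. \<chi> p = k}. p) = \<Union>P" using \<chi>(1) by auto
  ultimately show ?thesis by simp
qed

section \<open>Parity subgraphs and rooted forests\<close>

lemma sym_adj: "sym (adj E)"
  by (auto simp: sym_def adj_def insert_commute)

lemma adj_rtrancl_sym: "(u, v) \<in> (adj E)\<^sup>* \<Longrightarrow> (v, u) \<in> (adj E)\<^sup>*"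
  using sym_rtrancl[OF sym_adj] by (rule symD)

text \<open>The edges of the walk are added modulo two, so repeated edges cancel and only the two
  ends keep odd degree; no simple path has to be extracted.\<close>

lemma walk_join:
  assumes "fgraph E" "(u, v) \<in> (adj E)\<^sup>*"
  shows "\<exists>P\<subseteq>E. \<forall>w. odd (degree P w) \<longleftrightarrow> u \<noteq> v \<and> (w = u \<or> w = v)"
  using assms(2)
proof (induction rule: rtrancl_induct)
  case base
  show ?case by (intro exI[of _ "{}"]) (simp add: degree_def)
next
  case (step y z)
  then obtain P where P: "P \<subseteq> E" "\<And>w. odd (degree P w) \<longleftrightarrow> u \<noteq> y \<and> (w = u \<or> w = y)" by blast
  have yz: "{y, z} \<in> E" "y \<noteq> z" using step(2) fgraph_neq[OF assms(1)] by (auto simp: adj_def)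
  have d: "degree {{y, z}} w = (if w = y \<or> w = z then 1 else 0)" for w
  proof -
    have "{e \<in> {{y, z}}. w \<in> e} = (if w = y \<or> w = z then {{y, z}} else {})" by auto
    then show ?thesis by (simp add: degree_def)
  qed
  have fP: "finite P" using P(1) assms(1) finite_subset unfolding fgraph_def by blast
  let ?Q = "(P - {{y, z}}) \<union> ({{y, z}} - P)"
  have "odd (degree ?Q w) \<longleftrightarrow> u \<noteq> z \<and> (w = u \<or> w = z)" for w
    using degree_sym_diff_parity[OF fP, of "{{y, z}}" w] P(2)[of w] yz(2) by (auto simp: d split: if_splits)
  moreover have "?Q \<subseteq> E" using P(1) yz(1) by blast
  ultimately show ?case by blast
qed

lemma T_join:
  assumes "fgraph F" "finite T" "\<And>u. (u, x u) \<in> (adj F)\<^sup>*"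
  shows "\<exists>J\<subseteq>F. \<forall>v. v \<notin> x ` T \<longrightarrow> (odd (degree J v) \<longleftrightarrow> v \<in> T)"
  using assms(2)
proof (induction T)
  case empty
  show ?case by (intro exI[of _ "{}"]) (simp add: degree_def)
next
  case (insert u T)
  then obtain J where J: "J \<subseteq> F" "\<And>v. v \<notin> x ` T \<Longrightarrow> odd (degree J v) \<longleftrightarrow> v \<in> T" by blast
  obtain P where P: "P \<subseteq> F" "\<And>w. odd (degree P w) \<longleftrightarrow> u \<noteq> x u \<and> (w = u \<or> w = x u)"
    using walk_join[OF assms(1) assms(3)] by metis
  have fin: "finite J" "finite P" using J(1) P(1) assms(1) finite_subset unfolding fgraph_def by blast+
  let ?Q = "(J - P) \<union> (P - J)"
  have "odd (degree ?Q v) \<longleftrightarrow> v \<in> insert u T" if "v \<notin> x ` insert u T" for v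
    using degree_sym_diff_parity[OF fin, of v] J(2)[of v] P(2)[of v] that insert.hyps(2) by auto
  moreover have "?Q \<subseteq> F" using J(1) P(1) by blast
  ultimately show ?case by blast
qed

text \<open>Adjacent vertices reach the same vertices, so \<open>SOME\<close> picks the same one for
  both.\<close>

lemma component_representatives:
  "\<exists>r. (\<forall>v. (v, r v) \<in> (adj E)\<^sup>*) \<and> (\<forall>u v. {u, v} \<in> E \<longrightarrow> r u = r v)"
proof (intro exI conjI allI impI)
  let ?r = "\<lambda>v. SOME u. (v, u) \<in> (adj E)\<^sup>*"
  show "(v, ?r v) \<in> (adj E)\<^sup>*" for v by (rule someI[of _ v]) simp
  show "?r u = ?r v" if "{u, v} \<in> E" for u v
  proof -
    have "(u, v) \<in> (adj E)\<^sup>*" using that by (auto simp: adj_def)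
    then have "(u, w) \<in> (adj E)\<^sup>* \<longleftrightarrow> (v, w) \<in> (adj E)\<^sup>*" for w
      by (meson adj_rtrancl_sym rtrancl_trans)
    then show ?thesis by simp
  qed
qed

text \<open>Here \<open>r\<close>, \<open>l\<close> and \<open>p\<close> give the root, the level and the parent of a vertex.\<close>

definition rooted :: "'a set set \<Rightarrow> ('a \<Rightarrow> 'a) \<Rightarrow> ('a \<Rightarrow> nat) \<Rightarrow> ('a \<Rightarrow> 'a) \<Rightarrow> bool" where
  "rooted E r l p \<longleftrightarrow> (\<forall>v. l v = 0 \<longleftrightarrow> r v = v) \<and> (\<forall>v. l v \<noteq> 0 \<longrightarrow> {v, p v} \<in> E \<and> l v = Suc (l (p v)))
     \<and> (\<forall>u v. {u, v} \<in> E \<longrightarrow> r u = r v) \<and> (\<forall>u v. {u, v} \<in> E \<longrightarrow> l u \<le> Suc (l v))"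

definition forest :: "('a \<Rightarrow> nat) \<Rightarrow> ('a \<Rightarrow> 'a) \<Rightarrow> 'a set set" where
  "forest l p = {{v, p v} | v. l v \<noteq> 0}"

text \<open>The level of \<open>v\<close> is its distance from \<open>r v\<close>, so that
  \<open>forest l p\<close> consists of breadth-first search trees; this gives the bound
  \<open>l u \<le> Suc (l v)\<close> along edges. A vertex outside \<open>\<Union>E\<close> is its
  own root.\<close>

lemma rooted_exists:
  assumes "\<And>v. (v, r v) \<in> (adj E)\<^sup>*" "\<And>u v. {u, v} \<in> E \<Longrightarrow> r u = r v"
  shows "\<exists>l p. rooted E r l p"
proof -
  define l where "l v = (LEAST n. (v, r v) \<in> adj E ^^ n)" for v
  have l: "(v, r v) \<in> adj E ^^ l v" for v
    unfolding l_def using assms(1)[of v] by (metis LeastI_ex rtrancl_power)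
  have least: "l v \<le> n" if "(v, r v) \<in> adj E ^^ n" for v n
    unfolding l_def using that by (rule Least_le)
  \<comment> \<open>The first step of a shortest walk to the root lowers the distance by exactly
    one; its end becomes the parent.\<close>
  have "\<exists>u. {v, u} \<in> E \<and> l v = Suc (l u)" if "l v \<noteq> 0" for v
  proof -
    obtain k where k: "l v = Suc k" using \<open>l v \<noteq> 0\<close> not0_implies_Suc by blast
    then obtain u where u: "(v, u) \<in> adj E" "(u, r v) \<in> adj E ^^ k" using l[of v] relpow_Suc_D2 by metis
    then have ru: "{v, u} \<in> E" "r v = r u" using assms(2) by (auto simp: adj_def)
    then have "l u \<le> k" using least[of u k] u(2) by simp
    moreover have "l v \<le> Suc (l u)" using least[of v "Suc (l u)"] u(1) l[of u] ru(2) relpow_Suc_I2 by metis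
    ultimately show ?thesis using ru(1) k by auto
  qed
  then obtain p where p: "\<And>v. l v \<noteq> 0 \<Longrightarrow> {v, p v} \<in> E \<and> l v = Suc (l (p v))" by metis
  have "l v = 0 \<longleftrightarrow> r v = v" for v
  proof
    assume "l v = 0" then show "r v = v" using l[of v] by simp
  next
    assume "r v = v" then show "l v = 0" using least[of v 0] by simp
  qed
  moreover have "l u \<le> Suc (l v)" if "{u, v} \<in> E" for u v
  proof -
    have "(u, v) \<in> adj E" "(v, r u) \<in> adj E ^^ l v" using that l[of v] assms(2)[OF that] by (auto simp: adj_def)
    then show ?thesis using least[of u "Suc (l v)"] relpow_Suc_I2 by metis
  qed
  ultimately have "rooted E r l p" unfolding rooted_def
    by (intro conjI allI impI) (rule p p[THEN conjunct1] p[THEN conjunct2] assms(2) | assumption)+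
  then show ?thesis by blast
qed

lemma rooted_parent:
  "rooted E r l p \<Longrightarrow> l v \<noteq> 0 \<Longrightarrow> {v, p v} \<in> E \<and> l v = Suc (l (p v)) \<and> r (p v) = r v"
  unfolding rooted_def by metis

lemma forest_subset: "rooted E r l p \<Longrightarrow> forest l p \<subseteq> E"
  unfolding rooted_def forest_def by blast

lemma forest_reach:
  assumes "rooted E r l p"
  shows "(v, r v) \<in> (adj (forest l p))\<^sup>*"
proof (induction "l v" arbitrary: v)
  case 0
  then have "r v = v" using assms unfolding rooted_def by metis
  then show ?case by simp
next
  case (Suc n)
  then have "l v \<noteq> 0" by simp
  note par = rooted_parent[OF assms this]
  then have "(p v, r (p v)) \<in> (adj (forest l p))\<^sup>*" using Suc(1)[of "p v"] Suc(2) by simp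
  moreover have "(v, p v) \<in> adj (forest l p)" using \<open>l v \<noteq> 0\<close> unfolding adj_def forest_def by blast
  ultimately show ?case using par by (simp add: converse_rtrancl_into_rtrancl)
qed

lemma forest_edge:
  assumes "rooted E r l p" "e \<in> forest l p" "v \<in> e"
  shows "e = {v, p v} \<and> l v \<noteq> 0 \<and> l v = Suc (l (p v))
    \<or> (\<exists>w. e = {w, v} \<and> p w = v \<and> l w = Suc (l v) \<and> {w, v} \<in> E \<and> r w = r v)"
proof -
  obtain w where w: "e = {w, p w}" "l w \<noteq> 0" using assms(2) unfolding forest_def by blast
  then show ?thesis using rooted_parent[OF assms(1) w(2)] assms(3) by auto
qed

text \<open>In every component the open parity is put at a deepest vertex \<open>x v\<close>, which
  is a leaf of the breadth-first search tree. Joining the vertices of \<open>T\<close> to it by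
  walks in the tree prescribes all other parities. The exceptional vertices are those with
  \<open>x v = v\<close>; vertices outside \<open>\<Union>E\<close> are among them.\<close>

lemma leaf_forest:
  assumes "fgraph E"
  shows "\<exists>r l p x. rooted E r l p \<and> (\<forall>u v. {u, v} \<in> E \<longrightarrow> x u = x v) \<and> (\<forall>v. x (x v) = x v) \<and>
    (\<forall>v. degree (forest l p) (x v) \<le> 1) \<and>
    (\<forall>T. finite T \<longrightarrow> (\<exists>J\<subseteq>forest l p. \<forall>v. x v \<noteq> v \<longrightarrow> (odd (degree J v) \<longleftrightarrow> v \<in> T)))"
proof -
  obtain r where r: "\<forall>v. (v, r v) \<in> (adj E)\<^sup>*" "\<forall>u v. {u, v} \<in> E \<longrightarrow> r u = r v"
    using component_representatives[of E] by blast
  then obtain l p where lp: "rooted E r l p" using rooted_exists[of r E] by blast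
  let ?F = "forest l p"
  have fgF: "fgraph ?F" using forest_subset[OF lp] fgraph_subset[OF assms] by blast
  define deepest where "deepest v w \<longleftrightarrow> w \<in> \<Union>E \<and> r w = r v \<and> (\<forall>w'\<in>\<Union>E. r w' = r v \<longrightarrow> l w' \<le> l w)" for v w
  define x where "x v = (if v \<in> \<Union>E then (SOME w. deepest v w) else v)" for v
  have x: "deepest v (x v)" if "v \<in> \<Union>E" for v
  proof -
    let ?S = "{w \<in> \<Union>E. r w = r v}"
    have S: "finite ?S" "?S \<noteq> {}" using that by (auto intro: finite_subset[OF _ finite_Union_fgraph[OF assms]])
    obtain w where w: "w \<in> ?S" "l w = Max (l ` ?S)" using Max_in[of "l ` ?S"] S by (metis (no_types, lifting) finite_imageI imageE image_is_empty)
    have "deepest v w" unfolding deepest_def using w S(1) by auto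
    then show ?thesis unfolding x_def using that someI[of "deepest v" w] by simp
  qed
  have xeq: "x u = x v" if "r u = r v" "u \<in> \<Union>E" "v \<in> \<Union>E" for u v
    using that unfolding x_def deepest_def by simp
  have rx: "r (x v) = r v" for v
    by (cases "v \<in> \<Union>E") (use x[of v] in \<open>auto simp: deepest_def x_def\<close>)
  show ?thesis
  proof (rule exI[of _ r], rule exI[of _ l], rule exI[of _ p], rule exI[of _ x], intro conjI allI impI lp)
    show "x u = x v" if "{u, v} \<in> E" for u v using xeq[of u v] r(2) that by blast
    show "x (x v) = x v" for v
      by (cases "v \<in> \<Union>E") (use x[of v] xeq[OF rx] in \<open>auto simp: deepest_def x_def\<close>)
    show "degree ?F (x v) \<le> 1" for v
    proof (rule degree_le_1)
      show "finite ?F" using fgF unfolding fgraph_def by simp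
      \<comment> \<open>An edge at \<open>x v\<close> leads to the parent, since a child would lie
        deeper.\<close>
      have par: "e = {x v, p (x v)}" if e: "e \<in> ?F" "x v \<in> e" for e
      proof (rule ccontr)
        assume "e \<noteq> {x v, p (x v)}"
        then obtain w where w: "l w = Suc (l (x v))" "{w, x v} \<in> E" "r w = r (x v)"
          using forest_edge[OF lp e] by blast
        have "x v \<in> \<Union>E" "w \<in> \<Union>E" using w(2) by auto
        then have "v \<in> \<Union>E" unfolding x_def by (auto split: if_splits)
        then have "l w \<le> l (x v)" using x[of v] \<open>w \<in> \<Union>E\<close> w(3) rx[of v] unfolding deepest_def by auto
        then show False using w(1) by simp
      qed
      show "e = e'" if "e \<in> ?F" "e' \<in> ?F" "x v \<in> e" "x v \<in> e'" for e e'
        using par[OF that(1,3)] par[OF that(2,4)] by simp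
    qed
    show "\<exists>J\<subseteq>?F. \<forall>v. x v \<noteq> v \<longrightarrow> (odd (degree J v) \<longleftrightarrow> v \<in> T)" if T: "finite T" for T
    proof -
      have "(v, x v) \<in> (adj ?F)\<^sup>*" for v
        using forest_reach[OF lp, of v] adj_rtrancl_sym[OF forest_reach[OF lp, of "x v"]] rx[of v]
        by (simp add: rtrancl_trans)
      from T_join[OF fgF T this]
      obtain J where J: "J \<subseteq> ?F" "\<forall>v. v \<notin> x ` T \<longrightarrow> (odd (degree J v) \<longleftrightarrow> v \<in> T)" by blast
      have "v \<notin> x ` T" if "x v \<noteq> v" for v using \<open>\<And>v. x (x v) = x v\<close> that by auto
      then show ?thesis using J by (intro exI[of _ J]) simp
    qed
  qed
qed

section \<open>Bipartite and multipartite graphs\<close>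

text \<open>\<open>H\<close> consists of stars with centres in \<open>Z\<close>. A star is irregular
  unless it is a single edge, and the single edges are what \<open>R\<close> removes.\<close>

lemma star_forest:
  assumes "fgraph H"
    and Z: "\<And>e. e \<in> H \<Longrightarrow> \<exists>z w. e = {z, w} \<and> z \<in> Z \<and> w \<notin> Z"
    and leaf: "\<And>v. v \<notin> Z \<Longrightarrow> degree H v \<le> 1"
  shows "\<exists>R\<subseteq>H. irregular (H - R) \<and> (\<forall>v. degree R v \<le> 1)"
proof -
  define R where "R = {e \<in> H. \<exists>z\<in>Z. z \<in> e \<and> degree H z = 1}"
  have fH: "finite H" using assms(1) by (simp add: fgraph_def)
  have RH: "R \<subseteq> H" unfolding R_def by blast
  then have fR: "finite R" using fH finite_subset by blast
  have dR: "degree R v \<le> 1" for v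
  proof (cases "v \<in> Z")
    case False
    then show ?thesis using leaf[of v] degree_mono[OF fH RH, of v] by linarith
  next
    case True
    show ?thesis
    proof (rule degree_le_1[OF fR])
      fix e e' assume e: "e \<in> R" "e' \<in> R" "v \<in> e" "v \<in> e'"
      then obtain z where z: "z \<in> Z" "z \<in> e" "degree H z = 1" unfolding R_def by blast
      then have "z = v" using Z[of e] e(1,3) True unfolding R_def by auto
      then show "e = e'" using degree_le_1D[OF fH, of v e e'] z(3) e unfolding R_def by auto
    qed
  qed
  have "irregular (H - R)"
  proof (rule liI)
    \<comment> \<open>A centre with at least two edges loses none of them, while its leaves have
      degree one.\<close>
    have *: "degree (H - R) w \<noteq> degree (H - R) z" if zw: "{z, w} \<in> H - R" "z \<in> Z" "w \<notin> Z" for z w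
    proof -
      have d1: "degree H z \<noteq> 1" using zw unfolding R_def by blast
      have "{e \<in> H - R. z \<in> e} = {e \<in> H. z \<in> e}"
      proof -
        have "e \<notin> R" if "e \<in> H" "z \<in> e" for e
        proof
          assume "e \<in> R"
          then obtain z' where z': "z' \<in> Z" "z' \<in> e" "degree H z' = 1" unfolding R_def by blast
          then have "z' = z" using Z[OF that(1)] that(2) zw(2) by auto
          then show False using z'(3) d1 by simp
        qed
        then show ?thesis by blast
      qed
      then have "degree (H - R) z = degree H z" by (rule degree_cong)
      moreover have "degree H z \<ge> 1" using degree_pos[OF fH, of "{z, w}" z] zw(1) by blast
      moreover have "degree (H - R) w \<le> 1" using leaf[OF zw(3)] degree_mono[OF fH, of "H - R" w] by auto
      ultimately show ?thesis using d1 by linarith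
    qed
    fix u v assume uv: "{u, v} \<in> H - R"
    then obtain z w where zw: "{u, v} = {z, w}" "z \<in> Z" "w \<notin> Z" using Z[of "{u, v}"] by blast
    then have "degree (H - R) w \<noteq> degree (H - R) z" using *[of z w] uv by simp
    then show "degree (H - R) u \<noteq> degree (H - R) v" using zw(1) by (auto simp: doubleton_eq_iff)
  qed
  then show ?thesis using RH dR by (intro exI[of _ R]) simp
qed

text \<open>Sort the tree edges by the parity of the level of the child. In each of the two classes
  a vertex is either a centre joined to children or a leaf joined to its parent, so
  \<open>star_forest\<close> applies to both.\<close>

lemma forest_two_star_forests:
  assumes "rooted E r l p" "fgraph E" "K \<subseteq> forest l p"
  shows "\<exists>R\<subseteq>K. splits 2 (K - R) \<and> (\<forall>v. degree R v \<le> 2)"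
proof -
  define H where "H i = K \<inter> {{v, p v} | v. l v \<noteq> 0 \<and> l v mod 2 = i}" for i
  have H_E: "\<exists>v. e = {v, p v} \<and> l v \<noteq> 0 \<and> l v mod 2 = i" if "e \<in> H i" for e i
    using that unfolding H_def by simp
  have fgK: "fgraph K" using assms forest_subset[OF assms(1)] fgraph_subset by blast
  have "\<exists>R\<subseteq>H i. irregular (H i - R) \<and> (\<forall>v. degree R v \<le> 1)" for i
  proof -
    have fgH: "fgraph (H i)" using fgK fgraph_subset unfolding H_def by blast
    then have fH: "finite (H i)" unfolding fgraph_def by blast
    have "\<exists>z w. e = {z, w} \<and> z \<in> {v. l v mod 2 \<noteq> i} \<and> w \<notin> {v. l v mod 2 \<noteq> i}" if eH: "e \<in> H i" for e
    proof -
      obtain v where v: "e = {v, p v}" "l v \<noteq> 0" "l v mod 2 = i" using H_E[OF eH] by blast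
      then have "l (p v) mod 2 \<noteq> i" using rooted_parent[OF assms(1) v(2)] by (auto simp: mod_Suc split: if_splits)
      then show ?thesis using v by blast
    qed
    moreover have "degree (H i) v \<le> 1" if "v \<notin> {v. l v mod 2 \<noteq> i}" for v
    proof (rule degree_le_1[OF fH])
      have par: "e = {v, p v}" if ev: "e \<in> H i" "v \<in> e" for e
      proof -
        obtain w where w: "e = {w, p w}" "l w \<noteq> 0" "l w mod 2 = i" using H_E[OF ev(1)] by blast
        have "v \<noteq> p w"
          using rooted_parent[OF assms(1) w(2)] w(3) \<open>v \<notin> {v. l v mod 2 \<noteq> i}\<close> by (auto simp: mod_Suc split: if_splits)
        then show ?thesis using w ev(2) by auto
      qed
      show "e = e'" if "e \<in> H i" "e' \<in> H i" "v \<in> e" "v \<in> e'" for e e'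
        using par[OF that(1,3)] par[OF that(2,4)] by simp
    qed
    ultimately show ?thesis by (rule star_forest[OF fgH])
  qed
  then obtain R where R: "\<And>i. R i \<subseteq> H i" "\<And>i. irregular (H i - R i)" "\<And>i v. degree (R i) v \<le> 1" by metis
  have disj: "H 0 \<inter> H 1 = {}"
  proof (rule equals0I)
    fix e assume "e \<in> H 0 \<inter> H 1"
    then have "e \<in> H 0" "e \<in> H 1" by simp_all
    obtain v where v: "e = {v, p v}" "l v \<noteq> 0" "l v mod 2 = 0" using H_E[OF \<open>e \<in> H 0\<close>] by (elim exE conjE) (rule that)
    obtain w where w: "e = {w, p w}" "l w \<noteq> 0" "l w mod 2 = 1" using H_E[OF \<open>e \<in> H 1\<close>] by (elim exE conjE) (rule that)
    have "v \<noteq> w" using v(3) w(3) by auto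
    then have "p v = w" "p w = v" using v(1) w(1) by (auto simp: doubleton_eq_iff)
    then show False using rooted_parent[OF assms(1) v(2)] rooted_parent[OF assms(1) w(2)] by simp
  qed
  have K: "K = H 0 \<union> H 1"
  proof
    show "K \<subseteq> H 0 \<union> H 1"
    proof
      fix e assume "e \<in> K"
      then obtain v where "e = {v, p v}" "l v \<noteq> 0" using assms(3) unfolding forest_def by blast
      then show "e \<in> H 0 \<union> H 1" using \<open>e \<in> K\<close> unfolding H_def by (cases "l v mod 2 = 0") auto
    qed
  qed (auto simp: H_def)
  show ?thesis
  proof (intro exI[of _ "R 0 \<union> R 1"] conjI allI)
    show "R 0 \<union> R 1 \<subseteq> K" using R(1) K by blast
    have "splits (1 + 1) ((H 0 - R 0) \<union> (H 1 - R 1))" using R(2) disj by (intro splits_Un splits_irregular) auto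
    moreover have "K - (R 0 \<union> R 1) = (H 0 - R 0) \<union> (H 1 - R 1)" using K disj R(1) by blast
    ultimately show "splits 2 (K - (R 0 \<union> R 1))" by (simp add: numeral_2_eq_2)
    have "R i \<subseteq> K" for i using R(1)[of i] unfolding H_def by blast
    then have "finite (R i)" for i using fgK finite_subset[of "R i" K] unfolding fgraph_def by simp
    then have "degree (R 0 \<union> R 1) v = degree (R 0) v + degree (R 1) v" for v
      using R(1)[of 0] R(1)[of 1] disj by (intro degree_Un) blast+
    then show "degree (R 0 \<union> R 1) v \<le> 2" for v using R(3)[of 0 v] R(3)[of 1 v] by simp
  qed
qed

lemma bipartite_splits:
  assumes "fgraph E" and bip: "\<And>e. e \<in> E \<Longrightarrow> \<exists>a b. e = {a, b} \<and> a \<in> A \<and> b \<notin> A"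
  shows "\<exists>R\<subseteq>E. splits 4 (E - R) \<and> (\<forall>v. degree R v \<le> 3)"
proof -
  obtain r l p x where tree: "rooted E r l p"
    and x: "\<forall>u v. {u, v} \<in> E \<longrightarrow> x u = x v" "\<forall>v. x (x v) = x v" "\<forall>v. degree (forest l p) (x v) \<le> 1"
    and join: "\<forall>T. finite T \<longrightarrow> (\<exists>J\<subseteq>forest l p. \<forall>v. x v \<noteq> v \<longrightarrow> (odd (degree J v) \<longleftrightarrow> v \<in> T))"
    using leaf_forest[OF assms(1)] by (elim exE conjE) (rule that)
  define F where "F = forest l p"
  define S where "S = {e \<in> E - F. \<exists>v\<in>e. x v = v}"
  define N where "N = E - F - S"
  \<comment> \<open>The side of the exceptional leaf has to be the odd one: only its tree edge can
    lie in \<open>G\<close>, so a leaf that occurs in \<open>G\<close> has degree 1 there.\<close>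
  define Odd where "Odd = {v. (v \<in> A) = (x v \<in> A)}"
  have FE: "F \<subseteq> E" unfolding F_def by (rule forest_subset[OF tree])
  have finE: "finite E" using assms(1) by (simp add: fgraph_def)
  have fin: "finite K" if "K \<subseteq> E" for K using finE that by (rule rev_finite_subset)
  have fgS: "fgraph S" by (rule fgraph_subset[OF assms(1)]) (auto simp: S_def)
  have Sedge: "e = {x v, v}" if e: "e \<in> S" "v \<in> e" "x v \<noteq> v" for e v
  proof -
    obtain w where w: "e = {v, w}" using fgraph_edgeE[OF fgS e(1,2)] by metis
    then have "x v = x w" using x(1)[rule_format, of v w] e(1) unfolding S_def by blast
    moreover have "x w = w" using e w unfolding S_def by auto
    ultimately show ?thesis using w by (simp add: insert_commute)
  qed
  have "\<exists>z w. e = {z, w} \<and> z \<in> {v. x v = v} \<and> w \<notin> {v. x v = v}" if e: "e \<in> S" for e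
  proof -
    obtain z where z: "z \<in> e" "x z = z" using e unfolding S_def by blast
    obtain w where w: "e = {z, w}" "z \<noteq> w" using fgraph_edgeE[OF fgS e z(1)] by metis
    then have "x w = z" using x(1)[rule_format, of z w] z(2) e unfolding S_def by auto
    then show ?thesis using w z(2) by auto
  qed
  moreover have "degree S v \<le> 1" if "v \<notin> {v. x v = v}" for v
  proof (rule degree_le_1)
    show "finite S" using fgS by (simp add: fgraph_def)
    show "e = e'" if "e \<in> S" "e' \<in> S" "v \<in> e" "v \<in> e'" for e e'
      using Sedge[of e v] Sedge[of e' v] that \<open>v \<notin> {v. x v = v}\<close> by simp
  qed
  ultimately have "\<exists>R\<subseteq>S. irregular (S - R) \<and> (\<forall>v. degree R v \<le> 1)" by (rule star_forest[OF fgS])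
  then obtain RS where RS: "RS \<subseteq> S" "irregular (S - RS)" "\<And>v. degree RS v \<le> 1" by blast
  let ?T = "{v \<in> \<Union>E. odd (degree N v) \<noteq> (v \<in> Odd)}"
  have "finite ?T" using finite_Union_fgraph[OF assms(1)] by (rule rev_finite_subset) auto
  from join[rule_format, OF this] obtain J
    where J0: "J \<subseteq> forest l p" "\<forall>v. x v \<noteq> v \<longrightarrow> (odd (degree J v) \<longleftrightarrow> v \<in> ?T)"
    by (elim exE conjE) (rule that)
  note J = J0(1)[folded F_def] J0(2)[rule_format]
  define G where "G = N \<union> J"
  have degG: "degree G v = degree N v + degree J v" for v
    unfolding G_def using J(1) FE fin by (intro degree_Un) (auto simp: N_def)
  have par: "odd (degree G v) \<longleftrightarrow> v \<in> Odd" if "e \<in> G" "v \<in> e" for e v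
  proof (cases "x v = v")
    case False
    have "v \<in> \<Union>E" using that J(1) FE unfolding G_def N_def by blast
    then show ?thesis using degG[of v] J(2)[OF False] by auto
  next
    case True
    have "v \<notin> \<Union>N" using True unfolding N_def S_def by blast
    then have "degree N v = 0" using degree_eq_0[of N v] fin unfolding N_def by blast
    moreover have "e \<in> J" using that \<open>v \<notin> \<Union>N\<close> unfolding G_def by blast
    then have "degree J v \<ge> 1" using degree_pos[of J e v] that(2) J(1) FE fin by blast
    moreover have "degree J v \<le> 1"
      using degree_mono[OF fin[OF FE] J(1), of v] x(3)[rule_format, of v] True unfolding F_def by simp
    ultimately show ?thesis using True degG[of v] unfolding Odd_def by simp
  qed
  have GE: "G \<subseteq> E" using J(1) FE unfolding G_def N_def by blast
  have "irregular G"
  proof (rule irregular_parityI)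
    fix e assume e: "e \<in> G"
    obtain a b where ab: "e = {a, b}" "a \<in> A" "b \<notin> A" using bip e GE by blast
    then have "x a = x b" using x(1)[rule_format, of a b] e GE by blast
    then have "a \<in> Odd \<longleftrightarrow> b \<notin> Odd" using ab unfolding Odd_def by auto
    then show "\<exists>u v. e = {u, v} \<and> even (degree G u) \<and> odd (degree G v)"
      using par[OF e, of a] par[OF e, of b] ab(1) by (metis insert_commute insertCI)
  qed
  obtain RF where RF: "RF \<subseteq> F - J" "splits 2 (F - J - RF)" "\<And>v. degree RF v \<le> 2"
    using forest_two_star_forests[OF tree assms(1), of "F - J"] unfolding F_def by blast
  have disj: "S \<inter> G = {}" "(S \<union> G) \<inter> (F - J) = {}" and un: "E = S \<union> G \<union> (F - J)"
    using J(1) FE unfolding S_def G_def N_def by auto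
  have "splits (1 + 1 + 2) ((S - RS) \<union> G \<union> (F - J - RF))"
    using RS(2) \<open>irregular G\<close> RF(2) disj by (intro splits_Un splits_irregular) auto
  moreover have "E - (RS \<union> RF) = (S - RS) \<union> G \<union> (F - J - RF)" using disj un RS(1) RF(1) by blast
  ultimately have "splits 4 (E - (RS \<union> RF))" by (simp add: eval_nat_numeral)
  moreover have "degree (RS \<union> RF) v \<le> 3" for v
  proof -
    have "degree (RS \<union> RF) v = degree RS v + degree RF v"
      using RS(1) RF(1) disj un by (intro degree_Un fin) auto
    then show ?thesis using RS(3)[of v] RF(3)[of v] by simp
  qed
  moreover have "RS \<union> RF \<subseteq> E" using RS(1) RF(1) un by blast
  ultimately show ?thesis by blast
qed

lemma multipartite_splits:
  assumes "fgraph E" "\<And>u v. {u, v} \<in> E \<Longrightarrow> \<kappa> u \<noteq> \<kappa> v" "\<And>v. \<kappa> v < (2::nat) ^ t"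
  shows "\<exists>R\<subseteq>E. splits (4 * t) (E - R) \<and> (\<forall>v. degree R v \<le> 3 * t)"
  using assms
proof (induction t arbitrary: E \<kappa>)
  case 0
  have "E = {}"
  proof (rule ccontr)
    assume "E \<noteq> {}"
    then obtain u v where "{u, v} \<in> E" using fgraph_edgeE2[OF 0(1)] by (metis all_not_in_conv)
    then show False using 0(2)[of u v] 0(3)[of u] 0(3)[of v] by simp
  qed
  then show ?case by (simp add: splits_empty degree_def)
next
  case (Suc t)
  define E1 where "E1 = {e \<in> E. \<exists>u v. e = {u, v} \<and> \<kappa> u < 2 ^ t \<and> \<not> \<kappa> v < 2 ^ t}"
  define \<kappa>' where "\<kappa>' v = (if \<kappa> v < 2 ^ t then \<kappa> v else \<kappa> v - 2 ^ t)" for v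
  have fg: "fgraph E1" "fgraph (E - E1)" by (rule fgraph_subset[OF Suc.prems(1)], auto simp: E1_def)+
  have "\<exists>R\<subseteq>E1. splits 4 (E1 - R) \<and> (\<forall>v. degree R v \<le> 3)"
    by (rule bipartite_splits[OF fg(1), of "{v. \<kappa> v < 2 ^ t}"]) (auto simp: E1_def)
  then obtain R1 where R1: "R1 \<subseteq> E1" "splits 4 (E1 - R1)" "\<And>v. degree R1 v \<le> 3" by blast
  have "\<exists>R\<subseteq>E - E1. splits (4 * t) (E - E1 - R) \<and> (\<forall>v. degree R v \<le> 3 * t)"
  proof (rule Suc.IH[OF fg(2)])
    show "\<kappa>' v < 2 ^ t" for v using Suc.prems(3)[of v] by (auto simp: \<kappa>'_def)
    show "\<kappa>' u \<noteq> \<kappa>' v" if uv: "{u, v} \<in> E - E1" for u v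
    proof -
      have "\<kappa> u < 2 ^ t \<longleftrightarrow> \<kappa> v < 2 ^ t" using uv unfolding E1_def by (auto simp: insert_commute)
      then show ?thesis using Suc.prems(2)[of u v] uv by (auto simp: \<kappa>'_def)
    qed
  qed
  then obtain R2 where R2: "R2 \<subseteq> E - E1" "splits (4 * t) (E - E1 - R2)" "\<And>v. degree R2 v \<le> 3 * t" by blast
  have finE: "finite E" using Suc.prems(1) by (simp add: fgraph_def)
  have E1: "E1 \<subseteq> E" unfolding E1_def by blast
  have "splits (4 + 4 * t) ((E1 - R1) \<union> (E - E1 - R2))" using R1(2) R2(2) by (intro splits_Un) auto
  moreover have "E - (R1 \<union> R2) = (E1 - R1) \<union> (E - E1 - R2)" using R1(1) R2(1) E1 by blast
  moreover have "degree (R1 \<union> R2) v \<le> 3 * Suc t" for v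
  proof -
    have "degree (R1 \<union> R2) v = degree R1 v + degree R2 v"
      using R1(1) R2(1) E1 finite_subset[OF _ finE] by (intro degree_Un) blast+
    then show ?thesis using R1(3)[of v] R2(3)[of v] by simp
  qed
  moreover have "R1 \<union> R2 \<subseteq> E" using R1(1) R2(1) E1 by blast
  ultimately show ?case by (intro exI[of _ "R1 \<union> R2"]) simp
qed

section \<open>Cuts and balanced choices\<close>

text \<open>\<open>\<kappa>\<close> minimises the number of monochromatic edges. Recolouring one
  vertex \<open>v\<close> with \<open>j\<close> trades its edges inside its own class for those to
  class \<open>j\<close>, which cannot be an improvement.\<close>

lemma locally_optimal_cut:
  assumes "fgraph E" "(k::nat) \<ge> 1"
  shows "\<exists>\<kappa>. (\<forall>v. \<kappa> v < k) \<and>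
    (\<forall>v j. j < k \<longrightarrow> card {u. {v, u} \<in> E \<and> \<kappa> u = \<kappa> v} \<le> card {u. {v, u} \<in> E \<and> \<kappa> u = j})"
proof -
  have finE: "finite E" using assms(1) by (simp add: fgraph_def)
  define mono where "mono \<kappa> = {e \<in> E. \<exists>i. \<forall>v\<in>e. \<kappa> v = i}" for \<kappa> :: "'a \<Rightarrow> nat"
  have "\<exists>\<kappa>. (\<forall>v. \<kappa> v < k) \<and> (\<forall>\<kappa>'. (\<forall>v. \<kappa>' v < k) \<longrightarrow> card (mono \<kappa>) \<le> card (mono \<kappa>'))"
    using ex_has_least_nat[of "\<lambda>\<kappa>. \<forall>v. \<kappa> v < k" "\<lambda>_. 0" "\<lambda>\<kappa>. card (mono \<kappa>)"] assms(2) by auto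
  then obtain \<kappa> where \<kappa>: "\<forall>v. \<kappa> v < k"
    and least: "\<forall>\<kappa>'. (\<forall>v. \<kappa>' v < k) \<longrightarrow> card (mono \<kappa>) \<le> card (mono \<kappa>')"
    by (elim exE conjE) (rule that)
  have "card {u. {v, u} \<in> E \<and> \<kappa> u = \<kappa> v} \<le> card {u. {v, u} \<in> E \<and> \<kappa> u = j}" if j: "j < k" for v j
  proof (cases "j = \<kappa> v")
    case False
    let ?A = "(\<lambda>u. {v, u}) ` {u. {v, u} \<in> E \<and> \<kappa> u = \<kappa> v}"
    let ?B = "(\<lambda>u. {v, u}) ` {u. {v, u} \<in> E \<and> \<kappa> u = j}"
    have inj: "inj_on (\<lambda>u. {v, u}) X" for X :: "'a set" by (auto simp: inj_on_def doubleton_eq_iff)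
    have fin: "finite (mono \<kappa>)" "finite ?B" using finE unfolding mono_def by (auto intro: finite_subset[OF _ finE])
    have A: "?A \<subseteq> mono \<kappa>" unfolding mono_def by auto
    have sub: "mono (\<kappa>(v := j)) \<subseteq> (mono \<kappa> - ?A) \<union> ?B"
    proof
      fix e assume e: "e \<in> mono (\<kappa>(v := j))"
      then obtain i where eE: "e \<in> E" and i: "\<And>w. w \<in> e \<Longrightarrow> (\<kappa>(v := j)) w = i" unfolding mono_def by blast
      show "e \<in> (mono \<kappa> - ?A) \<union> ?B"
      proof (cases "v \<in> e")
        case True
        then obtain u where u: "e = {v, u}" "v \<noteq> u" using fgraph_edgeE[OF assms(1) eE] by metis
        then have "\<kappa> u = j" using i[of v] i[of u] by auto
        then have "e \<in> ?B" using u eE by (intro image_eqI[of _ _ u]) auto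
        then show ?thesis by simp
      next
        case F: False
        then have "\<forall>w\<in>e. \<kappa> w = i" using i by (metis fun_upd_other)
        then have "e \<in> mono \<kappa>" using eE unfolding mono_def by blast
        moreover have "e \<notin> ?A" using F by auto
        ultimately show ?thesis by simp
      qed
    qed
    have "card (mono \<kappa>) \<le> card (mono (\<kappa>(v := j)))" using least[rule_format, of "\<kappa>(v := j)"] \<kappa> j by simp
    also have "\<dots> \<le> card ((mono \<kappa> - ?A) \<union> ?B)" using sub fin by (intro card_mono) auto
    also have "\<dots> \<le> card (mono \<kappa> - ?A) + card ?B" by (rule card_Un_le)
    also have "\<dots> = card (mono \<kappa>) - card ?A + card ?B" using A fin(1) by (simp add: card_Diff_subset finite_subset)
    finally have "card ?A \<le> card ?B" using card_mono[OF fin(1) A] by linarith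
    then show ?thesis by (simp add: card_image[OF inj])
  qed simp
  then show ?thesis using \<kappa> by (intro exI[of _ \<kappa>]) simp
qed

text \<open>Read the pairs as edges \<open>{c w, d w}\<close>: this is an orientation with even in-degrees, up to one
  leaf-like vertex per component.\<close>

lemma parity_choice:
  assumes "finite W" "\<And>w. w \<in> W \<Longrightarrow> c w \<noteq> d w"
  shows "\<exists>s. (\<forall>w\<in>W. s w = c w \<or> s w = d w) \<and>
    (\<forall>y. even (card {w \<in> W. s w = y}) \<or> card {w \<in> W. s w = y} \<le> 1)"
proof -
  define E where "E = (\<lambda>w. {c w, d w}) ` W"
  have fgE: "fgraph E" unfolding fgraph_def E_def using assms by auto
  obtain r l p x where tree: "rooted E r l p"
    and x: "\<forall>u v. {u, v} \<in> E \<longrightarrow> x u = x v" "\<forall>v. x (x v) = x v" "\<forall>v. degree (forest l p) (x v) \<le> 1"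
    and join: "\<forall>T. finite T \<longrightarrow> (\<exists>J\<subseteq>forest l p. \<forall>v. x v \<noteq> v \<longrightarrow> (odd (degree J v) \<longleftrightarrow> v \<in> T))"
    using leaf_forest[OF fgE] by (elim exE conjE) (rule that)
  define F where "F = forest l p"
  have FE: "F \<subseteq> E" unfolding F_def by (rule forest_subset[OF tree])
  have finF: "finite F" using FE assms(1) finite_subset unfolding E_def by blast
  \<comment> \<open>Several \<open>w\<close> may give the same edge; \<open>\<omega>\<close> selects
    one of them for each edge, and only selected ones are flipped later.\<close>
  have "\<forall>e. \<exists>w. e \<in> E \<longrightarrow> w \<in> W \<and> {c w, d w} = e" unfolding E_def by blast
  then obtain \<omega> where \<omega>: "\<And>e. e \<in> E \<Longrightarrow> \<omega> e \<in> W \<and> {c (\<omega> e), d (\<omega> e)} = e" by metis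
  have inj: "inj_on \<omega> E" by (rule inj_onI) (metis \<omega>)
  \<comment> \<open>At the start a pair that does not represent a tree edge avoids the exceptional
    vertex; this is possible because a component has only one.\<close>
  define s0 where "s0 w = (if w \<notin> \<omega> ` F \<and> x (c w) = c w then d w else c w)" for w
  let ?T = "{v \<in> c ` W \<union> d ` W. odd (card {w \<in> W. s0 w = v})}"
  have "finite ?T" using assms(1) by simp
  from join[rule_format, OF this] obtain J
    where J0: "J \<subseteq> forest l p" "\<forall>v. x v \<noteq> v \<longrightarrow> (odd (degree J v) \<longleftrightarrow> v \<in> ?T)"
    by (elim exE conjE) (rule that)
  note J = J0(1)[folded F_def] J0(2)[rule_format]
  define s where "s w = (if w \<in> \<omega> ` J then (if s0 w = c w then d w else c w) else s0 w)" for w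
  have JW: "\<omega> ` J \<subseteq> W" using J(1) FE \<omega> by blast
  have "even (card {w \<in> W. s w = y}) \<or> card {w \<in> W. s w = y} \<le> 1" for y
  proof (cases "x y = y")
    case False
    let ?X = "{w \<in> W. s0 w = y}" and ?Y = "{w \<in> \<omega> ` J. c w = y \<or> d w = y}"
    \<comment> \<open>Flipping \<open>w\<close> matters at \<open>y\<close> exactly if
      \<open>y\<close> is one of its two options.\<close>
    have eq: "{w \<in> W. s w = y} = (?X - ?Y) \<union> (?Y - ?X)"
    proof (intro equalityI subsetI)
      fix w assume "w \<in> {w \<in> W. s w = y}"
      then show "w \<in> (?X - ?Y) \<union> (?Y - ?X)" using assms(2)[of w] by (auto simp: s_def s0_def split: if_splits)
    next
      fix w assume "w \<in> (?X - ?Y) \<union> (?Y - ?X)"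
      then show "w \<in> {w \<in> W. s w = y}" using assms(2)[of w] JW by (auto simp: s_def s0_def split: if_splits)
    qed
    have "(c (\<omega> e) = y \<or> d (\<omega> e) = y) \<longleftrightarrow> y \<in> e" if "e \<in> J" for e
    proof -
      have "{c (\<omega> e), d (\<omega> e)} = e" using \<omega> that J(1) FE by auto
      then have "y \<in> {c (\<omega> e), d (\<omega> e)} \<longleftrightarrow> y \<in> e" by simp
      then show ?thesis by auto
    qed
    then have Y: "?Y = \<omega> ` {e \<in> J. y \<in> e}" by auto
    have "inj_on \<omega> {e \<in> J. y \<in> e}" using J(1) FE by (intro inj_on_subset[OF inj]) auto
    then have cY: "card ?Y = degree J y" unfolding degree_def Y by (rule card_image)
    have fin: "finite ?X" "finite ?Y" using assms(1) finite_subset[OF JW] by auto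
    have "y \<in> c ` W \<union> d ` W" if "odd (card ?X)"
    proof -
      have "?X \<noteq> {}" using that by fastforce
      then show ?thesis unfolding s0_def by auto
    qed
    then have "odd (degree J y) \<longleftrightarrow> odd (card ?X)" using J(2)[OF False] by auto
    then show ?thesis using card_sym_diff_parity[OF fin] unfolding eq cY by simp
  next
    case True
    \<comment> \<open>At the leaf \<open>y\<close> only the pair of its single tree edge can choose
      \<open>y\<close>.\<close>
    have "{w \<in> W. s w = y} \<subseteq> \<omega> ` {e \<in> F. y \<in> e}"
    proof
      fix w assume "w \<in> {w \<in> W. s w = y}"
      then have w: "w \<in> W" "s w = y" by auto
      then have xcd: "x (c w) = x (d w)" using x(1) unfolding E_def by blast
      have "w \<in> \<omega> ` F"
      proof (rule ccontr)
        assume nF: "w \<notin> \<omega> ` F"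
        then have "s w = s0 w" using J(1) unfolding s_def by auto
        then have "x (s0 w) = s0 w" using w(2) True by simp
        then show False using nF xcd assms(2)[OF w(1)] unfolding s0_def by (auto split: if_splits)
      qed
      then obtain e where e: "e \<in> F" "w = \<omega> e" by blast
      then have "{c w, d w} = e" using \<omega> FE by blast
      moreover have "y \<in> {c w, d w}" using w(2) unfolding s_def s0_def by (auto split: if_splits)
      ultimately show "w \<in> \<omega> ` {e \<in> F. y \<in> e}" using e by blast
    qed
    then have "card {w \<in> W. s w = y} \<le> card {e \<in> F. y \<in> e}" using finF by (intro surj_card_le) auto
    also have "\<dots> \<le> 1" using x(3)[rule_format, of y] True unfolding F_def degree_def by simp
    finally show ?thesis by blast
  qed
  moreover have "\<forall>w\<in>W. s w = c w \<or> s w = d w" unfolding s_def s0_def by simp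
  ultimately show ?thesis by blast
qed

text \<open>Splitting every vertex into vertices of degree three turns even in-degrees into in-degrees
  at most two out of three.\<close>

lemma balanced_choice:
  assumes "finite B" "\<And>b. b \<in> B \<Longrightarrow> f b \<noteq> g b"
  shows "\<exists>s. (\<forall>b\<in>B. s b = f b \<or> s b = g b) \<and>
    (\<forall>a. 3 * card {b \<in> B. s b = a} \<le> 2 * card {b \<in> B. f b = a \<or> g b = a} + 2)"
proof -
  define I where "I a = {b \<in> B. f b = a \<or> g b = a}" for a
  have finI: "finite (I a)" for a using assms(1) unfolding I_def by simp
  have "\<forall>a. \<exists>h. bij_betw h (I a) {0..<card (I a)}" using ex_bij_betw_finite_nat[OF finI] by blast
  \<comment> \<open>\<open>h a\<close> numbers the pairs at \<open>a\<close>; blocks of three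
    consecutive ones belong to the new vertices \<open>(a, q)\<close>.\<close>
  then obtain h where h: "\<And>a. bij_betw (h a) (I a) {0..<card (I a)}" by metis
  obtain s' where s': "\<And>b. b \<in> B \<Longrightarrow> s' b = (f b, h (f b) b div 3) \<or> s' b = (g b, h (g b) b div 3)"
    and par: "\<And>y. even (card {b \<in> B. s' b = y}) \<or> card {b \<in> B. s' b = y} \<le> 1"
    using parity_choice[OF assms(1), of "\<lambda>b. (f b, h (f b) b div 3)" "\<lambda>b. (g b, h (g b) b div 3)"] assms(2) by auto
  define s where "s b = fst (s' b)" for b
  have "3 * card {b \<in> B. s b = a} \<le> 2 * card (I a) + 2" for a
  proof -
    let ?n = "card (I a)"
    let ?S = "\<lambda>q. {b \<in> B. s' b = (a, q)}"
    have sub: "?S q \<subseteq> {b \<in> I a. h a b div 3 = q}" for q using s' unfolding I_def by fastforce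
    have inj: "inj_on (h a) X" if "X \<subseteq> I a" for X using h[of a] that inj_on_subset unfolding bij_betw_def by blast
    have small: "card (?S q) \<le> card {i. i < ?n \<and> i div 3 = q}" for q
    proof (rule card_inj_on_le[of "h a"])
      show "inj_on (h a) (?S q)" using sub[of q] by (intro inj) auto
      show "h a ` ?S q \<subseteq> {i. i < ?n \<and> i div 3 = q}" using sub[of q] h[of a] unfolding bij_betw_def by fastforce
    qed simp
    have "card {i. i < ?n \<and> i div 3 = q} \<le> card {3 * q..<3 * q + 3}" for q by (rule card_mono) auto
    then have le3: "card (?S q) \<le> 3" for q using small[of q] order_trans by fastforce
    \<comment> \<open>Three is odd and larger than one.\<close>
    have le2: "card (?S q) \<le> 2" for q
      using le3[of q] par[of "(a, q)"] by (cases "card (?S q) = 3") auto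
    \<comment> \<open>The last block is incomplete and may be chosen entirely; it has at most two
      members, whence the summand 2 in the bound.\<close>
    have "{i. i < ?n \<and> i div 3 = ?n div 3} \<subseteq> {3 * (?n div 3)..<?n}" by auto
    then have "card {i. i < ?n \<and> i div 3 = ?n div 3} \<le> card {3 * (?n div 3)..<?n}" by (intro card_mono) auto
    then have last: "card (?S (?n div 3)) \<le> ?n mod 3"
      using small[of "?n div 3"] by (simp add: minus_div_mult_eq_mod[symmetric] mult.commute)
    have "{b \<in> B. s b = a} \<subseteq> (\<Union>q\<le>?n div 3. ?S q)"
    proof
      fix b assume "b \<in> {b \<in> B. s b = a}"
      then have b: "b \<in> B" "s' b = (a, snd (s' b))" unfolding s_def by auto
      then have "b \<in> I a" "h a b div 3 = snd (s' b)" using sub[of "snd (s' b)"] by auto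
      then have "snd (s' b) \<le> ?n div 3" using h[of a] unfolding bij_betw_def by (metis atLeastLessThan_iff div_le_mono imageI less_imp_le)
      then show "b \<in> (\<Union>q\<le>?n div 3. ?S q)" using b by blast
    qed
    then have "card {b \<in> B. s b = a} \<le> card (\<Union>q\<le>?n div 3. ?S q)" using assms(1) by (intro card_mono) auto
    also have "\<dots> \<le> (\<Sum>q\<le>?n div 3. card (?S q))" by (rule card_UN_le) simp
    also have "\<dots> = (\<Sum>q<?n div 3. card (?S q)) + card (?S (?n div 3))" by (simp add: lessThan_Suc_atMost[symmetric])
    also have "\<dots> \<le> 2 * (?n div 3) + ?n mod 3"
      using sum_bounded_above[of "{..<?n div 3}" "\<lambda>q. card (?S q)" 2] le2 last by simp
    finally have "card {b \<in> B. s b = a} \<le> 2 * (?n div 3) + ?n mod 3" .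
    moreover have "?n = 3 * (?n div 3) + ?n mod 3" "?n mod 3 \<le> 2" by simp_all
    ultimately show ?thesis by linarith
  qed
  moreover have "\<forall>b\<in>B. s b = f b \<or> s b = g b" unfolding s_def using s' by fastforce
  ultimately show ?thesis unfolding I_def by (intro exI[of _ s]) simp
qed

section \<open>Separating adjacent vertices by parity and greedy choice\<close>

text \<open>Among \<open>k\<close>, ..., \<open>k + 2 * \<delta> + 1\<close> there are
  \<open>\<delta> + 1\<close> odd numbers, one more than can be forbidden. With the degree in
  \<open>\<Gamma>\<close> for \<open>\<delta>\<close>, this is where the number of free edges in
  \<open>greedy_incidence\<close> comes from.\<close>

lemma odd_value_avoiding:
  fixes k \<delta> :: nat
  assumes "finite S" "card S \<le> \<delta>"
  shows "\<exists>w\<le>2 * \<delta> + 1. odd (k + w) \<and> k + w \<notin> S"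
proof (rule ccontr)
  assume no: "\<not> ?thesis"
  let ?g = "\<lambda>i. k + (2 * i + (if odd k then 0 else 1))"
  have "?g ` {..\<delta>} \<subseteq> S"
  proof
    fix y assume "y \<in> ?g ` {..\<delta>}"
    then obtain i where i: "i \<le> \<delta>" "y = ?g i" by blast
    then have "2 * i + (if odd k then 0 else 1) \<le> 2 * \<delta> + 1" "odd y" by auto
    then show "y \<in> S" using no i(2) by blast
  qed
  then have "card (?g ` {..\<delta>}) \<le> card S" using assms(1) by (rule card_mono[rotated])
  moreover have "card (?g ` {..\<delta>}) = Suc \<delta>" by (subst card_image) (auto simp: inj_on_def)
  ultimately show False using assms(2) by simp
qed

text \<open>Vertices of \<open>A\<close> are treated in the order \<open>\<sigma>\<close>. The edge from \<open>b\<close> to its last neighbour is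
  forced, so that \<open>b\<close> ends up with even degree; a vertex of \<open>\<Union>\<Gamma>\<close> uses its remaining
  edges to become odd and to differ from its earlier neighbours in \<open>\<Gamma>\<close>. A vertex \<open>b\<close> with a single
  neighbour is exempt from the parity condition.\<close>

lemma greedy_incidence:
  fixes \<Gamma> :: "'a set set"
  assumes fin: "finite A" "finite B" and inj: "inj_on \<sigma> A" and disj: "A \<inter> B = {}"
    and last0: "\<forall>b\<in>B. N b \<subseteq> A \<and> m b \<in> N b \<and> (\<forall>a\<in>N b. \<sigma> a \<le> (\<sigma> (m b) :: nat))"
    and \<Gamma>: "fgraph \<Gamma>" "\<Union>\<Gamma> \<subseteq> A"
    and free0: "\<forall>a\<in>\<Union>\<Gamma>. 2 * degree \<Gamma> a + 1 \<le> card {b \<in> B. a \<in> N b \<and> (a \<noteq> m b \<or> N b = {a})}"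
  shows "\<exists>D. D \<subseteq> {(a, b). b \<in> B \<and> a \<in> N b \<and> \<sigma> a < n} \<and>
    (\<forall>b\<in>B. (\<nexists>a. N b = {a}) \<longrightarrow> \<sigma> (m b) < n \<longrightarrow> even (card {a. (a, b) \<in> D})) \<and>
    (\<forall>a\<in>\<Union>\<Gamma>. \<sigma> a < n \<longrightarrow> odd (degree \<Gamma> a + card {b. (a, b) \<in> D})) \<and>
    (\<forall>a a'. {a, a'} \<in> \<Gamma> \<longrightarrow> \<sigma> a < n \<longrightarrow> \<sigma> a' < n \<longrightarrow>
      degree \<Gamma> a + card {b. (a, b) \<in> D} \<noteq> degree \<Gamma> a' + card {b. (a', b) \<in> D}) \<and>
    (\<forall>a b. (a, b) \<in> D \<longrightarrow> a \<notin> \<Union>\<Gamma> \<longrightarrow> N b \<noteq> {a})"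
proof (induction n)
  case 0
  show ?case by (intro exI[of _ "{}"]) auto
next
  case (Suc n)
  note last = bspec[OF last0] and free = bspec[OF free0]
  from Suc obtain D where D: "D \<subseteq> {(a, b). b \<in> B \<and> a \<in> N b \<and> \<sigma> a < n}"
    and Db: "\<forall>b\<in>B. (\<nexists>a. N b = {a}) \<longrightarrow> \<sigma> (m b) < n \<longrightarrow> even (card {a. (a, b) \<in> D})"
    and Do: "\<forall>a\<in>\<Union>\<Gamma>. \<sigma> a < n \<longrightarrow> odd (degree \<Gamma> a + card {b. (a, b) \<in> D})"
    and Dd: "\<forall>a a'. {a, a'} \<in> \<Gamma> \<longrightarrow> \<sigma> a < n \<longrightarrow> \<sigma> a' < n \<longrightarrow>
      degree \<Gamma> a + card {b. (a, b) \<in> D} \<noteq> degree \<Gamma> a' + card {b. (a', b) \<in> D}"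
    and De: "\<forall>a b. (a, b) \<in> D \<longrightarrow> a \<notin> \<Union>\<Gamma> \<longrightarrow> N b \<noteq> {a}"
    by (elim exE conjE) (rule that)
  show ?case
  proof (cases "\<exists>a\<in>A. \<sigma> a = n")
    case False
    have lt: "\<sigma> a < Suc n \<longleftrightarrow> \<sigma> a < n" if "a \<in> A" for a using False that less_Suc_eq by blast
    have \<Gamma>A: "a \<in> A" if "{a, a'} \<in> \<Gamma> \<or> {a', a} \<in> \<Gamma>" for a a' using that \<Gamma>(2) by blast
    show ?thesis
    proof (intro exI[of _ D] conjI)
      show "D \<subseteq> {(a, b). b \<in> B \<and> a \<in> N b \<and> \<sigma> a < Suc n}" using D by auto
      show "\<forall>b\<in>B. (\<nexists>a. N b = {a}) \<longrightarrow> \<sigma> (m b) < Suc n \<longrightarrow> even (card {a. (a, b) \<in> D})"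
        using Db last lt by blast
      show "\<forall>a\<in>\<Union>\<Gamma>. \<sigma> a < Suc n \<longrightarrow> odd (degree \<Gamma> a + card {b. (a, b) \<in> D})"
        using Do lt \<Gamma>(2) by blast
      show "\<forall>a a'. {a, a'} \<in> \<Gamma> \<longrightarrow> \<sigma> a < Suc n \<longrightarrow> \<sigma> a' < Suc n \<longrightarrow>
        degree \<Gamma> a + card {b. (a, b) \<in> D} \<noteq> degree \<Gamma> a' + card {b. (a', b) \<in> D}"
      proof (intro allI impI)
        fix a a' assume h: "{a, a'} \<in> \<Gamma>" "\<sigma> a < Suc n" "\<sigma> a' < Suc n"
        then have "\<sigma> a < n" "\<sigma> a' < n" using lt \<Gamma>A by auto
        then show "degree \<Gamma> a + card {b. (a, b) \<in> D} \<noteq> degree \<Gamma> a' + card {b. (a', b) \<in> D}"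
          using Dd h(1) by simp
      qed
      show "\<forall>a b. (a, b) \<in> D \<longrightarrow> a \<notin> \<Union>\<Gamma> \<longrightarrow> N b \<noteq> {a}" by (rule De)
    qed
  next
    case True
    then obtain a0 where a0: "a0 \<in> A" "\<sigma> a0 = n" by blast
    have uniq: "a = a0" if "a \<in> A" "\<sigma> a = n" for a using inj that a0 by (auto simp: inj_on_def)
    \<comment> \<open>The \<open>b\<close> for which \<open>a0\<close> is the last chance to repair
      an odd degree.\<close>
    define Forced where "Forced = {b \<in> B. m b = a0 \<and> (\<nexists>a. N b = {a}) \<and> odd (card {a. (a, b) \<in> D})}"
    \<comment> \<open>At these \<open>b\<close> the choice is open: a later neighbour repairs the
      parity, or \<open>b\<close> is exempt.\<close>
    define Free where "Free = {b \<in> B. a0 \<in> N b \<and> (a0 \<noteq> m b \<or> N b = {a0})}"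
    have finFF: "finite Forced" "finite Free" unfolding Forced_def Free_def using fin(2) by auto
    have FF: "Forced \<inter> Free = {}" unfolding Forced_def Free_def by auto
    define k where "k = degree \<Gamma> a0 + card Forced"
    \<comment> \<open>A vertex outside \<open>\<Union>\<Gamma>\<close> takes forced edges only;
      hence an exempt \<open>b\<close> is never joined to it.\<close>
    have "\<exists>W. W \<subseteq> Free \<and> (a0 \<notin> \<Union>\<Gamma> \<longrightarrow> W = {}) \<and> (a0 \<in> \<Union>\<Gamma> \<longrightarrow> odd (k + card W) \<and>
      (\<forall>a'. {a0, a'} \<in> \<Gamma> \<longrightarrow> k + card W \<noteq> degree \<Gamma> a' + card {b. (a', b) \<in> D}))"
    proof (cases "a0 \<in> \<Union>\<Gamma>")
      case True
      let ?S = "(\<lambda>a'. degree \<Gamma> a' + card {b. (a', b) \<in> D}) ` {a'. {a0, a'} \<in> \<Gamma>}"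
      have finN: "finite {a'. {a0, a'} \<in> \<Gamma>}"
        by (rule finite_subset[OF _ finite_Union_fgraph[OF \<Gamma>(1)]]) auto
      have "card ?S \<le> degree \<Gamma> a0" unfolding degree_neighbours[OF \<Gamma>(1)] by (rule card_image_le[OF finN])
      then obtain w where w: "w \<le> 2 * degree \<Gamma> a0 + 1" "odd (k + w)" "k + w \<notin> ?S"
        using odd_value_avoiding[of ?S "degree \<Gamma> a0" k] finN by blast
      then have "w \<le> card Free" using free[OF True] unfolding Free_def by linarith
      then obtain W where W: "W \<subseteq> Free" "card W = w" using obtain_subset_with_card_n by metis
      have "k + w \<noteq> degree \<Gamma> a' + card {b. (a', b) \<in> D}" if "{a0, a'} \<in> \<Gamma>" for a'
        using w(3) that by auto
      then show ?thesis using W w(2) True by (intro exI[of _ W]) simp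
    qed (intro exI[of _ "{}"], simp)
    then obtain W where W1: "W \<subseteq> Free" and W2: "a0 \<notin> \<Union>\<Gamma> \<longrightarrow> W = {}"
      and W34: "a0 \<in> \<Union>\<Gamma> \<longrightarrow> odd (k + card W) \<and>
      (\<forall>a'. {a0, a'} \<in> \<Gamma> \<longrightarrow> k + card W \<noteq> degree \<Gamma> a' + card {b. (a', b) \<in> D})"
      by (elim exE conjE) (rule that)
    note W = W1 W2[rule_format] W34[rule_format, THEN conjunct1] W34[rule_format, THEN conjunct2, rule_format]
    define D' where "D' = D \<union> {a0} \<times> (Forced \<union> W)"
    have nD: "(a0, b) \<notin> D" for b using D a0(2) by auto
    have row: "{b. (a, b) \<in> D'} = (if a = a0 then Forced \<union> W else {b. (a, b) \<in> D})" for a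
      unfolding D'_def using nD by auto
    have "card (Forced \<union> W) = card Forced + card W"
      using finFF FF W(1) finite_subset by (intro card_Un_disjoint) auto
    then have val: "degree \<Gamma> a0 + card {b. (a0, b) \<in> D'} = k + card W" unfolding row k_def by simp
    have lt: "\<sigma> a < Suc n \<longleftrightarrow> a = a0 \<or> \<sigma> a < n" if "a \<in> A" for a using uniq that a0(2) by (auto simp: less_Suc_eq)
    have lastA: "m b \<in> A" if "b \<in> B" for b using last[OF that] by blast
    show ?thesis
    proof (intro exI[of _ D'] conjI)
      have "b \<in> B \<and> a0 \<in> N b" if "b \<in> Forced \<union> W" for b
        using that W(1) last[of b] unfolding Forced_def Free_def by auto
      then show "D' \<subseteq> {(a, b). b \<in> B \<and> a \<in> N b \<and> \<sigma> a < Suc n}" unfolding D'_def using D a0(2) by auto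
      show "\<forall>b\<in>B. (\<nexists>a. N b = {a}) \<longrightarrow> \<sigma> (m b) < Suc n \<longrightarrow> even (card {a. (a, b) \<in> D'})"
      proof (intro ballI impI)
        fix b assume b: "b \<in> B" "\<nexists>a. N b = {a}" "\<sigma> (m b) < Suc n"
        show "even (card {a. (a, b) \<in> D'})"
        proof (cases "m b = a0")
          case True
          have "b \<notin> W" using W(1) True b(2) unfolding Free_def by auto
          then have "{a. (a, b) \<in> D'} = (if b \<in> Forced then insert a0 {a. (a, b) \<in> D} else {a. (a, b) \<in> D})"
            unfolding D'_def by auto
          moreover have "finite {a. (a, b) \<in> D}"
            using last[OF b(1)] D by (intro finite_subset[OF _ fin(1)]) auto
          ultimately show ?thesis using True b nD unfolding Forced_def by auto
        next
          case False
          then have "\<sigma> (m b) < n" using b lt[OF lastA] by simp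
          moreover have "b \<notin> Forced" using False unfolding Forced_def by simp
          moreover have "b \<notin> W"
          proof
            assume "b \<in> W"
            then have "a0 \<in> N b" using W(1) unfolding Free_def by blast
            then have "\<sigma> a0 \<le> \<sigma> (m b)" using last[OF b(1)] by blast
            then show False using \<open>\<sigma> (m b) < n\<close> a0(2) by simp
          qed
          then have "{a. (a, b) \<in> D'} = {a. (a, b) \<in> D}" using calculation(2) unfolding D'_def by auto
          ultimately show ?thesis using Db b by simp
        qed
      qed
      show "\<forall>a\<in>\<Union>\<Gamma>. \<sigma> a < Suc n \<longrightarrow> odd (degree \<Gamma> a + card {b. (a, b) \<in> D'})"
      proof (intro ballI impI)
        fix a assume a: "a \<in> \<Union>\<Gamma>" "\<sigma> a < Suc n"
        show "odd (degree \<Gamma> a + card {b. (a, b) \<in> D'})"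
        proof (cases "a = a0")
          case True then show ?thesis using val W(3) a(1) by metis
        next
          case False
          have "\<sigma> a < n" using lt[of a] a \<Gamma>(2) False by blast
          from bspec[OF Do a(1)] this show ?thesis using False unfolding row by simp
        qed
      qed
      show "\<forall>a a'. {a, a'} \<in> \<Gamma> \<longrightarrow> \<sigma> a < Suc n \<longrightarrow> \<sigma> a' < Suc n \<longrightarrow>
        degree \<Gamma> a + card {b. (a, b) \<in> D'} \<noteq> degree \<Gamma> a' + card {b. (a', b) \<in> D'}"
      proof (intro allI impI)
        fix a a' assume h: "{a, a'} \<in> \<Gamma>" "\<sigma> a < Suc n" "\<sigma> a' < Suc n"
        have ne: "a \<noteq> a'" using fgraph_neq[OF \<Gamma>(1) h(1)] .
        have UG: "a \<in> \<Union>\<Gamma>" "a' \<in> \<Union>\<Gamma>" using h(1) by auto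
        then have A: "a \<in> A" "a' \<in> A" using \<Gamma>(2) by auto
        consider "a = a0" | "a' = a0" | "a \<noteq> a0" "a' \<noteq> a0" by blast
        then show "degree \<Gamma> a + card {b. (a, b) \<in> D'} \<noteq> degree \<Gamma> a' + card {b. (a', b) \<in> D'}"
        proof cases
          case 1
          then show ?thesis using W(4)[of a'] val h(1) ne UG unfolding row by (auto simp: insert_commute)
        next
          case 2
          then show ?thesis using W(4)[of a] val h(1) ne UG unfolding row by (auto simp: insert_commute)
        next
          case 3
          then have "\<sigma> a < n" "\<sigma> a' < n" using lt A h by auto
          then show ?thesis using 3 Dd h(1) unfolding row by simp
        qed
      qed
      show "\<forall>a b. (a, b) \<in> D' \<longrightarrow> a \<notin> \<Union>\<Gamma> \<longrightarrow> N b \<noteq> {a}"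
      proof (intro allI impI)
        fix a b assume h: "(a, b) \<in> D'" "a \<notin> \<Union>\<Gamma>"
        show "N b \<noteq> {a}"
        proof (cases "(a, b) \<in> D")
          case True then show ?thesis using De h(2) by blast
        next
          case False
          then have "a = a0" "b \<in> Forced" using h W(2) unfolding D'_def by auto
          then show ?thesis unfolding Forced_def by blast
        qed
      qed
    qed
  qed
qed

text \<open>After \<open>greedy_incidence\<close> the vertices of \<open>\<Union>\<Gamma>\<close>
  are odd and differ along \<open>\<Gamma>\<close>, and the degrees in \<open>B\<close> are even
  except at vertices with a single neighbour. A vertex of \<open>A\<close> outside
  \<open>\<Union>\<Gamma>\<close> had no choice; if its degree came out even and positive, it gets
  one edge to \<open>C\<close>. \<open>parity_choice\<close> selects this edge among two so that the
  degrees in \<open>C\<close> are even or at most 1.\<close>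

lemma parity_round:
  fixes \<Gamma> :: "'a set set"
  assumes fin: "finite A" "finite B" and inj: "inj_on \<sigma> A"
    and disj: "A \<inter> B = {}" "A \<inter> C = {}" "B \<inter> C = {}"
    and last0: "\<forall>b\<in>B. N b \<subseteq> A \<and> m b \<in> N b \<and> (\<forall>a\<in>N b. \<sigma> a \<le> (\<sigma> (m b) :: nat))"
    and \<Gamma>: "fgraph \<Gamma>" "\<Union>\<Gamma> \<subseteq> A"
    and free0: "\<forall>a\<in>\<Union>\<Gamma>. 2 * degree \<Gamma> a + 1 \<le> card {b \<in> B. a \<in> N b \<and> (a \<noteq> m b \<or> N b = {a})}"
    and cd: "\<And>a. a \<in> A \<Longrightarrow> c a \<in> C \<and> d a \<in> C \<and> c a \<noteq> d a"
  shows "\<exists>K. (\<forall>e\<in>K. \<exists>a b. e = {a, b} \<and> (b \<in> B \<and> a \<in> N b \<or> a \<in> A \<and> (b = c a \<or> b = d a))) \<and> irregular (\<Gamma> \<union> K)"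
proof -
  note last = bspec[OF last0] and free = bspec[OF free0]
  obtain n where n: "\<forall>a\<in>A. \<sigma> a < n" using fin(1) by (metis finite_imageI finite_nat_set_iff_bounded imageI)
  obtain D where D: "D \<subseteq> {(a, b). b \<in> B \<and> a \<in> N b \<and> \<sigma> a < n}"
    and Db0: "\<forall>b\<in>B. (\<nexists>a. N b = {a}) \<longrightarrow> \<sigma> (m b) < n \<longrightarrow> even (card {a. (a, b) \<in> D})"
    and Do0: "\<forall>a\<in>\<Union>\<Gamma>. \<sigma> a < n \<longrightarrow> odd (degree \<Gamma> a + card {b. (a, b) \<in> D})"
    and Dd0: "\<forall>a a'. {a, a'} \<in> \<Gamma> \<longrightarrow> \<sigma> a < n \<longrightarrow> \<sigma> a' < n \<longrightarrow>
      degree \<Gamma> a + card {b. (a, b) \<in> D} \<noteq> degree \<Gamma> a' + card {b. (a', b) \<in> D}"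
    and De: "\<forall>a b. (a, b) \<in> D \<longrightarrow> a \<notin> \<Union>\<Gamma> \<longrightarrow> N b \<noteq> {a}"
    using greedy_incidence[OF fin inj disj(1) last0 \<Gamma> free0, of n] by (elim exE conjE) (rule that)
  have DA: "a \<in> A \<and> b \<in> B \<and> a \<in> N b" if "(a, b) \<in> D" for a b using D that last[of b] by auto
  have \<Gamma>A: "a \<in> A" "a' \<in> A" "a \<in> \<Union>\<Gamma>" "a' \<in> \<Union>\<Gamma>" if "{a, a'} \<in> \<Gamma>" for a a' using that \<Gamma>(2) by auto
  have Db: "even (card {a. (a, b) \<in> D})" if "b \<in> B" "\<nexists>a. N b = {a}" for b
    using Db0 last[OF that(1)] that n by blast
  have Do: "odd (degree \<Gamma> a + card {b. (a, b) \<in> D})" if "a \<in> \<Union>\<Gamma>" for a using Do0 n that \<Gamma>(2) by blast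
  have Dd: "degree \<Gamma> a + card {b. (a, b) \<in> D} \<noteq> degree \<Gamma> a' + card {b. (a', b) \<in> D}" if "{a, a'} \<in> \<Gamma>" for a a'
    using Dd0 n that \<Gamma>A[OF that] by blast
  define W where "W = {a \<in> A - \<Union>\<Gamma>. even (card {b. (a, b) \<in> D}) \<and> {b. (a, b) \<in> D} \<noteq> {}}"
  have finW: "finite W" unfolding W_def using fin(1) by simp
  have "c w \<noteq> d w" if "w \<in> W" for w using cd[of w] that unfolding W_def by simp
  then have "\<exists>s. (\<forall>w\<in>W. s w = c w \<or> s w = d w) \<and> (\<forall>y. even (card {w \<in> W. s w = y}) \<or> card {w \<in> W. s w = y} \<le> 1)"
    by (rule parity_choice[OF finW])
  then obtain s where s: "\<forall>w\<in>W. s w = c w \<or> s w = d w"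
    and spar: "\<forall>y. even (card {w \<in> W. s w = y}) \<or> card {w \<in> W. s w = y} \<le> 1" by (elim exE conjE) (rule that)
  have sC: "s w \<in> C" if "w \<in> W" for w using s cd[of w] that unfolding W_def by auto
  have WA: "w \<in> A \<and> w \<notin> \<Union>\<Gamma>" if "w \<in> W" for w using that unfolding W_def by simp
  define K where "K = (\<lambda>(a, b). {a, b}) ` D \<union> (\<lambda>w. {w, s w}) ` W"
  have mem: "{x, y} \<in> \<Gamma> \<union> K \<longleftrightarrow> {x, y} \<in> \<Gamma> \<or> (x, y) \<in> D \<or> (y, x) \<in> D \<or> (x \<in> W \<and> y = s x) \<or> (y \<in> W \<and> x = s y)" for x y
    unfolding K_def by (auto simp: doubleton_eq_iff image_iff)
  have finD: "finite D" by (rule finite_subset[of _ "A \<times> B"]) (use DA fin in auto)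
  have fgK: "fgraph K" unfolding fgraph_def
  proof
    show "finite K" unfolding K_def using finD finW by simp
    have "card {a, b} = 2" if "(a, b) \<in> D" for a b
    proof -
      have "a \<noteq> b" using DA[OF that] disj(1) by blast
      then show ?thesis by simp
    qed
    moreover have "card {w, s w} = 2" if "w \<in> W" for w
    proof -
      have "w \<noteq> s w" using sC[OF that] WA[OF that] disj(2) by (metis IntI empty_iff)
      then show ?thesis by simp
    qed
    ultimately show "\<forall>e\<in>K. card e = 2" unfolding K_def by (auto simp del: card_insert_if)
  qed
  have fgH: "fgraph (\<Gamma> \<union> K)" by (rule fgraph_Un[OF \<Gamma>(1) fgK])
  have finr: "finite {b. (a, b) \<in> D}" "finite {a. (a, b) \<in> D}" for a b
    using finite_subset[of "{b. (a, b) \<in> D}" B] finite_subset[of "{a. (a, b) \<in> D}" A] DA fin by auto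
  have degA1: "degree (\<Gamma> \<union> K) a = degree \<Gamma> a + card {b. (a, b) \<in> D}" if a: "a \<in> \<Union>\<Gamma>" for a
  proof -
    have aA: "a \<in> A" using a \<Gamma>(2) by blast
    have "{u. {a, u} \<in> \<Gamma> \<union> K} = {u. {a, u} \<in> \<Gamma>} \<union> {b. (a, b) \<in> D}"
      unfolding mem using a aA DA WA sC disj by (auto dest: DA WA sC)
    moreover have "{u. {a, u} \<in> \<Gamma>} \<inter> {b. (a, b) \<in> D} = {}"
      using \<Gamma>A(2) DA disj(1) by (metis (no_types, lifting) disjoint_iff mem_Collect_eq)
    moreover have "finite {u. {a, u} \<in> \<Gamma>}" by (rule finite_subset[OF _ fin(1)]) (use \<Gamma>A in auto)
    ultimately show ?thesis
      unfolding degree_neighbours[OF fgH] degree_neighbours[OF \<Gamma>(1)] using finr(1) by (simp add: card_Un_disjoint)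
  qed
  have degA2: "degree (\<Gamma> \<union> K) a = card {b. (a, b) \<in> D} + (if a \<in> W then 1 else 0)" if a: "a \<in> A" "a \<notin> \<Union>\<Gamma>" for a
  proof -
    have "{u. {a, u} \<in> \<Gamma> \<union> K} = {b. (a, b) \<in> D} \<union> (if a \<in> W then {s a} else {})"
      unfolding mem using a DA WA sC disj \<Gamma>A by auto
    moreover have "s a \<notin> {b. (a, b) \<in> D}" if "a \<in> W" using DA sC[OF that] disj(3) by blast
    ultimately show ?thesis unfolding degree_neighbours[OF fgH] using finr(1)[of a] by (auto simp: card_insert_if)
  qed
  have degB: "degree (\<Gamma> \<union> K) b = card {a. (a, b) \<in> D}" if b: "b \<in> B" for b
  proof -
    have "{u. {b, u} \<in> \<Gamma> \<union> K} = {a. (a, b) \<in> D}"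
      unfolding mem using b DA WA sC disj \<Gamma>A by blast
    then show ?thesis unfolding degree_neighbours[OF fgH] by simp
  qed
  have degC: "degree (\<Gamma> \<union> K) y = card {w \<in> W. s w = y}" if y: "y \<in> C" for y
  proof -
    have "{u. {y, u} \<in> \<Gamma> \<union> K} = {w \<in> W. s w = y}"
      unfolding mem using y DA WA sC disj \<Gamma>A by blast
    then show ?thesis unfolding degree_neighbours[OF fgH] by simp
  qed
  have ab: "degree (\<Gamma> \<union> K) a \<noteq> degree (\<Gamma> \<union> K) b" if abD: "(a, b) \<in> D" for a b
  proof -
    note m = DA[OF abD]
    have pos: "card {b. (a, b) \<in> D} \<noteq> 0" using finr(1)[of a] abD by auto
    show ?thesis
    proof (cases "a \<in> \<Union>\<Gamma>")
      case True
      show ?thesis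
      proof (cases "\<exists>a. N b = {a}")
        \<comment> \<open>An exempt \<open>b\<close> has degree one, while \<open>a\<close> also has
          an edge in \<open>\<Gamma>\<close>.\<close>
        case True
        then obtain a' where a': "N b = {a'}" by blast
        have "x = a" if "(x, b) \<in> D" for x using DA[OF that] m a' by auto
        then have "{a. (a, b) \<in> D} = {a}" using abD by blast
        then have "degree (\<Gamma> \<union> K) b = 1" using degB m by simp
        moreover have "degree \<Gamma> a \<noteq> 0" using degree_eq_0[of \<Gamma> a] \<open>a \<in> \<Union>\<Gamma>\<close> \<Gamma>(1) unfolding fgraph_def by blast
        ultimately show ?thesis using degA1[OF \<open>a \<in> \<Union>\<Gamma>\<close>] pos by linarith
      next
        case False
        then have "even (degree (\<Gamma> \<union> K) b)" using degB Db[of b] m by simp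
        moreover have "odd (degree (\<Gamma> \<union> K) a)" unfolding degA1[OF True] by (rule Do[OF True])
        ultimately show ?thesis by metis
      qed
    next
      case False
      have "a \<in> W \<longleftrightarrow> even (card {b. (a, b) \<in> D})" using m False abD unfolding W_def by blast
      then have "odd (degree (\<Gamma> \<union> K) a)" using degA2[of a] m False by simp
      moreover have "N b \<noteq> {a}" using De abD False by blast
      then have "\<nexists>a. N b = {a}" using m by (metis singletonD)
      then have "even (degree (\<Gamma> \<union> K) b)" using degB Db[of b] m by simp
      ultimately show ?thesis by metis
    qed
  qed
  have ac: "degree (\<Gamma> \<union> K) w \<noteq> degree (\<Gamma> \<union> K) (s w)" if w: "w \<in> W" for w
  proof -
    have p: "even (card {b. (w, b) \<in> D})" "{b. (w, b) \<in> D} \<noteq> {}" using w unfolding W_def by auto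
    then have "card {b. (w, b) \<in> D} \<noteq> 0" using finr(1)[of w] by simp
    \<comment> \<open>With the edge to \<open>C\<close> the degree of \<open>w\<close> is odd and at
      least three, so it differs from even degrees and from 1.\<close>
    then have "card {b. (w, b) \<in> D} \<ge> 2" using p(1) by (intro dvd_imp_le) auto
    then have "degree (\<Gamma> \<union> K) w \<ge> 3" "odd (degree (\<Gamma> \<union> K) w)" using degA2[of w] WA[OF w] w p(1) by auto
    then show ?thesis using degC[OF sC[OF w]] spar[rule_format, of "s w"] by auto
  qed
  have "irregular (\<Gamma> \<union> K)"
  proof (rule liI)
    fix u v assume "{u, v} \<in> \<Gamma> \<union> K"
    then consider "{u, v} \<in> \<Gamma>" | "(u, v) \<in> D" | "(v, u) \<in> D" | "u \<in> W" "v = s u" | "v \<in> W" "u = s v"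
      unfolding mem by blast
    then show "degree (\<Gamma> \<union> K) u \<noteq> degree (\<Gamma> \<union> K) v"
    proof cases
      case 1 then show ?thesis using degA1[OF \<Gamma>A(3)[OF 1]] degA1[OF \<Gamma>A(4)[OF 1]] Dd[OF 1] by simp
    qed (use ab[of u v] ab[of v u] ac[of u] ac[of v] in auto)
  qed
  moreover have "\<forall>e\<in>K. \<exists>a b. e = {a, b} \<and> (b \<in> B \<and> a \<in> N b \<or> a \<in> A \<and> (b = c a \<or> b = d a))"
  proof
    fix e assume "e \<in> K"
    then consider a b where "e = {a, b}" "(a, b) \<in> D" | w where "e = {w, s w}" "w \<in> W" unfolding K_def by auto
    then show "\<exists>a b. e = {a, b} \<and> (b \<in> B \<and> a \<in> N b \<or> a \<in> A \<and> (b = c a \<or> b = d a))"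
    proof cases
      case 1 then show ?thesis using DA by (intro exI[of _ a] exI[of _ b]) simp
    next
      case 2 then show ?thesis using WA s by (intro exI[of _ w] exI[of _ "s w"]) simp
    qed
  qed
  ultimately show ?thesis by (intro exI[of _ K]) simp
qed

text \<open>In a round each \<open>b\<close> is lost to just one vertex, its last neighbour:
  \<open>hi b\<close> in the order \<open>\<sigma>\<close>, \<open>lo b\<close> in the reverse
  order. \<open>balanced_choice\<close> decides which of the two loses \<open>b\<close>, and
  \<open>b\<close> serves only in the corresponding round, \<open>B1\<close> or \<open>B2\<close>.
  So every \<open>a\<close> loses about two thirds of its edges at most; the others are free in one
  of the rounds, and \<open>j a\<close> is a round with enough of them. Edges of
  \<open>\<Gamma>\<close> whose ends are in different rounds are left to the multipartite
  rest.\<close>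

lemma two_rounds:
  fixes \<Gamma> E :: "'a set set"
  assumes E: "fgraph E" and \<Gamma>: "\<Gamma> \<subseteq> E" "\<Union>\<Gamma> \<subseteq> A"
    and disj: "A \<inter> B = {}" "A \<inter> C = {}" "B \<inter> C = {}"
    and toB: "\<And>a. a \<in> \<Union>\<Gamma> \<Longrightarrow> 16 * degree \<Gamma> a \<le> card {b \<in> B. {a, b} \<in> E}"
    and toC: "\<And>a. a \<in> \<Union>\<Gamma> \<Longrightarrow> 4 \<le> card {c \<in> C. {a, c} \<in> E}"
  shows "\<exists>(j :: 'a \<Rightarrow> nat) K. (\<forall>v. j v < 2) \<and> K \<subseteq> E \<inter> {{a, b} | a b. a \<in> A \<and> b \<in> B \<union> C} \<and>
    splits 2 ({e \<in> \<Gamma>. \<exists>i. \<forall>v\<in>e. j v = i} \<union> K)"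
proof -
  have fg: "fgraph \<Gamma>" by (rule fgraph_subset[OF E \<Gamma>(1)])
  define A0 where "A0 = \<Union>\<Gamma>"
  have finA: "finite A0" unfolding A0_def by (rule finite_Union_fgraph[OF fg])
  have A0A: "A0 \<subseteq> A" using \<Gamma>(2) by (simp add: A0_def)
  define N where "N b = {a \<in> A0. {a, b} \<in> E}" for b
  define B0 where "B0 = {b \<in> B. N b \<noteq> {}}"
  have finB: "finite B0"
    by (rule finite_subset[OF _ finite_Union_fgraph[OF E]]) (auto simp: B0_def N_def)
  obtain \<sigma> :: "'a \<Rightarrow> nat" where \<sigma>: "inj_on \<sigma> A0" using finite_imp_inj_to_nat_seg[OF finA] by blast
  obtain M where M: "\<forall>a\<in>A0. \<sigma> a < M" using finA by (metis finite_imageI finite_nat_set_iff_bounded imageI)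
  have finN: "finite (N b)" for b unfolding N_def using finA by simp
  have NA: "N b \<subseteq> A0" for b unfolding N_def by blast
  have "\<exists>x\<in>N b. \<forall>a\<in>N b. \<sigma> a \<le> \<sigma> x" if "b \<in> B0" for b
  proof -
    have "Max (\<sigma> ` N b) \<in> \<sigma> ` N b" using finN that unfolding B0_def by (intro Max_in) auto
    then obtain x where "x \<in> N b" "\<sigma> x = Max (\<sigma> ` N b)" by auto
    then show ?thesis using finN[of b] by (intro bexI[of _ x]) auto
  qed
  then obtain hi where hi: "\<And>b. b \<in> B0 \<Longrightarrow> hi b \<in> N b \<and> (\<forall>a\<in>N b. \<sigma> a \<le> \<sigma> (hi b))" by metis
  have "\<exists>x\<in>N b. \<forall>a\<in>N b. \<sigma> x \<le> \<sigma> a" if "b \<in> B0" for b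
  proof -
    have "Min (\<sigma> ` N b) \<in> \<sigma> ` N b" using finN that unfolding B0_def by (intro Min_in) auto
    then obtain x where "x \<in> N b" "\<sigma> x = Min (\<sigma> ` N b)" by auto
    then show ?thesis using finN[of b] by (intro bexI[of _ x]) auto
  qed
  then obtain lo where lo: "\<And>b. b \<in> B0 \<Longrightarrow> lo b \<in> N b \<and> (\<forall>a\<in>N b. \<sigma> (lo b) \<le> \<sigma> a)" by metis
  have single: "N b = {a}" if b: "b \<in> B0" "lo b = hi b" "a \<in> N b" for a b
  proof -
    have "x = a" if "x \<in> N b" for x
    proof -
      have "\<sigma> x = \<sigma> (hi b)" "\<sigma> a = \<sigma> (hi b)" using hi[OF b(1)] lo[OF b(1)] b that by (metis order_antisym)+
      then show ?thesis using \<sigma> NA[of b] b(3) that unfolding inj_on_def by (metis subsetD)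
    qed
    then show ?thesis using b(3) by blast
  qed
  define Bm where "Bm = {b \<in> B0. lo b \<noteq> hi b}"
  have finBm: "finite Bm" unfolding Bm_def using finB by simp
  have "\<exists>s. (\<forall>b\<in>Bm. s b = lo b \<or> s b = hi b) \<and>
    (\<forall>a. 3 * card {b \<in> Bm. s b = a} \<le> 2 * card {b \<in> Bm. lo b = a \<or> hi b = a} + 2)"
    by (rule balanced_choice[OF finBm]) (simp add: Bm_def)
  then obtain s where s: "\<forall>b\<in>Bm. s b = lo b \<or> s b = hi b"
    and bal: "\<forall>a. 3 * card {b \<in> Bm. s b = a} \<le> 2 * card {b \<in> Bm. lo b = a \<or> hi b = a} + 2"
    by (elim exE conjE) (rule that)
  define B1 where "B1 = {b \<in> B0. lo b = hi b \<or> s b = hi b}"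
  define B2 where "B2 = {b \<in> Bm. s b \<noteq> hi b}"
  have B12: "B1 \<subseteq> B0" "B2 \<subseteq> B0" "B1 \<inter> B2 = {}" unfolding B1_def B2_def Bm_def by auto
  define fr1 where "fr1 a = {b \<in> B1. a \<in> N b \<and> (a \<noteq> hi b \<or> N b = {a})}" for a
  define fr2 where "fr2 a = {b \<in> B2. a \<in> N b \<and> (a \<noteq> lo b \<or> N b = {a})}" for a
  have enough: "2 * degree \<Gamma> a + 1 \<le> card (fr1 a) \<or> 2 * degree \<Gamma> a + 1 \<le> card (fr2 a)" if a: "a \<in> A0" for a
  proof -
    let ?Na = "{b \<in> B. {a, b} \<in> E}"
    have Na: "?Na = {b \<in> B0. a \<in> N b}" unfolding B0_def N_def using a by auto
    have fin: "finite (fr1 a)" "finite (fr2 a)" "finite ?Na"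
      unfolding fr1_def fr2_def Na using finB finite_subset[OF B12(1)] finite_subset[OF B12(2)] by auto
    have "?Na \<subseteq> fr1 a \<union> fr2 a \<union> {b \<in> Bm. s b = a}"
    proof
      fix b assume "b \<in> ?Na"
      then have b: "b \<in> B0" "a \<in> N b" unfolding Na by auto
      show "b \<in> fr1 a \<union> fr2 a \<union> {b \<in> Bm. s b = a}"
      proof (cases "lo b = hi b")
        case True
        then have "b \<in> fr1 a" using b single[OF b(1) True b(2)] unfolding fr1_def B1_def by simp
        then show ?thesis by simp
      next
        case False
        then have bm: "b \<in> Bm" using b unfolding Bm_def by simp
        then consider "s b = hi b" | "s b = lo b" "s b \<noteq> hi b" using s by blast
        then show ?thesis
        proof cases
          case 1
          then show ?thesis using b bm unfolding fr1_def B1_def by auto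
        next
          case 2
          then show ?thesis using b bm unfolding fr2_def B2_def by auto
        qed
      qed
    qed
    then have "card ?Na \<le> card (fr1 a \<union> fr2 a \<union> {b \<in> Bm. s b = a})" using fin finBm by (intro card_mono) auto
    also have "\<dots> \<le> card (fr1 a) + card (fr2 a) + card {b \<in> Bm. s b = a}"
      using card_Un_le[of "fr1 a \<union> fr2 a" "{b \<in> Bm. s b = a}"] card_Un_le[of "fr1 a" "fr2 a"] by linarith
    finally have 1: "card ?Na \<le> card (fr1 a) + card (fr2 a) + card {b \<in> Bm. s b = a}" .
    have "{b \<in> Bm. lo b = a \<or> hi b = a} \<subseteq> ?Na" unfolding Na Bm_def using hi lo by auto
    then have "card {b \<in> Bm. lo b = a \<or> hi b = a} \<le> card ?Na" using fin by (intro card_mono) auto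
    moreover have "3 * card {b \<in> Bm. s b = a} \<le> 2 * card {b \<in> Bm. lo b = a \<or> hi b = a} + 2" using bal by blast
    moreover have "16 * degree \<Gamma> a \<le> card ?Na" using toB a unfolding A0_def by blast
    moreover have "degree \<Gamma> a \<noteq> 0" using degree_eq_0[of \<Gamma> a] a fg unfolding A0_def fgraph_def by blast
    \<comment> \<open>If both counts were at most \<open>2 * degree \<Gamma> a\<close>, the balance
      would give \<open>card ?Na \<le> 12 * degree \<Gamma> a + 2\<close>, which is less than
      \<open>16 * degree \<Gamma> a\<close>.\<close>
    ultimately show ?thesis using 1 by linarith
  qed
  define j where "j a = (if 2 * degree \<Gamma> a + 1 \<le> card (fr1 a) then 0 else 1 :: nat)" for a
  define \<Gamma>' where "\<Gamma>' i = {e \<in> \<Gamma>. \<forall>v\<in>e. j v = i}" for i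
  have \<Gamma>'\<Gamma>: "\<Gamma>' i \<subseteq> \<Gamma>" for i unfolding \<Gamma>'_def by blast
  have fg': "fgraph (\<Gamma>' i)" for i by (rule fgraph_subset[OF fg \<Gamma>'\<Gamma>])
  have \<Gamma>'A: "\<Union>(\<Gamma>' i) \<subseteq> A0" for i unfolding \<Gamma>'_def A0_def by blast
  have degle: "degree (\<Gamma>' i) a \<le> degree \<Gamma> a" for i a
    using degree_mono[OF _ \<Gamma>'\<Gamma>] fg unfolding fgraph_def by blast
  \<comment> \<open>Four neighbours in \<open>C\<close>: two options for each round, and different
    ones so that the rounds share no edge.\<close>
  have "\<exists>xs. distinct xs \<and> length xs = 4 \<and> set xs \<subseteq> {c \<in> C. {a, c} \<in> E}" if a: "a \<in> A0" for a
  proof -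
    have "4 \<le> card {c \<in> C. {a, c} \<in> E}" using toC a unfolding A0_def .
    then obtain T where T: "T \<subseteq> {c \<in> C. {a, c} \<in> E}" "card T = 4" "finite T"
      by (rule obtain_subset_with_card_n)
    obtain ys where "set ys = T" "distinct ys" using finite_distinct_list[OF T(3)] by blast
    then show ?thesis using T distinct_card[of ys] by (intro exI[of _ ys]) simp
  qed
  then obtain xs where xs: "\<And>a. a \<in> A0 \<Longrightarrow> distinct (xs a) \<and> length (xs a) = 4 \<and> set (xs a) \<subseteq> {c \<in> C. {a, c} \<in> E}" by metis
  have c: "xs a ! i \<in> C" "{a, xs a ! i} \<in> E" if ai: "a \<in> A0" "i < 4" for a i
  proof -
    have "xs a ! i \<in> set (xs a)" using xs[OF ai(1)] ai(2) by simp
    then show "xs a ! i \<in> C" "{a, xs a ! i} \<in> E" using xs[OF ai(1)] by auto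
  qed
  have cne: "xs a ! i \<noteq> xs a ! k" if "a \<in> A0" "i < 4" "k < 4" "i \<noteq> k" for a i k
    using xs[OF that(1)] that by (simp add: nth_eq_iff_index_eq)
  have A0disj: "A0 \<inter> B' = {}" if "B' \<subseteq> B" for B' using A0A disj(1) that by blast
  have A0C: "A0 \<inter> C = {}" using A0A disj(2) by blast
  have BB: "B1 \<subseteq> B" "B2 \<subseteq> B" using B12 unfolding B0_def by auto
  then have BC: "B1 \<inter> C = {}" "B2 \<inter> C = {}" using disj(3) by auto
  have "\<exists>K. (\<forall>e\<in>K. \<exists>a b. e = {a, b} \<and> (b \<in> B1 \<and> a \<in> N b \<or> a \<in> A0 \<and> (b = xs a ! 0 \<or> b = xs a ! 1))) \<and> irregular (\<Gamma>' 0 \<union> K)"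
  proof (rule parity_round[OF finA _ \<sigma> A0disj[OF BB(1)] A0C BC(1) _ fg' \<Gamma>'A])
    show "finite B1" using finB B12(1) finite_subset by blast
    show "\<forall>b\<in>B1. N b \<subseteq> A0 \<and> hi b \<in> N b \<and> (\<forall>a\<in>N b. \<sigma> a \<le> \<sigma> (hi b))" using hi NA B12(1) by blast
    show "\<forall>a\<in>\<Union>(\<Gamma>' 0). 2 * degree (\<Gamma>' 0) a + 1 \<le> card {b \<in> B1. a \<in> N b \<and> (a \<noteq> hi b \<or> N b = {a})}"
    proof
      fix a assume "a \<in> \<Union>(\<Gamma>' 0)"
      then have "j a = 0" unfolding \<Gamma>'_def by blast
      then have "2 * degree \<Gamma> a + 1 \<le> card (fr1 a)" unfolding j_def by (simp split: if_splits)
      then show "2 * degree (\<Gamma>' 0) a + 1 \<le> card {b \<in> B1. a \<in> N b \<and> (a \<noteq> hi b \<or> N b = {a})}"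
        using degle[of 0 a] unfolding fr1_def by linarith
    qed
    show "xs a ! 0 \<in> C \<and> xs a ! 1 \<in> C \<and> xs a ! 0 \<noteq> xs a ! 1" if "a \<in> A0" for a
      using c(1)[OF that] cne[OF that] by simp
  qed
  then obtain K1 where K1: "\<forall>e\<in>K1. \<exists>a b. e = {a, b} \<and> (b \<in> B1 \<and> a \<in> N b \<or> a \<in> A0 \<and> (b = xs a ! 0 \<or> b = xs a ! 1))"
    "irregular (\<Gamma>' 0 \<union> K1)" by blast
  \<comment> \<open>Subtracting from the bound \<open>M\<close> reverses the order within the
    natural numbers.\<close>
  have \<sigma>': "inj_on (\<lambda>a. M - \<sigma> a) A0"
  proof (rule inj_onI)
    fix a a' assume h: "a \<in> A0" "a' \<in> A0" "M - \<sigma> a = M - \<sigma> a'"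
    then have "\<sigma> a = \<sigma> a'" using M by (metis diff_diff_cancel less_imp_le)
    then show "a = a'" using \<sigma> h unfolding inj_on_def by blast
  qed
  have "\<exists>K. (\<forall>e\<in>K. \<exists>a b. e = {a, b} \<and> (b \<in> B2 \<and> a \<in> N b \<or> a \<in> A0 \<and> (b = xs a ! 2 \<or> b = xs a ! 3))) \<and> irregular (\<Gamma>' 1 \<union> K)"
  proof (rule parity_round[OF finA _ \<sigma>' A0disj[OF BB(2)] A0C BC(2) _ fg' \<Gamma>'A])
    show "finite B2" using finB B12(2) finite_subset by blast
    show "\<forall>b\<in>B2. N b \<subseteq> A0 \<and> lo b \<in> N b \<and> (\<forall>a\<in>N b. M - \<sigma> a \<le> M - \<sigma> (lo b))"
    proof
      fix b assume "b \<in> B2"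
      then have "b \<in> B0" using B12(2) by blast
      from lo[OF this] show "N b \<subseteq> A0 \<and> lo b \<in> N b \<and> (\<forall>a\<in>N b. M - \<sigma> a \<le> M - \<sigma> (lo b))"
        using NA[of b] diff_le_mono2 by blast
    qed
    show "\<forall>a\<in>\<Union>(\<Gamma>' 1). 2 * degree (\<Gamma>' 1) a + 1 \<le> card {b \<in> B2. a \<in> N b \<and> (a \<noteq> lo b \<or> N b = {a})}"
    proof
      fix a assume a: "a \<in> \<Union>(\<Gamma>' 1)"
      then have "j a = 1" unfolding \<Gamma>'_def by blast
      moreover have "a \<in> A0" using a \<Gamma>'A by blast
      ultimately have "2 * degree \<Gamma> a + 1 \<le> card (fr2 a)" using enough[of a] unfolding j_def by (auto split: if_splits)
      then show "2 * degree (\<Gamma>' 1) a + 1 \<le> card {b \<in> B2. a \<in> N b \<and> (a \<noteq> lo b \<or> N b = {a})}"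
        using degle[of 1 a] unfolding fr2_def by linarith
    qed
    show "xs a ! 2 \<in> C \<and> xs a ! 3 \<in> C \<and> xs a ! 2 \<noteq> xs a ! 3" if "a \<in> A0" for a
      using c(1)[OF that] cne[OF that] by simp
  qed
  then obtain K2 where K2: "\<forall>e\<in>K2. \<exists>a b. e = {a, b} \<and> (b \<in> B2 \<and> a \<in> N b \<or> a \<in> A0 \<and> (b = xs a ! 2 \<or> b = xs a ! 3))"
    "irregular (\<Gamma>' 1 \<union> K2)" by blast
  have Nb: "b \<in> B \<and> a \<in> A0 \<and> {a, b} \<in> E" if "b \<in> B1 \<union> B2" "a \<in> N b" for a b
    using that BB unfolding N_def by auto
  have shape1: "\<exists>a b. e = {a, b} \<and> a \<in> A0 \<and> {a, b} \<in> E \<and> (b \<in> B1 \<or> b = xs a ! 0 \<or> b = xs a ! 1)" if e: "e \<in> K1" for e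
  proof -
    obtain a b where "e = {a, b}" and "b \<in> B1 \<and> a \<in> N b \<or> a \<in> A0 \<and> (b = xs a ! 0 \<or> b = xs a ! 1)"
      using bspec[OF K1(1) e] by (elim exE conjE) (rule that)
    then show ?thesis using Nb[of b a] c[of a 0] c[of a 1] by (intro exI[of _ a] exI[of _ b]) auto
  qed
  have shape2: "\<exists>a b. e = {a, b} \<and> a \<in> A0 \<and> {a, b} \<in> E \<and> (b \<in> B2 \<or> b = xs a ! 2 \<or> b = xs a ! 3)" if e: "e \<in> K2" for e
  proof -
    obtain a b where "e = {a, b}" and "b \<in> B2 \<and> a \<in> N b \<or> a \<in> A0 \<and> (b = xs a ! 2 \<or> b = xs a ! 3)"
      using bspec[OF K2(1) e] by (elim exE conjE) (rule that)
    then show ?thesis using Nb[of b a] c[of a 2] c[of a 3] by (intro exI[of _ a] exI[of _ b]) auto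
  qed
  have shape: "\<exists>a b. e = {a, b} \<and> a \<in> A0 \<and> b \<in> B \<union> C \<and> {a, b} \<in> E" if "e \<in> K1 \<union> K2" for e
  proof (cases "e \<in> K1")
    case True
    from shape1[OF this] show ?thesis using BB c(1) by (elim exE conjE) (intro exI conjI, assumption, auto)
  next
    case False
    then have "e \<in> K2" using that by blast
    from shape2[OF this] show ?thesis using BB c(1) by (elim exE conjE) (intro exI conjI, assumption, auto)
  qed
  \<comment> \<open>\<open>B1\<close> and \<open>B2\<close> are disjoint, so a common edge would end
    in \<open>C\<close>, where the rounds use different neighbours of \<open>a\<close>.\<close>
  have K12: "K1 \<inter> K2 = {}"
  proof (rule equals0I)
    fix e assume e: "e \<in> K1 \<inter> K2"
    obtain a b where ab: "e = {a, b}" "a \<in> A0" "b \<in> B1 \<or> b = xs a ! 0 \<or> b = xs a ! 1"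
      using shape1[of e] e by auto
    obtain a' b' where ab': "e = {a', b'}" "a' \<in> A0" "b' \<in> B2 \<or> b' = xs a' ! 2 \<or> b' = xs a' ! 3"
      using shape2[of e] e by auto
    have bb: "b \<in> B1 \<union> C" "b' \<in> B2 \<union> C" using ab ab' c(1) by auto
    then have "b \<notin> A0" "b' \<notin> A0" using A0disj[OF BB(1)] A0disj[OF BB(2)] A0C by auto
    then have "a \<noteq> b'" "b \<noteq> a'" using ab(2) ab'(2) by auto
    then have eq: "a = a'" "b = b'" using ab(1) ab'(1) by (auto simp: doubleton_eq_iff)
    have "b \<in> C" using bb eq B12(3) by auto
    then have "b \<notin> B1" "b \<notin> B2" using BC by auto
    then show False using ab(3) ab'(3) eq cne[OF ab(2)] by auto
  qed
  have \<Gamma>K: "\<Gamma> \<inter> (K1 \<union> K2) = {}"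
  proof (rule equals0I)
    fix e assume e: "e \<in> \<Gamma> \<inter> (K1 \<union> K2)"
    then obtain a b where "e = {a, b}" "b \<in> B \<union> C" using shape[of e] by blast
    then show False using e \<Gamma>(2) disj by blast
  qed
  have \<Gamma>01: "\<Gamma>' 0 \<inter> \<Gamma>' 1 = {}"
  proof (rule equals0I)
    fix e assume e: "e \<in> \<Gamma>' 0 \<inter> \<Gamma>' 1"
    then have "e \<noteq> {}" using fg fgraph_empty_notin unfolding \<Gamma>'_def by blast
    then obtain v where "v \<in> e" by blast
    then have "j v = 0" "j v = 1" using e unfolding \<Gamma>'_def by auto
    then show False by simp
  qed
  have "(\<Gamma>' 0 \<union> K1) \<inter> (\<Gamma>' 1 \<union> K2) = {}" using K12 \<Gamma>K \<Gamma>01 \<Gamma>'\<Gamma>[of 0] \<Gamma>'\<Gamma>[of 1] by blast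
  then have "splits (1 + 1) ((\<Gamma>' 0 \<union> K1) \<union> (\<Gamma>' 1 \<union> K2))" by (intro splits_Un splits_irregular K1(2) K2(2))
  moreover have "(\<Gamma>' 0 \<union> K1) \<union> (\<Gamma>' 1 \<union> K2) = {e \<in> \<Gamma>. \<exists>i. \<forall>v\<in>e. j v = i} \<union> (K1 \<union> K2)"
  proof -
    have "{e \<in> \<Gamma>. \<exists>i. \<forall>v\<in>e. j v = i} = \<Gamma>' 0 \<union> \<Gamma>' 1"
    proof (intro equalityI subsetI)
      fix e assume "e \<in> {e \<in> \<Gamma>. \<exists>i. \<forall>v\<in>e. j v = i}"
      then obtain i where i: "e \<in> \<Gamma>" "\<forall>v\<in>e. j v = i" by blast
      have "e \<noteq> {}" using i(1) fg fgraph_empty_notin by blast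
      then obtain v where "v \<in> e" by blast
      then have "i = 0 \<or> i = 1" using i(2) unfolding j_def by (auto split: if_splits)
      then show "e \<in> \<Gamma>' 0 \<union> \<Gamma>' 1" using i unfolding \<Gamma>'_def by auto
    qed (auto simp: \<Gamma>'_def)
    then show ?thesis by blast
  qed
  ultimately have "splits 2 ({e \<in> \<Gamma>. \<exists>i. \<forall>v\<in>e. j v = i} \<union> (K1 \<union> K2))" by (simp add: numeral_2_eq_2)
  moreover have "\<forall>v. j v < 2" unfolding j_def by simp
  moreover have "K1 \<union> K2 \<subseteq> E \<inter> {{a, b} | a b. a \<in> A \<and> b \<in> B \<union> C}"
  proof
    fix e assume "e \<in> K1 \<union> K2"
    from shape[OF this] obtain a b where "e = {a, b}" "a \<in> A0" "b \<in> B \<union> C" "{a, b} \<in> E" by blast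
    then show "e \<in> E \<inter> {{a, b} | a b. a \<in> A \<and> b \<in> B \<union> C}" using A0A by blast
  qed
  ultimately show ?thesis by (intro exI[of _ j] exI[of _ "K1 \<union> K2"]) simp
qed

lemma card_smallest_class:
  fixes \<kappa> :: "'a \<Rightarrow> nat"
  assumes "finite S" "\<And>u. u \<in> S \<Longrightarrow> \<kappa> u < k" "\<And>j. j < k \<Longrightarrow> m \<le> card {u \<in> S. \<kappa> u = j}"
  shows "k * m \<le> card S"
proof -
  have "S = (\<Union>j<k. {u \<in> S. \<kappa> u = j})" using assms(2) by auto
  then have "card S = card (\<Union>j<k. {u \<in> S. \<kappa> u = j})" by simp
  also have "\<dots> = (\<Sum>j<k. card {u \<in> S. \<kappa> u = j})"
    using assms(1) by (intro card_UN_disjoint) auto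
  also have "\<dots> \<ge> (\<Sum>j<k. m)" using assms(3) by (intro sum_mono) auto
  finally show ?thesis by simp
qed

text \<open>The vertex set is cut into five classes, and each class into sixteen subclasses. Edges within
  a subclass of class \<open>i\<close> are treated with the help of the edges to the classes \<open>i + 1\<close> and \<open>i + 2\<close>
  modulo five, so that no edge serves two classes.\<close>

lemma almost_decomposition:
  fixes E :: "'a set set"
  assumes E: "fgraph E"
  shows "\<exists>R\<subseteq>E. splits 42 (E - R) \<and> (\<forall>v. degree R v \<le> 24)"
proof -
  have finE: "finite E" using E by (simp add: fgraph_def)
  have "\<exists>\<kappa>. (\<forall>v. \<kappa> v < 5) \<and>
    (\<forall>v j. j < 5 \<longrightarrow> card {u. {v, u} \<in> E \<and> \<kappa> u = \<kappa> v} \<le> card {u. {v, u} \<in> E \<and> \<kappa> u = (j::nat)})"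
    by (rule locally_optimal_cut[OF E]) simp
  then obtain \<kappa> :: "'a \<Rightarrow> nat" where \<kappa>5: "\<forall>v. \<kappa> v < 5"
    and \<kappa>: "\<forall>v j. j < 5 \<longrightarrow> card {u. {v, u} \<in> E \<and> \<kappa> u = \<kappa> v} \<le> card {u. {v, u} \<in> E \<and> \<kappa> u = j}"
    by (elim exE conjE) (rule that)
  define E1 where "E1 = {e \<in> E. \<exists>i. \<forall>v\<in>e. \<kappa> v = i}"
  have E1: "{u, v} \<in> E1 \<longleftrightarrow> {u, v} \<in> E \<and> \<kappa> u = \<kappa> v" for u v unfolding E1_def by auto
  have fg1: "fgraph E1" by (rule fgraph_subset[OF E]) (auto simp: E1_def)
  have "\<exists>\<mu>. (\<forall>v. \<mu> v < 16) \<and>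
    (\<forall>v j. j < 16 \<longrightarrow> card {u. {v, u} \<in> E1 \<and> \<mu> u = \<mu> v} \<le> card {u. {v, u} \<in> E1 \<and> \<mu> u = (j::nat)})"
    by (rule locally_optimal_cut[OF fg1]) simp
  then obtain \<mu> :: "'a \<Rightarrow> nat" where \<mu>16: "\<forall>v. \<mu> v < 16"
    and \<mu>: "\<forall>v j. j < 16 \<longrightarrow> card {u. {v, u} \<in> E1 \<and> \<mu> u = \<mu> v} \<le> card {u. {v, u} \<in> E1 \<and> \<mu> u = j}"
    by (elim exE conjE) (rule that)
  define E2 where "E2 = {e \<in> E1. \<exists>i. \<forall>v\<in>e. \<mu> v = i}"
  have E2: "{u, v} \<in> E2 \<longleftrightarrow> {u, v} \<in> E \<and> \<kappa> u = \<kappa> v \<and> \<mu> u = \<mu> v" for u v unfolding E2_def using E1 by auto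
  have fg2: "fgraph E2" by (rule fgraph_subset[OF fg1]) (auto simp: E2_def)
  have nb: "finite {u. {v, u} \<in> E}" for v
    by (rule finite_subset[OF _ finite_Union_fgraph[OF E]]) auto
  \<comment> \<open>The subclass of \<open>v\<close> contains at most one sixteenth of its
    neighbours in its own class, and these are at most as many as its neighbours in class
    \<open>j\<close>.\<close>
  have big: "16 * degree E2 v \<le> card {u. {v, u} \<in> E \<and> \<kappa> u = j}" if "j < 5" for v j
  proof -
    have "degree E2 v = card {u. {v, u} \<in> E1 \<and> \<mu> u = \<mu> v}"
      unfolding degree_neighbours[OF fg2] E2 E1 by (rule arg_cong[where f = card]) auto
    moreover have "16 * card {u. {v, u} \<in> E1 \<and> \<mu> u = \<mu> v} \<le> card {u. {v, u} \<in> E1}"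
    proof (rule card_smallest_class)
      show "finite {u. {v, u} \<in> E1}" using nb[of v] unfolding E1 by simp
      show "\<mu> u < 16" for u using \<mu>16 by simp
      show "card {u. {v, u} \<in> E1 \<and> \<mu> u = \<mu> v} \<le> card {u \<in> {u. {v, u} \<in> E1}. \<mu> u = j}" if "j < 16" for j
        using \<mu> that by simp
    qed
    moreover have "{u. {v, u} \<in> E1} = {u. {v, u} \<in> E \<and> \<kappa> u = \<kappa> v}" unfolding E1 by auto
    moreover have "card {u. {v, u} \<in> E \<and> \<kappa> u = \<kappa> v} \<le> card {u. {v, u} \<in> E \<and> \<kappa> u = j}"
      using \<kappa> that by simp
    ultimately show ?thesis by simp
  qed
  define \<Gamma> where "\<Gamma> i = {e \<in> E2. \<forall>v\<in>e. \<kappa> v = i}" for i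
  define cl where "cl i = {v. \<kappa> v = i}" for i
  have \<Gamma>2: "\<Gamma> i \<subseteq> E2" for i unfolding \<Gamma>_def by blast
  have degle: "degree (\<Gamma> i) v \<le> degree E2 v" for i v
    using degree_mono[OF _ \<Gamma>2] fg2 unfolding fgraph_def by blast
  define Z where "Z i j K \<longleftrightarrow> (\<forall>v. j v < 2) \<and>
    K \<subseteq> E \<inter> {{a, b} | a b. a \<in> cl i \<and> b \<in> cl ((i + 1) mod 5) \<union> cl ((i + 2) mod 5)} \<and>
    splits 2 ({e \<in> \<Gamma> i. \<exists>n. \<forall>v\<in>e. j v = n} \<union> K)" for i and j :: "'a \<Rightarrow> nat" and K
  have zone: "\<exists>j K. Z i j K" if i: "i < 5" for i
    unfolding Z_def
  proof (rule two_rounds[OF E])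
    show "\<Gamma> i \<subseteq> E" using \<Gamma>2 unfolding E2_def E1_def by blast
    show "\<Union>(\<Gamma> i) \<subseteq> cl i" unfolding \<Gamma>_def cl_def by blast
    have "i \<noteq> (i + 1) mod 5" "i \<noteq> (i + 2) mod 5" "(i + 1) mod 5 \<noteq> (i + 2) mod 5" using i by presburger+
    then show "cl i \<inter> cl ((i + 1) mod 5) = {}" "cl i \<inter> cl ((i + 2) mod 5) = {}"
      "cl ((i + 1) mod 5) \<inter> cl ((i + 2) mod 5) = {}" unfolding cl_def by auto
    fix a assume a: "a \<in> \<Union>(\<Gamma> i)"
    have eq: "{u \<in> cl k. {a, u} \<in> E} = {u. {a, u} \<in> E \<and> \<kappa> u = k}" for k unfolding cl_def by auto
    show "16 * degree (\<Gamma> i) a \<le> card {b \<in> cl ((i + 1) mod 5). {a, b} \<in> E}"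
      unfolding eq using big[of "(i + 1) mod 5" a] degle[of i a] by simp
    \<comment> \<open>A positive degree already gives sixteen neighbours in the third class, more
      than the four required.\<close>
    have "finite (\<Gamma> i)" using finite_subset[OF \<Gamma>2] fg2 unfolding fgraph_def by blast
    then have "degree (\<Gamma> i) a \<noteq> 0" using degree_eq_0[of "\<Gamma> i" a] a by blast
    then show "4 \<le> card {c \<in> cl ((i + 2) mod 5). {a, c} \<in> E}"
      unfolding eq using big[of "(i + 2) mod 5" a] degle[of i a] by simp
  qed
  have "\<forall>i. \<exists>j K. i < 5 \<longrightarrow> Z i j K" using zone by simp
  then obtain j K where "\<forall>i. i < 5 \<longrightarrow> Z i (j i) (K i)" by metis
  then have jK: "(\<forall>v. j i v < 2) \<and>
    K i \<subseteq> E \<inter> {{a, b} | a b. a \<in> cl i \<and> b \<in> cl ((i + 1) mod 5) \<union> cl ((i + 2) mod 5)} \<and>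
    splits 2 ({e \<in> \<Gamma> i. \<exists>n. \<forall>v\<in>e. j i v = n} \<union> K i)" if "i < 5" for i
    using that unfolding Z_def by simp
  define D where "D i = {e \<in> \<Gamma> i. \<exists>n. \<forall>v\<in>e. j i v = n} \<union> K i" for i
  have DE: "D i \<subseteq> E" if "i < 5" for i
    using jK[OF that] \<Gamma>2[of i] unfolding D_def E2_def E1_def by auto
  have Dzone: "\<exists>u v. e = {u, v} \<and> \<kappa> u = i \<and> (\<kappa> v = i \<or> \<kappa> v = (i + 1) mod 5 \<or> \<kappa> v = (i + 2) mod 5)"
    if e: "e \<in> D i" "i < 5" for e i
  proof (cases "e \<in> K i")
    case True
    have "e \<in> {{a, b} | a b. a \<in> cl i \<and> b \<in> cl ((i + 1) mod 5) \<union> cl ((i + 2) mod 5)}"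
      using jK[OF e(2)] True by auto
    then show ?thesis unfolding cl_def by blast
  next
    case False
    then have "e \<in> \<Gamma> i" using e(1) unfolding D_def by blast
    then obtain u v where "e = {u, v}" using fgraph_edgeE2[OF fgraph_subset[OF fg2 \<Gamma>2[of i]]] by metis
    then show ?thesis using \<open>e \<in> \<Gamma> i\<close> unfolding \<Gamma>_def by blast
  qed
  have "splits (2 * 5) (\<Union>i<5. D i)"
  proof (rule splits_UN)
    show "splits 2 (D i)" if "i < 5" for i using jK[OF that] unfolding D_def by simp
    show "D i \<inter> D k = {}" if ik: "i < 5" "k < 5" "i \<noteq> k" for i k
    proof (rule equals0I)
      fix e assume e: "e \<in> D i \<inter> D k"
      obtain u v where uv: "e = {u, v}" "\<kappa> u = i" "\<kappa> v = i \<or> \<kappa> v = (i + 1) mod 5 \<or> \<kappa> v = (i + 2) mod 5"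
        using Dzone[of e i] e ik by auto
      obtain x y where xy: "e = {x, y}" "\<kappa> x = k" "\<kappa> y = k \<or> \<kappa> y = (k + 1) mod 5 \<or> \<kappa> y = (k + 2) mod 5"
        using Dzone[of e k] e ik by auto
      \<comment> \<open>An edge serving two classes would be a step by 1 or 2 in both directions,
        but 1, 2, -1 and -2 are distinct modulo five.\<close>
      have "x = v \<and> y = u" using uv xy ik(3) by (auto simp: doubleton_eq_iff)
      then have "k = i \<or> k = (i + 1) mod 5 \<or> k = (i + 2) mod 5" "i = k \<or> i = (k + 1) mod 5 \<or> i = (k + 2) mod 5"
        using uv xy by auto
      moreover have "(x + 1) mod 5 = (if x < 4 then x + 1 else x - 4)" "(x + 2) mod 5 = (if x < 3 then x + 2 else x - 3)"
        if "x < 5" for x :: nat using that by (auto simp: mod_if)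
      ultimately show False using ik by (auto split: if_splits)
    qed
  qed
  then have dD: "splits 10 (\<Union>i<5. D i)" by simp
  let ?Q = "E - (\<Union>i<5. D i)"
  have fgQ: "fgraph ?Q" by (rule fgraph_subset[OF E]) blast
  \<comment> \<open>Class, subclass and round as digits of one number below 5 * 16 * 2 = 160. An
    edge whose ends agree in all three was treated in \<open>D\<close>.\<close>
  define \<rho> where "\<rho> v = \<kappa> v + 5 * (\<mu> v + 16 * j (\<kappa> v) v)" for v
  have "\<exists>R\<subseteq>?Q. splits (4 * 8) (?Q - R) \<and> (\<forall>v. degree R v \<le> 3 * 8)"
  proof (rule multipartite_splits[OF fgQ])
    show "\<rho> v < 2 ^ 8" for v
    proof -
      have "\<kappa> v < 5" "\<mu> v < 16" "j (\<kappa> v) v < 2" using \<kappa>5 \<mu>16 jK[of "\<kappa> v"] by auto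
      then show ?thesis unfolding \<rho>_def by simp
    qed
    show "\<rho> u \<noteq> \<rho> v" if uv: "{u, v} \<in> ?Q" for u v
    proof
      assume eq: "\<rho> u = \<rho> v"
      have 5: "(a + 5 * m) mod 5 = a" "(a + 5 * m) div 5 = m" if "a < 5" for a m :: nat using that by simp_all
      have 16: "(a + 16 * m) mod 16 = a" "(a + 16 * m) div 16 = m" if "a < 16" for a m :: nat using that by simp_all
      have "\<rho> w mod 5 = \<kappa> w" "\<rho> w div 5 mod 16 = \<mu> w" "\<rho> w div 5 div 16 = j (\<kappa> w) w" for w
        using 5[of "\<kappa> w"] 16[of "\<mu> w"] \<kappa>5 \<mu>16 unfolding \<rho>_def by metis+
      then have same: "\<kappa> u = \<kappa> v" "\<mu> u = \<mu> v" "j (\<kappa> u) u = j (\<kappa> u) v" using eq by metis+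
      then have "{u, v} \<in> \<Gamma> (\<kappa> u)" using uv E2 unfolding \<Gamma>_def by auto
      then have "{u, v} \<in> D (\<kappa> u)" using same(3) unfolding D_def by auto
      then show False using uv \<kappa>5 by blast
    qed
  qed
  then obtain R where R: "R \<subseteq> ?Q" "splits 32 (?Q - R)" "\<forall>v. degree R v \<le> 24" by auto
  have "splits (10 + 32) ((\<Union>i<5. D i) \<union> (?Q - R))" using dD R(2) by (rule splits_Un) blast
  moreover have "(\<Union>i<5. D i) \<union> (?Q - R) = E - R" using R(1) DE by blast
  ultimately have "splits 42 (E - R)" by simp
  then show ?thesis using R by (intro exI[of _ R]) blast
qed

section \<open>Even orientations\<close>

text \<open>An orientation assigns to each edge one of its endpoints, its tail.\<close>

definition out :: "'a set set \<Rightarrow> ('a set \<Rightarrow> 'a) \<Rightarrow> 'a \<Rightarrow> 'a set set" where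
  "out E \<alpha> v = {e \<in> E. \<alpha> e = v}"

text \<open>Reversing the edges of \<open>J\<close> changes every out-set by a symmetric difference.
  With \<open>J\<close> taken from a walk or from \<open>T_join\<close>, this prescribes the
  parities of the out-degrees.\<close>

lemma flip_orientation:
  assumes "fgraph E" "\<forall>e\<in>E. \<alpha> e \<in> e" "J \<subseteq> E"
  shows "\<exists>\<beta>. (\<forall>e\<in>E. \<beta> e \<in> e) \<and>
    (\<forall>v. out E \<beta> v = (out E \<alpha> v - {e \<in> J. v \<in> e}) \<union> ({e \<in> J. v \<in> e} - out E \<alpha> v)) \<and>
    (\<forall>v. odd (card (out E \<beta> v)) \<longleftrightarrow> odd (card (out E \<alpha> v)) \<noteq> odd (degree J v))"
proof -
  have "\<exists>w. w \<in> e \<and> w \<noteq> \<alpha> e \<and> e = {\<alpha> e, w}" if e: "e \<in> E" for e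
  proof -
    obtain w where "e = {\<alpha> e, w}" "\<alpha> e \<noteq> w" using fgraph_edgeE[OF assms(1) e] assms(2) e by metis
    then show ?thesis by (intro exI[of _ w]) auto
  qed
  then obtain o' where o': "\<And>e. e \<in> E \<Longrightarrow> o' e \<in> e \<and> o' e \<noteq> \<alpha> e \<and> e = {\<alpha> e, o' e}" by metis
  define \<beta> where "\<beta> e = (if e \<in> J then o' e else \<alpha> e)" for e
  have finE: "finite E" using assms(1) by (simp add: fgraph_def)
  have eq: "out E \<beta> v = (out E \<alpha> v - {e \<in> J. v \<in> e}) \<union> ({e \<in> J. v \<in> e} - out E \<alpha> v)" for v
  proof (rule set_eqI)
    fix e
    show "e \<in> out E \<beta> v \<longleftrightarrow> e \<in> (out E \<alpha> v - {e \<in> J. v \<in> e}) \<union> ({e \<in> J. v \<in> e} - out E \<alpha> v)"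
    proof (cases "e \<in> J")
      case True
      then have "e \<in> E" using assms(3) by blast
      note o = o'[OF this]
      have "v \<in> e \<longleftrightarrow> v = \<alpha> e \<or> v = o' e" using o by (metis insert_iff singletonD)
      then show ?thesis using True \<open>e \<in> E\<close> o unfolding out_def \<beta>_def by auto
    next
      case False
      then show ?thesis unfolding out_def \<beta>_def by simp
    qed
  qed
  have "odd (card (out E \<beta> v)) \<longleftrightarrow> odd (card (out E \<alpha> v)) \<noteq> odd (degree J v)" for v
  proof -
    have "finite (out E \<alpha> v)" "finite {e \<in> J. v \<in> e}"
      using finE finite_subset[OF assms(3) finE] unfolding out_def by auto
    then show ?thesis unfolding eq degree_def by (rule card_sym_diff_parity)
  qed
  moreover have "\<forall>e\<in>E. \<beta> e \<in> e" using o' assms(2) unfolding \<beta>_def by simp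
  ultimately show ?thesis using eq by (intro exI[of _ \<beta>]) simp
qed

section \<open>Stars and paths of length two as pieces\<close>

lemma pair_partition:
  assumes "finite S" "even (card S)"
  shows "\<exists>P. \<Union>P = S \<and> (\<forall>p\<in>P. card p = 2) \<and> (\<forall>p\<in>P. \<forall>q\<in>P. p \<noteq> q \<longrightarrow> p \<inter> q = {})"
  using assms
proof (induction "card S" arbitrary: S rule: less_induct)
  case less
  show ?case
  proof (cases "S = {}")
    case True then show ?thesis by (intro exI[of _ "{}"]) simp
  next
    case False
    then have "card S \<noteq> 0" using less.prems(1) by simp
    then have "2 \<le> card S" using less.prems(2) by (intro dvd_imp_le) auto
    then obtain T where T: "T \<subseteq> S" "card T = 2" "finite T" by (rule obtain_subset_with_card_n)
    have c: "card (S - T) = card S - 2" using T by (simp add: card_Diff_subset)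
    then have "card (S - T) < card S" "even (card (S - T))" using \<open>2 \<le> card S\<close> less.prems(2) by auto
    then obtain P where P: "\<Union>P = S - T" "\<forall>p\<in>P. card p = 2" "\<forall>p\<in>P. \<forall>q\<in>P. p \<noteq> q \<longrightarrow> p \<inter> q = {}"
      using less.hyps[of "S - T"] less.prems(1) by auto
    have "p \<inter> T = {}" if "p \<in> P" for p using P(1) that by blast
    then show ?thesis using P T by (intro exI[of _ "insert T P"]) auto
  qed
qed

lemma irregular_star:
  assumes "fgraph S" "\<forall>e\<in>S. v \<in> e" "card S \<ge> 2"
  shows "irregular S"
proof (rule liI)
  have dv: "degree S v \<ge> 2" unfolding degree_def using assms(2,3) by (simp add: Collect_conj_eq Int_absorb2 subset_iff)
  have dw: "degree S w \<le> 1" if w: "w \<noteq> v" for w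
  proof (rule degree_le_1)
    show "finite S" using assms(1) by (simp add: fgraph_def)
    have par: "e = {v, w}" if e: "e \<in> S" "w \<in> e" for e
    proof -
      obtain x where "e = {w, x}" using fgraph_edgeE[OF assms(1) e] by metis
      then show ?thesis using assms(2) e(1) w by auto
    qed
    show "e = e'" if "e \<in> S" "e' \<in> S" "w \<in> e" "w \<in> e'" for e e' using par[OF that(1,3)] par[OF that(2,4)] by simp
  qed
  fix a b assume ab: "{a, b} \<in> S"
  then have "a \<noteq> b" "a = v \<or> b = v" using fgraph_neq[OF assms(1)] assms(2) by auto
  then show "degree S a \<noteq> degree S b" using dv dw[of a] dw[of b] by auto
qed

lemma star_vertices:
  assumes "fgraph S" "\<forall>e\<in>S. v \<in> e"
  shows "card (\<Union>S) \<le> card S + 1"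
proof -
  have fin: "finite S" using assms(1) by (simp add: fgraph_def)
  have "\<exists>w. e = {v, w}" if e: "e \<in> S" for e
  proof -
    have "v \<in> e" using assms(2) e by blast
    from fgraph_edgeE[OF assms(1) e this] show ?thesis by metis
  qed
  then obtain o' where o': "\<And>e. e \<in> S \<Longrightarrow> e = {v, o' e}" by metis
  have "\<Union>S \<subseteq> insert v (o' ` S)" using o' by (auto; blast)
  then have "card (\<Union>S) \<le> card (insert v (o' ` S))" using fin by (intro card_mono) auto
  also have "\<dots> \<le> card S + 1" using card_insert_le_m1[of "card S + 1" "o' ` S" v] card_image_le[OF fin, of o'] by simp
  finally show ?thesis .
qed

text \<open>Reversing a join makes all out-degrees even, except possibly at one vertex per
  component. Where one stays odd, an outgoing edge goes to \<open>M\<close>; the out-sets of the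
  rest are paired into paths of length two. Such a path has three vertices, each lying in at most
  \<open>D\<close> paths, whence \<open>3 * D + 1\<close> colours.\<close>

lemma bounded_degree_splits:
  assumes "fgraph R" "\<And>v. degree R v \<le> D"
  shows "\<exists>M\<subseteq>R. splits (3 * D + 1) (R - M) \<and> (\<forall>v. degree M v \<le> 1)"
proof -
  obtain r l p x where tree: "rooted R r l p"
    and x: "\<forall>u v. {u, v} \<in> R \<longrightarrow> x u = x v" "\<forall>v. x (x v) = x v" "\<forall>v. degree (forest l p) (x v) \<le> 1"
    and join: "\<forall>T. finite T \<longrightarrow> (\<exists>J\<subseteq>forest l p. \<forall>v. x v \<noteq> v \<longrightarrow> (odd (degree J v) \<longleftrightarrow> v \<in> T))"
    using leaf_forest[OF assms(1)] by (elim exE conjE) (rule that)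
  have finR: "finite R" using assms(1) by (simp add: fgraph_def)
  have "e \<noteq> {}" if "e \<in> R" for e using that fgraph_empty_notin[OF assms(1)] by blast
  then obtain \<alpha>0 where \<alpha>0: "\<forall>e\<in>R. \<alpha>0 e \<in> e" by (metis all_not_in_conv)
  let ?T = "{v \<in> \<Union>R. odd (card (out R \<alpha>0 v))}"
  have "finite ?T" by (rule finite_subset[OF _ finite_Union_fgraph[OF assms(1)]]) auto
  from join[rule_format, OF this] obtain J
    where J: "J \<subseteq> forest l p" "\<forall>v. x v \<noteq> v \<longrightarrow> (odd (degree J v) \<longleftrightarrow> v \<in> ?T)"
    by (elim exE conjE) (rule that)
  have JR: "J \<subseteq> R" using J(1) forest_subset[OF tree] by blast
  obtain \<alpha> where \<alpha>: "\<forall>e\<in>R. \<alpha> e \<in> e"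
    and par: "\<forall>v. odd (card (out R \<alpha> v)) \<longleftrightarrow> odd (card (out R \<alpha>0 v)) \<noteq> odd (degree J v)"
    using flip_orientation[OF assms(1) \<alpha>0 JR] by (elim exE conjE) (rule that)
  have ev: "even (card (out R \<alpha> v))" if "x v \<noteq> v" for v
  proof -
    have "v \<in> \<Union>R" if "odd (card (out R \<alpha>0 v))"
    proof -
      have "out R \<alpha>0 v \<noteq> {}" using that by fastforce
      then show ?thesis using \<alpha>0 unfolding out_def by auto
    qed
    then show ?thesis using par[rule_format, of v] J(2)[rule_format, OF that] by auto
  qed
  have finO: "finite (out R \<alpha> v)" for v unfolding out_def using finR by simp
  have "\<exists>e. odd (card (out R \<alpha> v)) \<longrightarrow> e \<in> out R \<alpha> v" for v by (cases "out R \<alpha> v = {}") auto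
  then obtain f where f: "\<And>v. odd (card (out R \<alpha> v)) \<Longrightarrow> f v \<in> out R \<alpha> v" by metis
  define M where "M = f ` {v. odd (card (out R \<alpha> v))}"
  have fR: "f v \<in> R \<and> \<alpha> (f v) = v \<and> x v = v" if "odd (card (out R \<alpha> v))" for v
    using f[OF that] ev[of v] that unfolding out_def by auto
  have MR: "M \<subseteq> R" unfolding M_def using fR by auto
  \<comment> \<open>An edge of \<open>M\<close> is determined by the exceptional vertex of its
    component, so there is at most one per component.\<close>
  have Mpar: "e = f (x w)" if e: "e \<in> M" "w \<in> e" for e w
  proof -
    obtain v where v: "odd (card (out R \<alpha> v))" "e = f v" using e(1) unfolding M_def by blast
    note fv = fR[OF v(1)]
    then have "v \<in> e" using \<alpha> v(2) by auto
    moreover have "e \<in> R" using fv v(2) by simp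
    ultimately have "x w = x v"
      using fgraph_edgeE[OF assms(1) \<open>e \<in> R\<close> \<open>v \<in> e\<close>] x(1) e(2) by (metis insertE singletonD)
    then show ?thesis using fv v(2) by simp
  qed
  have M1: "degree M v \<le> 1" for v
    using finite_subset[OF MR finR] Mpar[of _ v] by (intro degree_le_1) metis+
  have rest: "even (card (out (R - M) \<alpha> v))" for v
  proof (cases "odd (card (out R \<alpha> v))")
    case True
    have "out (R - M) \<alpha> v = out R \<alpha> v - {f v}"
    proof -
      have "e = f v" if "e \<in> M" "\<alpha> e = v" for e using that fR unfolding M_def by auto
      moreover have "f v \<in> M" using True unfolding M_def by blast
      ultimately show ?thesis unfolding out_def by auto
    qed
    then show ?thesis using True finO[of v] f[OF True] by simp
  next
    case False
    have "out (R - M) \<alpha> v = out R \<alpha> v" unfolding out_def using fR False unfolding M_def by auto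
    then show ?thesis using False by simp
  qed
  have "\<exists>P. \<Union>P = out (R - M) \<alpha> v \<and> (\<forall>p\<in>P. card p = 2) \<and> (\<forall>p\<in>P. \<forall>q\<in>P. p \<noteq> q \<longrightarrow> p \<inter> q = {})" for v
    using rest[of v] finR unfolding out_def by (intro pair_partition) auto
  then obtain P where P: "\<And>v. \<Union>(P v) = out (R - M) \<alpha> v" "\<And>v. \<forall>p\<in>P v. card p = 2"
    "\<And>v. \<forall>p\<in>P v. \<forall>q\<in>P v. p \<noteq> q \<longrightarrow> p \<inter> q = {}" by metis
  define PP where "PP = (\<Union>v\<in>\<Union>R. P v)"
  have PPE: "\<exists>v. p \<in> P v \<and> p \<subseteq> out (R - M) \<alpha> v" if "p \<in> PP" for p
    using that P(1) unfolding PP_def by blast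
  have PPst: "p \<subseteq> R \<and> card p = 2 \<and> (\<exists>v. \<forall>e\<in>p. v \<in> e)" if p: "p \<in> PP" for p
  proof -
    obtain v where v: "p \<in> P v" "p \<subseteq> out (R - M) \<alpha> v" using PPE[OF p] by blast
    then have "\<forall>e\<in>p. v \<in> e" using \<alpha> unfolding out_def by auto
    then show ?thesis using v P(2) unfolding out_def by blast
  qed
  have UPP: "\<Union>PP = R - M"
  proof
    show "\<Union>PP \<subseteq> R - M" using PPE unfolding out_def by blast
    show "R - M \<subseteq> \<Union>PP"
    proof
      fix e assume e: "e \<in> R - M"
      then have "e \<in> \<Union>(P (\<alpha> e))" unfolding P(1) out_def by simp
      moreover have "\<alpha> e \<in> \<Union>R" using e \<alpha> by auto
      ultimately show "e \<in> \<Union>PP" unfolding PP_def by blast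
    qed
  qed
  have "splits (3 * D + 1) (\<Union>PP)"
  proof (rule splits_pieces)
    have "PP \<subseteq> Pow R" using PPst by blast
    then show "finite PP" using finR finite_subset by auto
    fix p assume p: "p \<in> PP"
    note pp = PPst[OF p]
    show fg: "fgraph p" using fgraph_subset[OF assms(1)] pp by blast
    from pp obtain v where v: "\<forall>e\<in>p. v \<in> e" by blast
    show "irregular p" using irregular_star[OF fg v] pp by simp
    show "card (\<Union>p) \<le> 3" using star_vertices[OF fg v] pp by simp
    fix q assume q: "q \<in> PP" "p \<noteq> q"
    obtain v where v: "p \<in> P v" "p \<subseteq> out (R - M) \<alpha> v" using PPE[OF p] by blast
    obtain w where w: "q \<in> P w" "q \<subseteq> out (R - M) \<alpha> w" using PPE[OF q(1)] by blast
    show "p \<inter> q = {}"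
    proof (cases "v = w")
      case True then show ?thesis using P(3)[of v] v(1) w(1) q(2) by blast
    next
      case False then show ?thesis using v(2) w(2) unfolding out_def by blast
    qed
  next
    show "degree (\<Union>PP) v \<le> D" for v
      using degree_mono[OF finR, of "\<Union>PP" v] assms(2)[of v] unfolding UPP by simp
  qed
  then show ?thesis using MR M1 unfolding UPP by (intro exI[of _ M]) simp
qed

text \<open>Centres of the stars have even degree; if a leaf is shared by an even number of stars, moving one of
  them to a second colour makes it odd in both.\<close>

lemma splits_stars:
  assumes U: "finite U"
    and S: "\<And>u. u \<in> U \<Longrightarrow> fgraph (S u) \<and> even (card (S u)) \<and> (\<forall>e\<in>S u. u \<in> e)"
    and cen: "\<And>u u' e. u \<in> U \<Longrightarrow> u' \<in> U \<Longrightarrow> u \<noteq> u' \<Longrightarrow> e \<in> S u \<Longrightarrow> u' \<notin> e"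
    and share: "\<And>u u' e e' w. u \<in> U \<Longrightarrow> u' \<in> U \<Longrightarrow> u \<noteq> u' \<Longrightarrow> e \<in> S u \<Longrightarrow> e' \<in> S u' \<Longrightarrow> w \<in> e \<Longrightarrow> w \<in> e'
      \<Longrightarrow> w = g u"
  shows "splits 2 (\<Union>u\<in>U. S u)"
proof -
  \<comment> \<open>The centres of the stars that have \<open>w\<close> as a leaf.\<close>
  define L where "L w = {u \<in> U. {u, w} \<in> S u}" for w
  have finL: "finite (L w)" for w unfolding L_def using U by simp
  have "\<exists>u. L w \<noteq> {} \<longrightarrow> u \<in> L w" for w by blast
  then obtain m where m: "\<And>w. L w \<noteq> {} \<Longrightarrow> m w \<in> L w" by metis
  \<comment> \<open>For each leaf \<open>w\<close> shared by an even number of stars, the star at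
    \<open>m w\<close> is moved. As the star at \<open>u\<close> can share only the leaf
    \<open>g u\<close>, no star is moved on behalf of two leaves.\<close>
  define Mv where "Mv = {u \<in> U. u \<in> L (g u) \<and> u = m (g u) \<and> even (card (L (g u)))}"
  have MvU: "Mv \<subseteq> U" unfolding Mv_def by blast
  have gL: "g u = w" if uw: "u \<in> L w" "card (L w) \<noteq> 1" for u w
  proof -
    have "L w \<noteq> {u}" using uw(2) by auto
    then obtain u' where "u' \<in> L w" "u' \<noteq> u" using uw(1) by blast
    then show ?thesis using share[of u u' "{u, w}" "{u', w}" w] uw(1) unfolding L_def by auto
  qed
  have key: "irregular (\<Union>u\<in>X. S u)" if X: "X = U - Mv \<or> X = Mv" for X
  proof (rule irregular_parityI)
    let ?H = "\<Union>u\<in>X. S u"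
    have XU: "X \<subseteq> U" using X MvU by blast
    have odd: "odd (card (L w \<inter> X))" if u: "u \<in> L w" "u \<in> X" for u w
    proof (cases "card (L w) = 1")
      case True
      then have "L w = {u}" using u(1) by (metis card_1_singletonE singletonD)
      then show ?thesis using u(2) by simp
    next
      case False
      note g = gL[OF _ False]
      show ?thesis
      proof (cases "even (card (L w))")
        case True
        have mw: "m w \<in> L w" using m u(1) by blast
        have one: "L w \<inter> Mv = {m w}"
        proof
          show "L w \<inter> Mv \<subseteq> {m w}" using g unfolding Mv_def by auto
          show "{m w} \<subseteq> L w \<inter> Mv" using g[OF mw] mw True unfolding Mv_def L_def by auto
        qed
        have "L w \<inter> (U - Mv) = L w - {m w}" using one unfolding L_def by blast
        moreover have "card (L w) \<noteq> 0" using mw finL[of w] by auto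
        ultimately have "odd (card (L w \<inter> (U - Mv)))" using True mw finL[of w] by simp
        then show ?thesis using X one by auto
      next
        case odd: False
        have "L w \<inter> Mv = {}" using g odd unfolding Mv_def by auto
        then have "X = U - Mv" using X u by blast
        then have "L w \<inter> X = L w" using \<open>L w \<inter> Mv = {}\<close> unfolding L_def by blast
        then show ?thesis using odd by simp
      qed
    qed
    fix e assume "e \<in> ?H"
    then obtain u where u: "u \<in> X" "e \<in> S u" by blast
    then have uU: "u \<in> U" using XU by blast
    note Su = S[OF uU]
    obtain w where w: "e = {u, w}" "u \<noteq> w" using fgraph_edgeE[of "S u" e u] Su u(2) by metis
    have "{f \<in> ?H. u \<in> f} = S u"
    proof
      show "{f \<in> ?H. u \<in> f} \<subseteq> S u" using cen uU XU by blast
      show "S u \<subseteq> {f \<in> ?H. u \<in> f}" using Su u(1) by blast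
    qed
    then have "even (degree ?H u)" unfolding degree_def using Su by simp
    moreover have "odd (degree ?H w)"
    proof -
      have wU: "w \<notin> U" using cen[OF uU _ _ u(2), of w] w by auto
      have "{f \<in> ?H. w \<in> f} = (\<lambda>u. {u, w}) ` (L w \<inter> X)"
      proof (intro equalityI subsetI)
        fix f assume "f \<in> {f \<in> ?H. w \<in> f}"
        then obtain u' where u': "u' \<in> X" "f \<in> S u'" "w \<in> f" by blast
        then have "u' \<in> U" using XU by blast
        then have "fgraph (S u')" "u' \<in> f" using S u'(2) by auto
        then have "f = {u', w}" using fgraph_edgeE[of "S u'" f u'] u' wU \<open>u' \<in> U\<close> by (metis insertE singletonD)
        then show "f \<in> (\<lambda>u. {u, w}) ` (L w \<inter> X)" using u' \<open>u' \<in> U\<close> unfolding L_def by blast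
      next
        fix f assume "f \<in> (\<lambda>u. {u, w}) ` (L w \<inter> X)"
        then show "f \<in> {f \<in> ?H. w \<in> f}" unfolding L_def by blast
      qed
      moreover have "inj_on (\<lambda>u. {u, w}) (L w \<inter> X)" by (auto simp: inj_on_def doubleton_eq_iff)
      ultimately have "degree ?H w = card (L w \<inter> X)" unfolding degree_def by (simp add: card_image)
      moreover have "u \<in> L w" using uU w u(2) unfolding L_def by simp
      ultimately show ?thesis using odd[of u w] u(1) by simp
    qed
    ultimately show "\<exists>u v. e = {u, v} \<and> even (degree ?H u) \<and> odd (degree ?H v)" using w(1) by blast
  qed
  have "(\<Union>u\<in>U - Mv. S u) \<inter> (\<Union>u\<in>Mv. S u) = {}"
  proof (rule equals0I)
    fix e assume "e \<in> (\<Union>u\<in>U - Mv. S u) \<inter> (\<Union>u\<in>Mv. S u)"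
    then obtain u u' where "u \<in> U" "u \<notin> Mv" "e \<in> S u" "u' \<in> Mv" "e \<in> S u'" by blast
    then show False using cen[of u u' e] S[of u'] MvU by blast
  qed
  then have "splits (1 + 1) ((\<Union>u\<in>U - Mv. S u) \<union> (\<Union>u\<in>Mv. S u))" using key by (intro splits_Un splits_irregular) auto
  moreover have "(\<Union>u\<in>U - Mv. S u) \<union> (\<Union>u\<in>Mv. S u) = (\<Union>u\<in>U. S u)" using MvU by blast
  ultimately show ?thesis by (simp add: numeral_2_eq_2)
qed

text \<open>Each vertex of \<open>Q\<close> points to at most one other, so the average number of conflicts is at
  most two.\<close>

lemma functional_degenerate:
  assumes "finite Q" "Q \<noteq> {}" "\<And>u. u \<in> Q \<Longrightarrow> card {v \<in> Q. v \<noteq> u \<and> A u v} \<le> 1"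
  shows "\<exists>u\<in>Q. card {v \<in> Q. v \<noteq> u \<and> (A u v \<or> A v u)} \<le> 2"
proof (rule ccontr)
  assume no: "\<not> ?thesis"
  have two: "2 \<le> card {v \<in> Q. v \<noteq> u \<and> A v u}" if u: "u \<in> Q" for u
  proof -
    have eq: "{v \<in> Q. v \<noteq> u \<and> (A u v \<or> A v u)} = {v \<in> Q. v \<noteq> u \<and> A u v} \<union> {v \<in> Q. v \<noteq> u \<and> A v u}" by auto
    have "card {v \<in> Q. v \<noteq> u \<and> (A u v \<or> A v u)} \<le> card {v \<in> Q. v \<noteq> u \<and> A u v} + card {v \<in> Q. v \<noteq> u \<and> A v u}"
      unfolding eq by (rule card_Un_le)
    moreover have "\<not> card {v \<in> Q. v \<noteq> u \<and> (A u v \<or> A v u)} \<le> 2" using no u by blast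
    ultimately show ?thesis using assms(3)[OF u] by linarith
  qed
  have "card (SIGMA u:Q. {v \<in> Q. v \<noteq> u \<and> A v u}) = (\<Sum>u\<in>Q. card {v \<in> Q. v \<noteq> u \<and> A v u})"
    using assms(1) by simp
  also have "\<dots> \<ge> (\<Sum>u\<in>Q. 2)" using two by (rule sum_mono)
  finally have "2 * card Q \<le> card (SIGMA u:Q. {v \<in> Q. v \<noteq> u \<and> A v u})" by simp
  also have "\<dots> \<le> card Q"
  proof (rule card_inj_on_le[of snd])
    show "inj_on snd (SIGMA u:Q. {v \<in> Q. v \<noteq> u \<and> A v u})"
    proof (rule inj_onI)
      fix x y assume x: "x \<in> (SIGMA u:Q. {v \<in> Q. v \<noteq> u \<and> A v u})"
        and y: "y \<in> (SIGMA u:Q. {v \<in> Q. v \<noteq> u \<and> A v u})" and eq: "snd x = snd y"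
      obtain u v where xu: "x = (u, v)" "u \<in> Q" "v \<in> Q" "v \<noteq> u" "A v u" using x by auto
      obtain u' where yu: "y = (u', v)" "u' \<in> Q" "v \<noteq> u'" "A v u'" using y eq xu(1) by auto
      have "finite {w \<in> Q. w \<noteq> v \<and> A v w}" using assms(1) by simp
      then have "\<forall>a\<in>{w \<in> Q. w \<noteq> v \<and> A v w}. \<forall>b\<in>{w \<in> Q. w \<noteq> v \<and> A v w}. a = b"
        using assms(3)[OF xu(3)] by (simp add: card_le_Suc0_iff_eq)
      then have "u = u'" using xu yu by blast
      then show "x = y" using xu yu by simp
    qed
  qed (use assms(1) in auto)
  finally show False using assms(1,2) by (simp add: card_gt_0_iff)
qed

lemma UN_classes:
  fixes f :: "'a \<Rightarrow> nat"
  assumes "\<And>u. u \<in> U \<Longrightarrow> f u < k"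
  shows "(\<Union>j<k. \<Union>u\<in>{u \<in> U. f u = j}. S u) = (\<Union>u\<in>U. S u)"
  using assms by blast

text \<open>Each out-set is an even star with at most one matching edge. If there is one, evenness
  supplies a tree edge as well; the two form the path \<open>Q v\<close>, and the rest
  \<open>S' v\<close> is an even star in the tree. The stars are sorted by level modulo 3 and the
  paths by a conflict colouring with 3 colours; \<open>splits_stars\<close> needs 2 colours for each
  class, which gives 2 * 3 + 2 * 3 = 12.\<close>

lemma forest_matching_splits:
  assumes tree: "rooted E r l p" and E: "fgraph E"
    and M: "fgraph M" "\<And>v. degree M v \<le> 1" "M \<inter> forest l p = {}"
    and S: "S \<subseteq> forest l p \<union> M" "\<forall>e\<in>S. \<alpha> e \<in> e" "\<And>v. even (card (out S \<alpha> v))"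
  shows "splits 12 S"
proof -
  define F where "F = forest l p"
  have fgF: "fgraph F" unfolding F_def by (rule fgraph_subset[OF E forest_subset[OF tree]])
  have fgS: "fgraph S" by (rule fgraph_subset[OF fgraph_Un[OF fgF M(1)]]) (use S(1) F_def in blast)
  have finS: "finite S" using fgS by (simp add: fgraph_def)
  have finM: "finite M" using M(1) by (simp add: fgraph_def)
  define O' where "O' v = out S \<alpha> v" for v
  have O': "O' v \<subseteq> S" "finite (O' v)" "e \<in> O' v \<Longrightarrow> v \<in> e" "e \<in> O' v \<Longrightarrow> \<alpha> e = v" for v e
    using finS S(2) unfolding O'_def out_def by auto
  have O'M: "e = e'" if "e \<in> M" "e' \<in> M" "w \<in> e" "w \<in> e'" for e e' w
    using degree_le_1D[OF finM M(2) that] .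
  define Tk where "Tk = {v \<in> \<Union>S. O' v \<inter> M \<noteq> {}}"
  have finV: "finite (\<Union>S)" by (rule finite_Union_fgraph[OF fgS])
  have finTk: "finite Tk" unfolding Tk_def by (rule finite_subset[OF _ finV]) auto
  have "\<exists>e f. e \<in> O' v \<inter> M \<and> f \<in> O' v \<inter> F" if v: "v \<in> Tk" for v
  proof -
    obtain e where e: "e \<in> O' v" "e \<in> M" using v unfolding Tk_def by blast
    have "even (card (O' v))" unfolding O'_def by (rule S(3))
    then have "O' v \<noteq> {e}" by auto
    then obtain f where f: "f \<in> O' v" "f \<noteq> e" using e(1) by blast
    then have "f \<notin> M" using O'M[of e f v] e O'(3) by blast
    then have "f \<in> F" using f(1) O'(1) S(1) unfolding F_def by blast
    then show ?thesis using e f by blast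
  qed
  then obtain ed fd where ef: "\<And>v. v \<in> Tk \<Longrightarrow> ed v \<in> O' v \<inter> M \<and> fd v \<in> O' v \<inter> F" by metis
  define Q where "Q v = {ed v, fd v}" for v
  define S' where "S' v = (if v \<in> Tk then O' v - Q v else O' v)" for v
  have edfd: "ed v \<noteq> fd v" if "v \<in> Tk" for v using ef[OF that] M(3) unfolding F_def by auto
  have QO: "Q v \<subseteq> O' v" if "v \<in> Tk" for v using ef[OF that] unfolding Q_def by blast
  have S'O: "S' v \<subseteq> O' v" for v unfolding S'_def by auto
  have S'F: "S' v \<subseteq> F" if "v \<in> \<Union>S" for v
  proof
    fix e assume e: "e \<in> S' v"
    show "e \<in> F"
    proof (rule ccontr)
      assume "e \<notin> F"
      then have "e \<in> M" using e S'O O'(1) S(1) unfolding F_def by blast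
      moreover have "e \<in> O' v" using e S'O by blast
      ultimately have "v \<in> Tk" using that unfolding Tk_def by blast
      then have "e = ed v" using O'M[of e "ed v" v] ef[OF \<open>v \<in> Tk\<close>] \<open>e \<in> M\<close> \<open>e \<in> O' v\<close> O'(3) by blast
      then show False using e \<open>v \<in> Tk\<close> unfolding S'_def Q_def by simp
    qed
  qed
  have S'even: "even (card (S' v))" for v
  proof (cases "v \<in> Tk")
    case True
    have "card (S' v) = card (O' v) - card (Q v)"
      using True QO[OF True] unfolding S'_def Q_def by (simp add: card_Diff_subset)
    moreover have "card (Q v) = 2" using edfd[OF True] unfolding Q_def by simp
    ultimately show ?thesis using S(3)[of v] unfolding O'_def by simp
  next
    case False
    then show ?thesis using S(3)[of v] unfolding S'_def O'_def by simp
  qed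
  have Odisj: "u = v" if "e \<in> O' u" "e \<in> O' v" for e u v using O'(4) that by metis
  have sub: "fgraph X" if "X \<subseteq> O' v" for X v
    by (rule fgraph_subset[OF fgS]) (use that O'(1) in blast)
  have lev: "p u = w \<and> l u = Suc (l w) \<or> p w = u \<and> l w = Suc (l u)" if e: "e \<in> F" "u \<in> e" "w \<in> e" "u \<noteq> w" for e u w
    using forest_edge[OF tree e(1)[unfolded F_def] e(2)] e by auto
  \<comment> \<open>Two centres whose levels agree modulo 3 are not adjacent in the tree, and a
    common neighbour is the parent of both. So a star can share only the leaf
    \<open>p u\<close>.\<close>
  have "splits (2 * 3) (\<Union>j<3. \<Union>u\<in>{u \<in> \<Union>S. l u mod 3 = j}. S' u)"
  proof (rule splits_UN)
    fix j :: nat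
    let ?U = "{u \<in> \<Union>S. l u mod 3 = j}"
    have inF: "e \<in> F \<and> u \<in> e" if "u \<in> ?U" "e \<in> S' u" for e u using S'F S'O O'(3) that by blast
    have cen: "u' \<notin> e" if h: "u \<in> ?U" "u' \<in> ?U" "u \<noteq> u'" "e \<in> S' u" for u u' e
    proof
      assume "u' \<in> e"
      then have "l u = Suc (l u') \<or> l u' = Suc (l u)" using lev[of e u u'] inF[OF h(1,4)] h(3) by blast
      moreover have "l u mod 3 = l u' mod 3" using h(1,2) by simp
      ultimately show False by (auto simp: mod_Suc split: if_splits)
    qed
    show "splits 2 (\<Union>u\<in>?U. S' u)"
    proof (rule splits_stars)
      show "finite ?U" by (rule finite_subset[OF _ finV]) auto
      show "fgraph (S' u) \<and> even (card (S' u)) \<and> (\<forall>e\<in>S' u. u \<in> e)" for u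
        using sub[OF S'O] S'even S'O O'(3) by blast
      show "u' \<notin> e" if "u \<in> ?U" "u' \<in> ?U" "u \<noteq> u'" "e \<in> S' u" for u u' e using cen that by blast
      fix u u' e e' w assume h: "u \<in> ?U" "u' \<in> ?U" "u \<noteq> u'" "e \<in> S' u" "e' \<in> S' u'" "w \<in> e" "w \<in> e'"
      have ne: "w \<noteq> u" "w \<noteq> u'" using cen[OF h(1,2,3,4)] cen[OF h(2,1) _ h(5)] h(3,6,7) by auto
      have 1: "p u = w \<and> l u = Suc (l w) \<or> p w = u \<and> l w = Suc (l u)"
        using lev[of e u w] inF[OF h(1,4)] h(6) ne(1) by blast
      have 2: "p u' = w \<and> l u' = Suc (l w) \<or> p w = u' \<and> l w = Suc (l u')"
        using lev[of e' u' w] inF[OF h(2,5)] h(7) ne(2) by blast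
      have m: "l u mod 3 = l u' mod 3" using h(1,2) by simp
      show "w = p u"
      proof (rule ccontr)
        assume "w \<noteq> p u"
        then have "p w = u" "l w = Suc (l u)" using 1 by auto
        then have "l u' = Suc (Suc (l u))" using 2 h(3) by simp
        then show False using m by presburger
      qed
    qed
  next
    fix i j :: nat assume "i \<noteq> j"
    have "u = v" if "e \<in> S' u" "e \<in> S' v" for e u v using Odisj S'O that by blast
    then show "(\<Union>u\<in>{u \<in> \<Union>S. l u mod 3 = i}. S' u) \<inter> (\<Union>u\<in>{u \<in> \<Union>S. l u mod 3 = j}. S' u) = {}"
      using \<open>i \<noteq> j\<close> by auto
  qed
  moreover have "(\<Union>j<3. \<Union>u\<in>{u \<in> \<Union>S. l u mod 3 = j}. S' u) = (\<Union>u\<in>\<Union>S. S' u)"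
    by (rule UN_classes) simp
  ultimately have "splits (2 * 3) (\<Union>u\<in>\<Union>S. S' u)" by (simp only:)
  then have d1: "splits 6 (\<Union>u\<in>\<Union>S. S' u)" by simp
  have "\<exists>y. fd v = {v, y} \<and> y \<noteq> v" if v: "v \<in> Tk" for v
  proof -
    have "fd v \<in> S" "v \<in> fd v" using ef[OF v] O' by blast+
    then show ?thesis using fgraph_edgeE[OF fgS] by metis
  qed
  then obtain y where y: "\<And>v. v \<in> Tk \<Longrightarrow> fd v = {v, y v} \<and> y v \<noteq> v" by metis
  have vin: "v \<in> ed v" "v \<in> fd v" "ed v \<in> M" if "v \<in> Tk" for v using ef[OF that] O'(3) by blast+
  have eddisj: "u = u'" if h: "u \<in> Tk" "u' \<in> Tk" "w \<in> ed u" "w \<in> ed u'" for u u' w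
  proof -
    have "ed u = ed u'" using O'M[OF _ _ h(3,4)] vin h by blast
    then show ?thesis using Odisj[of "ed u" u u'] ef[OF h(1)] ef[OF h(2)] by auto
  qed
  \<comment> \<open>The matching edges are disjoint, so \<open>y u\<close> lies on at most one of
    them and \<open>u\<close> points to at most one other path; \<open>functional_degenerate\<close>
    then yields three colours.\<close>
  have "\<exists>\<chi>. (\<forall>u\<in>Tk. \<chi> u < Suc 2) \<and>
    (\<forall>u\<in>Tk. \<forall>v\<in>Tk. u \<noteq> v \<longrightarrow> (y u \<in> ed v \<or> y v \<in> ed u) \<longrightarrow> \<chi> u \<noteq> \<chi> v)"
  proof (rule degenerate_colouring[OF finTk])
    show "y v \<in> ed u \<or> y u \<in> ed v" if "y u \<in> ed v \<or> y v \<in> ed u" for u v using that by blast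
    fix T assume T: "T \<subseteq> Tk" "T \<noteq> {}"
    show "\<exists>u\<in>T. card {v \<in> T. v \<noteq> u \<and> (y u \<in> ed v \<or> y v \<in> ed u)} \<le> 2"
    proof (rule functional_degenerate)
      show "finite T" using T(1) finTk finite_subset by blast
      show "T \<noteq> {}" by (rule T(2))
      show "card {v \<in> T. v \<noteq> u \<and> y u \<in> ed v} \<le> 1" for u
      proof -
        have "\<forall>a\<in>{v \<in> T. v \<noteq> u \<and> y u \<in> ed v}. \<forall>b\<in>{v \<in> T. v \<noteq> u \<and> y u \<in> ed v}. a = b"
          using eddisj T(1) by blast
        moreover have "finite {v \<in> T. v \<noteq> u \<and> y u \<in> ed v}" by (rule finite_subset[OF _ finTk]) (use T(1) in auto)
        ultimately show ?thesis by (simp add: card_le_Suc0_iff_eq)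
      qed
    qed
  qed
  then obtain \<chi> where \<chi>3: "\<forall>u\<in>Tk. \<chi> u < Suc 2"
    and \<chi>: "\<forall>u\<in>Tk. \<forall>v\<in>Tk. u \<noteq> v \<longrightarrow> (y u \<in> ed v \<or> y v \<in> ed u) \<longrightarrow> \<chi> u \<noteq> \<chi> v"
    by (elim exE conjE) (rule that)
  have "splits (2 * 3) (\<Union>j<3. \<Union>u\<in>{u \<in> Tk. \<chi> u = j}. Q u)"
  proof (rule splits_UN)
    fix j :: nat
    let ?U = "{u \<in> Tk. \<chi> u = j}"
    have cen: "u' \<notin> e" if h: "u \<in> ?U" "u' \<in> ?U" "u \<noteq> u'" "e \<in> Q u" for u u' e
    proof
      assume u'e: "u' \<in> e"
      have T: "u \<in> Tk" "u' \<in> Tk" using h by auto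
      show False
      proof (cases "e = ed u")
        case True then show ?thesis using eddisj[OF T, of u'] u'e vin(1)[OF T(2)] h(3) by blast
      next
        case False
        then have "u' = y u" using h(3,4) u'e y[OF T(1)] unfolding Q_def by auto
        then show ?thesis using \<chi> T h vin(1)[OF T(2)] by auto
      qed
    qed
    show "splits 2 (\<Union>u\<in>?U. Q u)"
    proof (rule splits_stars)
      show "finite ?U" using finTk by simp
      show "fgraph (Q u) \<and> even (card (Q u)) \<and> (\<forall>e\<in>Q u. u \<in> e)" if "u \<in> ?U" for u
      proof -
        have u: "u \<in> Tk" using that by simp
        then show ?thesis using sub[OF QO[OF u]] edfd[OF u] vin[OF u] unfolding Q_def by simp
      qed
      show "u' \<notin> e" if "u \<in> ?U" "u' \<in> ?U" "u \<noteq> u'" "e \<in> Q u" for u u' e using cen that by blast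
      fix u u' e e' w assume h: "u \<in> ?U" "u' \<in> ?U" "u \<noteq> u'" "e \<in> Q u" "e' \<in> Q u'" "w \<in> e" "w \<in> e'"
      have T: "u \<in> Tk" "u' \<in> Tk" using h by auto
      show "w = y u"
      proof (rule ccontr)
        assume ny: "w \<noteq> y u"
        have "w \<noteq> u" using cen[of u' u e'] h by auto
        then have "e \<noteq> fd u" using ny y[OF T(1)] h(6) by auto
        then have wu: "w \<in> ed u" using h(4,6) unfolding Q_def by auto
        show False
        proof (cases "e' = ed u'")
          case True then show ?thesis using eddisj[OF T wu] h(3,7) by blast
        next
          case False
          have "w \<noteq> u'" using cen[of u u' e] h by auto
          then have "w = y u'" using False h(5,7) y[OF T(2)] unfolding Q_def by auto
          then show ?thesis using \<chi> T h(1,2,3) wu by auto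
        qed
      qed
    qed
  next
    fix i j :: nat assume "i \<noteq> j"
    have "u = u'" if "e \<in> Q u" "e \<in> Q u'" "u \<in> Tk" "u' \<in> Tk" for e u u' using Odisj QO that by blast
    then show "(\<Union>u\<in>{u \<in> Tk. \<chi> u = i}. Q u) \<inter> (\<Union>u\<in>{u \<in> Tk. \<chi> u = j}. Q u) = {}" using \<open>i \<noteq> j\<close> by auto
  qed
  moreover have "(\<Union>j<3. \<Union>u\<in>{u \<in> Tk. \<chi> u = j}. Q u) = (\<Union>u\<in>Tk. Q u)"
    by (rule UN_classes) (use \<chi>3 in simp)
  ultimately have "splits (2 * 3) (\<Union>u\<in>Tk. Q u)" by (simp only:)
  then have d2: "splits 6 (\<Union>u\<in>Tk. Q u)" by simp
  have "(\<Union>u\<in>\<Union>S. S' u) \<inter> (\<Union>u\<in>Tk. Q u) = {}"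
  proof (rule equals0I)
    fix e assume "e \<in> (\<Union>u\<in>\<Union>S. S' u) \<inter> (\<Union>u\<in>Tk. Q u)"
    then obtain u v where "e \<in> S' u" "v \<in> Tk" "e \<in> Q v" by blast
    moreover then have "u = v" using Odisj[of e u v] S'O QO by blast
    ultimately show False unfolding S'_def by simp
  qed
  then have "splits (6 + 6) ((\<Union>u\<in>\<Union>S. S' u) \<union> (\<Union>u\<in>Tk. Q u))" using d1 d2 by (intro splits_Un)
  moreover have "(\<Union>u\<in>\<Union>S. S' u) \<union> (\<Union>u\<in>Tk. Q u) = S"
  proof
    show "(\<Union>u\<in>\<Union>S. S' u) \<union> (\<Union>u\<in>Tk. Q u) \<subseteq> S" using S'O QO O'(1) by blast
    show "S \<subseteq> (\<Union>u\<in>\<Union>S. S' u) \<union> (\<Union>u\<in>Tk. Q u)"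
    proof
      fix e assume e: "e \<in> S"
      then have "e \<in> O' (\<alpha> e)" "\<alpha> e \<in> \<Union>S" using S(2) unfolding O'_def out_def by auto
      then show "e \<in> (\<Union>u\<in>\<Union>S. S' u) \<union> (\<Union>u\<in>Tk. Q u)" unfolding S'_def
        by (cases "\<alpha> e \<in> Tk \<and> e \<in> Q (\<alpha> e)") (auto split: if_splits)
    qed
  qed
  ultimately show ?thesis by simp
qed

section \<open>A small irregular graph whose removal leaves an even orientation\<close>

lemma degree_insert:
  "finite S \<Longrightarrow> e \<notin> S \<Longrightarrow> degree (insert e S) v = degree S v + (if v \<in> e then 1 else 0)"
proof -
  assume S: "finite S" "e \<notin> S"
  have "{f \<in> insert e S. v \<in> f} = (if v \<in> e then insert e {f \<in> S. v \<in> f} else {f \<in> S. v \<in> f})" by auto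
  then show ?thesis unfolding degree_def using S by simp
qed

lemma degree_empty: "degree {} v = 0"
  by (simp add: degree_def)

text \<open>The spider with centre \<open>v\<close> and legs of length 1, 2 and 2; it is removed in
  the last case of \<open>even_remainder\<close>.\<close>

lemma irregular_claw_with_two_long_legs:
  assumes "distinct [v, a, b, c, y, z]"
  shows "irregular {{v, a}, {v, b}, {v, c}, {b, y}, {c, z}}" (is "irregular ?H")
proof -
  have d: "degree ?H u = (if u \<in> {v, a} then 1 else 0) + (if u \<in> {v, b} then 1 else 0) +
    (if u \<in> {v, c} then 1 else 0) + (if u \<in> {b, y} then 1 else 0) + (if u \<in> {c, z} then 1 else 0)" for u
    using assms by (simp add: degree_insert degree_empty doubleton_eq_iff)
  have "degree ?H v = 3" "degree ?H a = 1" "degree ?H b = 2" "degree ?H c = 2" "degree ?H y = 1" "degree ?H z = 1"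
    unfolding d using assms by auto
  then show ?thesis unfolding irregular_def by (auto simp: doubleton_eq_iff)
qed

text \<open>Take an orientation that has even out-degree except possibly at \<open>v0\<close>, with the out-degree
  at \<open>v0\<close> maximal. If it is odd and at least three, the star at \<open>v0\<close> can be removed. If it is
  one, maximality puts the other neighbours of \<open>v0\<close> into different components of the graph without
  \<open>v0\<close>, since switching a path between two of them would raise the out-degree to three;
  then a claw with two long legs can be removed.\<close>

lemma even_remainder:
  assumes E: "fgraph E" and conn: "\<And>u. u \<in> \<Union>E \<Longrightarrow> (u, v0) \<in> (adj E)\<^sup>*" and deg: "degree E v0 \<ge> 4"
  shows "\<exists>H \<alpha>. H \<subseteq> E \<and> irregular H \<and> (\<forall>e\<in>E - H. \<alpha> e \<in> e) \<and> (\<forall>v. even (card (out (E - H) \<alpha> v)))"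
proof -
  have finE: "finite E" using E by (simp add: fgraph_def)
  define good where "good \<alpha> \<longleftrightarrow> (\<forall>e\<in>E. \<alpha> e \<in> e) \<and> (\<forall>v. v \<noteq> v0 \<longrightarrow> even (card (out E \<alpha> v)))" for \<alpha>
  have finO: "finite (out E \<alpha> v)" for \<alpha> v unfolding out_def using finE by simp
  have "\<exists>\<alpha>. good \<alpha>"
  proof -
    have "e \<noteq> {}" if "e \<in> E" for e using that fgraph_empty_notin[OF E] by blast
    then obtain \<alpha>0 where \<alpha>0: "\<forall>e\<in>E. \<alpha>0 e \<in> e" by (metis all_not_in_conv)
    \<comment> \<open>All walks end in \<open>v0\<close>, so its parity alone stays open.\<close>
    let ?x = "\<lambda>u. if u \<in> \<Union>E then v0 else u"
    let ?T = "{v \<in> \<Union>E. odd (card (out E \<alpha>0 v))}"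
    have "finite ?T" by (rule finite_subset[OF _ finite_Union_fgraph[OF E]]) auto
    moreover have "(u, ?x u) \<in> (adj E)\<^sup>*" for u using conn[of u] by simp
    ultimately have "\<exists>J\<subseteq>E. \<forall>v. v \<notin> ?x ` ?T \<longrightarrow> (odd (degree J v) \<longleftrightarrow> v \<in> ?T)" by (rule T_join[OF E])
    then obtain J where J: "J \<subseteq> E" "\<forall>v. v \<notin> ?x ` ?T \<longrightarrow> (odd (degree J v) \<longleftrightarrow> v \<in> ?T)"
      by (elim exE conjE) (rule that)
    obtain \<alpha> where \<alpha>: "\<forall>e\<in>E. \<alpha> e \<in> e"
      and par: "\<forall>v. odd (card (out E \<alpha> v)) \<longleftrightarrow> odd (card (out E \<alpha>0 v)) \<noteq> odd (degree J v)"
      using flip_orientation[OF E \<alpha>0 J(1)] by (elim exE conjE) (rule that)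
    have "even (card (out E \<alpha> v))" if "v \<noteq> v0" for v
    proof -
      have "v \<notin> ?x ` ?T" using that by auto
      then have 1: "odd (degree J v) \<longleftrightarrow> v \<in> ?T" using J(2) by blast
      have "v \<in> \<Union>E" if "odd (card (out E \<alpha>0 v))"
      proof -
        have "out E \<alpha>0 v \<noteq> {}" using that by fastforce
        then show ?thesis using \<alpha>0 unfolding out_def by auto
      qed
      then show ?thesis using par[rule_format, of v] 1 by auto
    qed
    then show ?thesis using \<alpha> unfolding good_def by blast
  qed
  then obtain \<alpha>1 where "good \<alpha>1" by blast
  moreover have "\<forall>\<beta>. good \<beta> \<longrightarrow> card (out E \<beta> v0) < card E + 1"
    using card_mono[OF finE] unfolding out_def by (simp add: less_Suc_eq_le)
  ultimately have "\<exists>\<alpha>. good \<alpha> \<and> (\<forall>\<beta>. good \<beta> \<longrightarrow> card (out E \<beta> v0) \<le> card (out E \<alpha> v0))"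
    by (rule ex_has_greatest_nat)
  then obtain \<alpha> where good: "good \<alpha>" and maxi: "\<forall>\<beta>. good \<beta> \<longrightarrow> card (out E \<beta> v0) \<le> card (out E \<alpha> v0)" by blast
  have \<alpha>: "\<forall>e\<in>E. \<alpha> e \<in> e" and ev: "\<And>v. v \<noteq> v0 \<Longrightarrow> even (card (out E \<alpha> v))" using good unfolding good_def by blast+
  consider "even (card (out E \<alpha> v0))" | "odd (card (out E \<alpha> v0))" "card (out E \<alpha> v0) \<ge> 2" | "card (out E \<alpha> v0) = 1"
    by (cases "card (out E \<alpha> v0) \<ge> 2") (force simp: not_le less_2_cases_iff)+
  then show ?thesis
  proof cases
    case 1
    then have "even (card (out (E - {}) \<alpha> v))" for v using ev by (cases "v = v0") simp_all
    then show ?thesis using \<alpha> by (intro exI[of _ "{}"] exI[of _ \<alpha>]) simp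
  next
    case 2
    let ?H = "out E \<alpha> v0"
    have sub: "?H \<subseteq> E" unfolding out_def by blast
    have "irregular ?H" using \<alpha> 2(2) by (intro irregular_star[OF fgraph_subset[OF E sub], of v0]) (auto simp: out_def)
    moreover have "even (card (out (E - ?H) \<alpha> v))" for v
    proof (cases "v = v0")
      case True
      have "out (E - ?H) \<alpha> v = {}" using True unfolding out_def by auto
      then show ?thesis by simp
    next
      case False
      have "out (E - ?H) \<alpha> v = out E \<alpha> v" using False unfolding out_def by auto
      then show ?thesis using ev[OF False] by simp
    qed
    ultimately show ?thesis using \<alpha> sub by (intro exI[of _ ?H] exI[of _ \<alpha>]) simp
  next
    case 3
    then obtain e0 where e0: "out E \<alpha> v0 = {e0}" by (rule card_1_singletonE)
    then have e0E: "e0 \<in> E" "\<alpha> e0 = v0" "v0 \<in> e0" using \<alpha> unfolding out_def by auto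
    obtain c0 where c0: "e0 = {v0, c0}" "v0 \<noteq> c0" using fgraph_edgeE[OF E e0E(1,3)] by metis
    define Ch where "Ch = {c. {v0, c} \<in> E} - {c0}"
    have finN: "finite {c. {v0, c} \<in> E}" by (rule finite_subset[OF _ finite_Union_fgraph[OF E]]) auto
    have Ch3: "card Ch \<ge> 3" unfolding Ch_def using deg e0E(1) c0(1) finN by (simp add: degree_neighbours[OF E])
    have Ch: "{v0, c} \<in> E \<and> c \<noteq> v0 \<and> \<alpha> {v0, c} = c" if c: "c \<in> Ch" for c
    proof -
      have 1: "{v0, c} \<in> E" "c \<noteq> c0" using c unfolding Ch_def by auto
      then have "c \<noteq> v0" using fgraph_neq[OF E] by blast
      moreover have "{v0, c} \<noteq> e0" using 1(2) c0 by (auto simp: doubleton_eq_iff)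
      then have "{v0, c} \<notin> out E \<alpha> v0" unfolding e0 by simp
      then have "\<alpha> {v0, c} \<noteq> v0" using 1(1) unfolding out_def by simp
      moreover have "\<alpha> {v0, c} \<in> {v0, c}" using 1(1) \<alpha> by (rule bspec[rotated])
      ultimately show ?thesis using 1(1) by simp
    qed
    define E0 where "E0 = {e \<in> E. v0 \<notin> e}"
    have fg0: "fgraph E0" by (rule fgraph_subset[OF E]) (auto simp: E0_def)
    have sep: "(c, c') \<notin> (adj E0)\<^sup>*" if c: "c \<in> Ch" "c' \<in> Ch" "c \<noteq> c'" for c c'
    proof
      assume cc': "(c, c') \<in> (adj E0)\<^sup>*"
      obtain P where P: "P \<subseteq> E0" "\<forall>w. odd (degree P w) \<longleftrightarrow> c \<noteq> c' \<and> (w = c \<or> w = c')"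
        using walk_join[OF fg0 cc'] by (elim exE conjE) (rule that)
      \<comment> \<open>A closed walk from \<open>v0\<close> through \<open>c\<close> and
        \<open>c'\<close>: it has even degree everywhere, so reversing it keeps all parities, but
        both of its edges at \<open>v0\<close> now leave \<open>v0\<close>.\<close>
      let ?J = "insert {v0, c} (insert {v0, c'} P)"
      have nP: "{v0, c} \<notin> P" "{v0, c'} \<notin> P" using P(1) unfolding E0_def by auto
      have finP: "finite P" using P(1) fg0 finite_subset unfolding fgraph_def by blast
      have ne: "{v0, c} \<noteq> {v0, c'}" using c(3) by (auto simp: doubleton_eq_iff)
      have JE: "?J \<subseteq> E" using Ch[OF c(1)] Ch[OF c(2)] P(1) unfolding E0_def by auto
      have dJ: "degree ?J w = degree P w + (if w = v0 \<or> w = c' then 1 else 0) + (if w = v0 \<or> w = c then 1 else 0)" for w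
        using nP finP ne by (simp add: degree_insert)
      obtain \<beta> where \<beta>: "\<forall>e\<in>E. \<beta> e \<in> e"
        and out: "\<forall>v. out E \<beta> v = (out E \<alpha> v - {e \<in> ?J. v \<in> e}) \<union> ({e \<in> ?J. v \<in> e} - out E \<alpha> v)"
        and par: "\<forall>v. odd (card (out E \<beta> v)) \<longleftrightarrow> odd (card (out E \<alpha> v)) \<noteq> odd (degree ?J v)"
        using flip_orientation[OF E \<alpha> JE] by (elim exE conjE) (rule that)
      have "even (card (out E \<beta> v))" if "v \<noteq> v0" for v
      proof -
        have "even (degree ?J v)" using P(2)[rule_format, of v] that c(3) unfolding dJ by auto
        then show ?thesis using par[rule_format, of v] ev[OF that] by simp
      qed
      then have "good \<beta>" using \<beta> unfolding good_def by blast
      then have "card (out E \<beta> v0) \<le> 1" using maxi 3 by auto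
      moreover have "{{v0, c}, {v0, c'}} \<subseteq> out E \<beta> v0"
      proof -
        have "e0 \<noteq> {v0, c}" "e0 \<noteq> {v0, c'}" using c(1,2) c0 unfolding Ch_def by (auto simp: doubleton_eq_iff)
        then show ?thesis unfolding out[rule_format, of v0] e0 by auto
      qed
      then have "card {{v0, c}, {v0, c'}} \<le> card (out E \<beta> v0)" using finO by (rule card_mono[rotated])
      ultimately show False using ne by simp
    qed
    \<comment> \<open>Of the at least three vertices of \<open>Ch\<close> at most one lies in the
      component of \<open>c0\<close>, so two remain for the long legs.\<close>
    define Far where "Far = {c \<in> Ch. (c0, c) \<notin> (adj E0)\<^sup>*}"
    have finCh: "finite Ch" using finN unfolding Ch_def by simp
    have "card (Ch - Far) \<le> 1"
    proof -
      have "c = c'" if c: "c \<in> Ch - Far" "c' \<in> Ch - Far" for c c'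
      proof (rule ccontr)
        assume "c \<noteq> c'"
        have "(c, c0) \<in> (adj E0)\<^sup>*" "(c0, c') \<in> (adj E0)\<^sup>*"
          using c adj_rtrancl_sym[of c0 c E0] unfolding Far_def by auto
        then have "(c, c') \<in> (adj E0)\<^sup>*" by (rule rtrancl_trans)
        then show False using sep[of c c'] c \<open>c \<noteq> c'\<close> by blast
      qed
      then show ?thesis using finCh by (simp add: card_le_Suc0_iff_eq)
    qed
    moreover have "card Ch = card Far + card (Ch - Far)"
      using finCh by (metis (no_types, lifting) Far_def add.commute card_Diff_subset card_mono finite_subset le_add_diff_inverse2 mem_Collect_eq subsetI)
    ultimately have "2 \<le> card Far" using Ch3 by linarith
    then obtain T where T: "T \<subseteq> Far" "card T = 2" by (rule obtain_subset_with_card_n)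
    then obtain c1 c2 where c12: "c1 \<in> Far" "c2 \<in> Far" "c1 \<noteq> c2" by (metis card_2_iff insertCI subsetD)
    \<comment> \<open>The out-degree of \<open>c\<close> is even and counts the edge to
      \<open>v0\<close>, so a second edge leaves \<open>c\<close>; it becomes the outer edge of a
      leg.\<close>
    have "\<exists>z. {c, z} \<in> E0 \<and> \<alpha> {c, z} = c \<and> c \<noteq> z" if c: "c \<in> Far" for c
    proof -
      have cC: "c \<in> Ch" using c unfolding Far_def by simp
      note cc = Ch[OF cC]
      have "{v0, c} \<in> out E \<alpha> c" using cc unfolding out_def by simp
      moreover have "even (card (out E \<alpha> c))" using ev cc by blast
      then have "out E \<alpha> c \<noteq> {{v0, c}}" by auto
      ultimately obtain f where f: "f \<in> out E \<alpha> c" "f \<noteq> {v0, c}" by blast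
      then have fE: "f \<in> E" "\<alpha> f = c" unfolding out_def by auto
      then have "c \<in> f" using \<alpha> by blast
      then obtain z where z: "f = {c, z}" "c \<noteq> z" using fgraph_edgeE[OF E fE(1)] by metis
      then have "v0 \<notin> f" using f(2) cc by (auto simp: insert_commute)
      then show ?thesis using z fE unfolding E0_def by blast
    qed
    then obtain zf where zf: "\<And>c. c \<in> Far \<Longrightarrow> {c, zf c} \<in> E0 \<and> \<alpha> {c, zf c} = c \<and> c \<noteq> zf c" by metis
    define z1 where "z1 = zf c1"
    define z2 where "z2 = zf c2"
    have z1: "{c1, z1} \<in> E0" "\<alpha> {c1, z1} = c1" "c1 \<noteq> z1" and z2: "{c2, z2} \<in> E0" "\<alpha> {c2, z2} = c2" "c2 \<noteq> z2"
      using zf[OF c12(1)] zf[OF c12(2)] unfolding z1_def z2_def by auto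
    have C: "c1 \<in> Ch" "c2 \<in> Ch" "(c0, c1) \<notin> (adj E0)\<^sup>*" "(c0, c2) \<notin> (adj E0)\<^sup>*" using c12 unfolding Far_def by auto
    have r1: "(c1, z1) \<in> (adj E0)\<^sup>*" "(z1, c1) \<in> (adj E0)\<^sup>*" and r2: "(c2, z2) \<in> (adj E0)\<^sup>*" "(z2, c2) \<in> (adj E0)\<^sup>*"
      using z1(1) z2(1) unfolding adj_def by (auto simp: insert_commute)
    have s12: "(c1, c2) \<notin> (adj E0)\<^sup>*" "(c2, c1) \<notin> (adj E0)\<^sup>*" using sep[OF C(1,2)] sep[OF C(2,1)] c12(3) by auto
    \<comment> \<open>\<open>c0\<close>, \<open>c1\<close> and \<open>c2\<close> lie in three
      components of the graph without \<open>v0\<close>, so the ends \<open>z1\<close> and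
      \<open>z2\<close> are new vertices.\<close>
    have "distinct [v0, c0, c1, c2, z1, z2]"
    proof -
      have "c1 \<noteq> v0" "c2 \<noteq> v0" "c1 \<noteq> c0" "c2 \<noteq> c0" using Ch[OF C(1)] Ch[OF C(2)] C unfolding Ch_def by auto
      moreover have "z1 \<noteq> v0" "z2 \<noteq> v0" using z1(1) z2(1) unfolding E0_def by auto
      moreover have "z1 \<noteq> c0" "z2 \<noteq> c0" using C r1 r2 by auto
      moreover have "z1 \<noteq> c2" "z2 \<noteq> c1" using s12 r1 r2 by auto
      moreover have "z1 \<noteq> z2" using s12 r1 r2 by (metis rtrancl_trans)
      ultimately show ?thesis using c0(2) c12(3) z1(3) z2(3) by auto
    qed
    note dist = this
    let ?H = "{{v0, c0}, {v0, c1}, {v0, c2}, {c1, z1}, {c2, z2}}"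
    have "irregular ?H" using dist by (rule irregular_claw_with_two_long_legs)
    moreover have HE: "?H \<subseteq> E" using e0E(1) c0(1) Ch[OF C(1)] Ch[OF C(2)] z1(1) z2(1) unfolding E0_def by auto
    \<comment> \<open>The spider takes the only edge out of \<open>v0\<close> and two edges out of
      each of \<open>c1\<close> and \<open>c2\<close>.\<close>
    moreover have "even (card (out (E - ?H) \<alpha> v))" for v
    proof -
      have \<alpha>H: "\<alpha> {v0, c0} = v0" "\<alpha> {v0, c1} = c1" "\<alpha> {v0, c2} = c2" "\<alpha> {c1, z1} = c1" "\<alpha> {c2, z2} = c2"
        using e0E(2) c0(1) Ch[OF C(1)] Ch[OF C(2)] z1(2) z2(2) by auto
      have two: "even (card (X - {e, f}))" if "even (card X)" "finite X" "e \<in> X" "f \<in> X" "e \<noteq> f" for X :: "'a set set" and e f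
        using that by (simp add: card_Diff_subset)
      consider "v = v0" | "v = c1" | "v = c2" | "v \<notin> {v0, c1, c2}" by blast
      then show ?thesis
      proof cases
        case 1
        have "out (E - ?H) \<alpha> v = {}" using 1 e0 c0(1) unfolding out_def by auto
        then show ?thesis by simp
      next
        case 2
        have eq: "out (E - ?H) \<alpha> v = out E \<alpha> c1 - {{v0, c1}, {c1, z1}}"
          unfolding out_def 2 using \<alpha>H dist by auto
        have in_out: "{v0, c1} \<in> out E \<alpha> c1" "{c1, z1} \<in> out E \<alpha> c1" using \<alpha>H HE unfolding out_def by auto
        have ne: "c1 \<noteq> v0" "{v0, c1} \<noteq> {c1, z1}" using dist by (auto simp: doubleton_eq_iff)
        show ?thesis unfolding eq by (rule two[OF ev[OF ne(1)] finO in_out ne(2)])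
      next
        case 3
        have eq: "out (E - ?H) \<alpha> v = out E \<alpha> c2 - {{v0, c2}, {c2, z2}}"
          unfolding out_def 3 using \<alpha>H dist by auto
        have in_out: "{v0, c2} \<in> out E \<alpha> c2" "{c2, z2} \<in> out E \<alpha> c2" using \<alpha>H HE unfolding out_def by auto
        have ne: "c2 \<noteq> v0" "{v0, c2} \<noteq> {c2, z2}" using dist by (auto simp: doubleton_eq_iff)
        show ?thesis unfolding eq by (rule two[OF ev[OF ne(1)] finO in_out ne(2)])
      next
        case 4
        have "out (E - ?H) \<alpha> v = out E \<alpha> v" unfolding out_def using \<alpha>H 4 by auto
        then show ?thesis using ev[of v] 4 by simp
      qed
    qed
    ultimately show ?thesis using \<alpha> by (intro exI[of _ ?H] exI[of _ \<alpha>]) simp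
  qed
qed

section \<open>Graphs of maximum degree three\<close>

text \<open>A locally irregular graph of maximum degree three splits into pieces around its vertices of
  degree three and around those vertices of degree two that have no neighbour of degree three.\<close>

lemma subcubic_pieces:
  assumes D: "fgraph D" and irregular: "irregular D" and deg: "\<And>v. degree D v \<le> 3"
  shows "\<exists>P. finite P \<and> \<Union>P = D \<and> (\<forall>p\<in>P. \<forall>q\<in>P. p \<noteq> q \<longrightarrow> p \<inter> q = {}) \<and> (\<forall>p\<in>P. irregular p \<and> card (\<Union>p) \<le> 13)"
proof -
  have finD: "finite D" using D by (simp add: fgraph_def)
  have ne: "degree D u \<noteq> degree D v" if "{u, v} \<in> D" for u v using irregular that unfolding irregular_def by blast
  \<comment> \<open>The degrees at an edge are 3 and 2, 3 and 1, or 2 and 1. In the last case the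
    edge goes to a neighbour of degree three of its end of degree two, if there is one, and
    otherwise to that end itself.\<close>
  define centre where "centre e v \<longleftrightarrow> (v \<in> e \<and> degree D v = 3) \<or>
    ((\<forall>u\<in>e. degree D u \<noteq> 3) \<and> degree D v = 3 \<and> (\<exists>w\<in>e. degree D w = 2 \<and> {v, w} \<in> D)) \<or>
    ((\<forall>u\<in>e. degree D u \<noteq> 3) \<and> v \<in> e \<and> degree D v = 2 \<and> (\<forall>y. {v, y} \<in> D \<longrightarrow> degree D y \<noteq> 3))" for e v
  have "\<exists>v. centre e v" if e: "e \<in> D" for e
  proof (cases "\<exists>u\<in>e. degree D u = 3")
    case True then show ?thesis unfolding centre_def by blast
  next
    case no3: False
    obtain u w where uw: "e = {u, w}" "u \<noteq> w" using fgraph_edgeE2[OF D e] by metis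
    have "degree D x \<in> {1, 2}" if "x \<in> e" for x
    proof -
      have "degree D x \<le> 3" "degree D x \<ge> 1" "degree D x \<noteq> 3"
        using deg degree_pos[OF finD e that] no3 that by auto
      then show ?thesis by auto
    qed
    then have "degree D u \<in> {1, 2}" "degree D w \<in> {1, 2}" "degree D u \<noteq> degree D w" using uw(1) ne e by auto
    then obtain x where x: "x \<in> e" "degree D x = 2" using uw(1) by auto
    show ?thesis
    proof (cases "\<exists>y. {x, y} \<in> D \<and> degree D y = 3")
      case True
      then obtain y where "{y, x} \<in> D" "degree D y = 3" by (auto simp: insert_commute)
      then have "centre e y" using no3 x unfolding centre_def by blast
      then show ?thesis by blast
    next
      case False
      then have "centre e x" using no3 x unfolding centre_def by blast
      then show ?thesis by blast
    qed
  qed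
  then obtain ctr where ctr: "\<And>e. e \<in> D \<Longrightarrow> centre e (ctr e)" by metis
  define Fib where "Fib v = {e \<in> D. ctr e = v}" for v
  have FD: "Fib v \<subseteq> D" for v unfolding Fib_def by blast
  have fgF: "fgraph (Fib v)" for v by (rule fgraph_subset[OF D FD])
  have uniq3: "v' = v" if h: "e \<in> D" "v \<in> e" "degree D v = 3" "centre e v'" for e v v'
  proof (rule ccontr)
    assume "v' \<noteq> v"
    have v': "v' \<in> e" "degree D v' = 3" using h(2,3,4) unfolding centre_def by auto
    obtain x where "e = {v, x}" using fgraph_edgeE[OF D h(1,2)] by metis
    then have "{v, v'} \<in> D" using v'(1) \<open>v' \<noteq> v\<close> h(1) by auto
    then show False using ne[of v v'] h(3) v'(2) by simp
  qed
  have "irregular (Fib (ctr e)) \<and> card (\<Union>(Fib (ctr e))) \<le> 13" if e: "e \<in> D" for e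
  proof
    let ?v = "ctr e"
    have cen: "centre f ?v" if "f \<in> Fib ?v" for f using that ctr unfolding Fib_def by force
    have finF: "finite (Fib ?v)" using finite_subset[OF FD finD] .
    have dle: "degree (Fib ?v) u \<le> degree D u" for u by (rule degree_mono[OF finD FD])
    show "irregular (Fib ?v)"
    proof (cases "degree D ?v = 3")
      case True
      have star: "{f \<in> Fib ?v. ?v \<in> f} = {f \<in> D. ?v \<in> f}"
        using uniq3[OF _ _ True ctr] unfolding Fib_def by auto
      have d3: "degree (Fib ?v) ?v = 3" using degree_cong[OF star] True by simp
      \<comment> \<open>The outer edge of a leg of length two: \<open>w\<close> lies on two edges of
        the piece and \<open>z\<close> on only one.\<close>
      have leg: "degree (Fib ?v) w \<noteq> degree (Fib ?v) z"
        if wz: "{w, z} \<in> Fib ?v" "?v \<notin> {w, z}" "degree D w = 2" "{?v, w} \<in> D" for w z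
      proof -
        have wzD: "{w, z} \<in> D" using wz(1) FD by blast
        have no3: "degree D z \<noteq> 3"
        proof
          assume "degree D z = 3"
          then have "?v = z" using uniq3[OF wzD _ _ cen[OF wz(1)], of z] by simp
          then show False using wz(2) by simp
        qed
        have "degree D z \<noteq> 2" using ne[OF wzD] wz(3) by simp
        then have "degree (Fib ?v) z \<le> 1" using dle[of z] deg[of z] no3 by linarith
        moreover have "2 \<le> degree (Fib ?v) w"
        proof -
          have "{?v, w} \<in> Fib ?v" using star wz(4) by auto
          then have "{{?v, w}, {w, z}} \<subseteq> {f \<in> Fib ?v. w \<in> f}" using wz(1) by auto
          then have "card {{?v, w}, {w, z}} \<le> degree (Fib ?v) w" unfolding degree_def using finF by (intro card_mono) auto
          moreover have "{?v, w} \<noteq> {w, z}" using wz(2) by (auto simp: doubleton_eq_iff)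
          ultimately show ?thesis by simp
        qed
        ultimately show ?thesis by linarith
      qed
      show ?thesis
      proof (rule liI)
        fix a b assume ab: "{a, b} \<in> Fib ?v"
        then have abD: "{a, b} \<in> D" using FD by blast
        show "degree (Fib ?v) a \<noteq> degree (Fib ?v) b"
        proof (cases "?v \<in> {a, b}")
          case T: True
          have small: "degree (Fib ?v) x \<noteq> 3" if "{?v, x} \<in> D" for x
            using ne[OF that] True dle[of x] deg[of x] by linarith
          show ?thesis
          proof (cases "?v = a")
            case True then show ?thesis using small[of b] d3 abD by simp
          next
            case False
            then have "?v = b" using T by simp
            then show ?thesis using small[of a] d3 abD by (simp add: insert_commute)
          qed
        next
          case F: False
          then have "\<exists>w\<in>{a, b}. degree D w = 2 \<and> {?v, w} \<in> D" using cen[OF ab] unfolding centre_def by blast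
          then show ?thesis
          proof (elim bexE conjE)
            fix w assume w: "w \<in> {a, b}" "degree D w = 2" "{?v, w} \<in> D"
            show ?thesis
            proof (cases "w = a")
              case True then show ?thesis using leg[of a b] ab F w by simp
            next
              case False
              then have "w = b" using w(1) by simp
              then show ?thesis using leg[of b a] ab F w by (simp add: insert_commute)
            qed
          qed
        qed
      qed
    next
      case no: False
      have third: "?v \<in> f \<and> degree D ?v = 2 \<and> (\<forall>y. {?v, y} \<in> D \<longrightarrow> degree D y \<noteq> 3)" if "centre f ?v" for f
        using that no unfolding centre_def by blast
      note v = third[OF ctr[OF e]]
      have "f \<in> Fib ?v" if f: "f \<in> D" "?v \<in> f" for f
      proof -
        obtain y where y: "f = {?v, y}" using fgraph_edgeE[OF D f] by metis
        then have yd: "degree D y \<noteq> 2" "degree D y \<noteq> 3" using ne[of ?v y] f(1) v by auto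
        have "ctr f = ?v"
          using ctr[OF f(1)] yd v y no unfolding centre_def by (auto simp: insert_commute)
        then show ?thesis using f(1) unfolding Fib_def by simp
      qed
      then have "{f \<in> D. ?v \<in> f} \<subseteq> Fib ?v" by blast
      then have "card {f \<in> D. ?v \<in> f} \<le> card (Fib ?v)" using finF by (rule card_mono[rotated])
      then have "2 \<le> card (Fib ?v)" using v unfolding degree_def by simp
      moreover have "\<forall>f\<in>Fib ?v. ?v \<in> f" using third cen by blast
      ultimately show ?thesis using irregular_star[OF fgF] by blast
    qed
    define N where "N u = {w. {u, w} \<in> D}" for u
    have cN: "card (N u) \<le> 3" for u using deg[of u] unfolding degree_neighbours[OF D] N_def .
    have finN: "finite (N u)" for u unfolding N_def by (rule finite_subset[OF _ finite_Union_fgraph[OF D]]) auto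
    \<comment> \<open>A piece lies within distance two of its centre, which leaves room for 1 + 3 +
      3 * 3 = 13 vertices.\<close>
    have "\<Union>(Fib ?v) \<subseteq> insert ?v (N ?v \<union> (\<Union>w\<in>N ?v. N w))"
    proof
      fix x assume "x \<in> \<Union>(Fib ?v)"
      then obtain f where f: "f \<in> Fib ?v" "x \<in> f" by blast
      have fD: "f \<in> D" using f(1) FD by blast
      have "?v \<in> f \<or> (\<exists>w\<in>f. {?v, w} \<in> D)" using cen[OF f(1)] unfolding centre_def by blast
      then show "x \<in> insert ?v (N ?v \<union> (\<Union>w\<in>N ?v. N w))"
      proof
        assume "?v \<in> f"
        then obtain y where "f = {?v, y}" using fgraph_edgeE[OF D fD] by metis
        then show ?thesis using f(2) fD unfolding N_def by auto
      next
        assume "\<exists>w\<in>f. {?v, w} \<in> D"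
        then obtain w where w: "w \<in> f" "{?v, w} \<in> D" by blast
        then obtain y where "f = {w, y}" using fgraph_edgeE[OF D fD] by metis
        then show ?thesis using f(2) fD w unfolding N_def by auto
      qed
    qed
    then have "card (\<Union>(Fib ?v)) \<le> card (insert ?v (N ?v \<union> (\<Union>w\<in>N ?v. N w)))" using finN by (intro card_mono) auto
    also have "\<dots> \<le> Suc (card (N ?v \<union> (\<Union>w\<in>N ?v. N w)))" using finN by (simp add: card_insert_if)
    also have "card (N ?v \<union> (\<Union>w\<in>N ?v. N w)) \<le> card (N ?v) + card (\<Union>w\<in>N ?v. N w)" by (rule card_Un_le)
    also have "card (\<Union>w\<in>N ?v. N w) \<le> (\<Sum>w\<in>N ?v. card (N w))" by (rule card_UN_le[OF finN])
    also have "\<dots> \<le> card (N ?v) * 3" using sum_bounded_above[of "N ?v" "\<lambda>w. card (N w)" 3] cN by simp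
    finally show "card (\<Union>(Fib ?v)) \<le> 13" using cN[of ?v] by linarith
  qed
  then have "\<forall>p\<in>Fib ` ctr ` D. irregular p \<and> card (\<Union>p) \<le> 13" by blast
  moreover have "\<Union>(Fib ` ctr ` D) = D" unfolding Fib_def by auto
  moreover have "\<forall>p\<in>Fib ` ctr ` D. \<forall>q\<in>Fib ` ctr ` D. p \<noteq> q \<longrightarrow> p \<inter> q = {}" unfolding Fib_def by auto
  ultimately show ?thesis using finD by (intro exI[of _ "Fib ` ctr ` D"]) simp
qed

text \<open>The given colouring may use any number of colours. Its classes are cut into pieces with
  at most 13 vertices, of which at most three meet at a vertex, so greedy colouring of the pieces
  needs 13 * 3 + 1 colours.\<close>

lemma subcubic_splits:
  assumes K: "fgraph K" and deg: "\<And>v. degree K v \<le> 3" and c: "\<And>i. irregular {e \<in> K. c e = (i :: nat)}"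
  shows "splits 40 K"
proof -
  have finK: "finite K" using K by (simp add: fgraph_def)
  define split where "split i P \<longleftrightarrow> finite P \<and> \<Union>P = {e \<in> K. c e = i} \<and> (\<forall>p\<in>P. \<forall>q\<in>P. p \<noteq> q \<longrightarrow> p \<inter> q = {}) \<and>
    (\<forall>p\<in>P. irregular p \<and> card (\<Union>p) \<le> 13)" for i P
  have "\<exists>P. split i P" for i
    unfolding split_def
  proof (rule subcubic_pieces)
    show "fgraph {e \<in> K. c e = i}" by (rule fgraph_subset[OF K]) auto
    show "degree {e \<in> K. c e = i} v \<le> 3" for v
      using degree_mono[OF finK, of "{e \<in> K. c e = i}" v] deg[of v] by force
  qed (rule c)
  then obtain P where sP: "\<And>i. split i (P i)" by metis
  have P: "finite (P i)" "\<Union>(P i) = {e \<in> K. c e = i}"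
    "\<forall>p\<in>P i. \<forall>q\<in>P i. p \<noteq> q \<longrightarrow> p \<inter> q = {}" "\<forall>p\<in>P i. irregular p \<and> card (\<Union>p) \<le> 13" for i
    using sP[of i] unfolding split_def by simp_all
  define PP where "PP = (\<Union>i\<in>c ` K. P i)"
  have sub: "p \<subseteq> {e \<in> K. c e = i}" if "p \<in> P i" for p i using P(2) that by blast
  have UPP: "\<Union>PP = K"
  proof (intro equalityI subsetI)
    fix e assume "e \<in> \<Union>PP"
    then show "e \<in> K" unfolding PP_def using sub by blast
  next
    fix e assume e: "e \<in> K"
    then have "e \<in> \<Union>(P (c e))" unfolding P(2) by simp
    then show "e \<in> \<Union>PP" unfolding PP_def using e by blast
  qed
  have "splits (13 * 3 + 1) (\<Union>PP)"
  proof (rule splits_pieces)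
    show "finite PP" unfolding PP_def using finK P(1) by simp
    fix p assume "p \<in> PP"
    then obtain i where i: "p \<in> P i" unfolding PP_def by blast
    show "irregular p" "card (\<Union>p) \<le> 13" using P(4) i by blast+
    show "fgraph p" by (rule fgraph_subset[OF K]) (use sub[OF i] in auto)
    fix q assume "q \<in> PP" "p \<noteq> q"
    then obtain k where k: "q \<in> P k" unfolding PP_def by blast
    show "p \<inter> q = {}"
    proof (cases "i = k")
      case True then show ?thesis using P(3)[of i] i k \<open>p \<noteq> q\<close> by simp
    next
      case False then show ?thesis using sub[OF i] sub[OF k] by auto
    qed
  next
    show "degree (\<Union>PP) v \<le> 3" for v unfolding UPP by (rule deg)
  qed
  then show ?thesis unfolding UPP by simp
qed

section \<open>Assembly: a connected graph, then all components\<close>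

lemma connected_splits:
  assumes K: "fgraph K" and conn: "\<And>u. u \<in> \<Union>K \<Longrightarrow> (u, v0) \<in> (adj K)\<^sup>*" and deg: "degree K v0 \<ge> 4"
  shows "splits 128 K"
proof -
  have finK: "finite K" using K by (simp add: fgraph_def)
  define r where "r u = (if u \<in> \<Union>K then v0 else u)" for u
  have "(v, r v) \<in> (adj K)\<^sup>*" for v using conn[of v] unfolding r_def by simp
  moreover have "r u = r v" if "{u, v} \<in> K" for u v using that unfolding r_def by auto
  ultimately have "\<exists>l p. rooted K r l p" by (rule rooted_exists)
  then obtain l p where tree: "rooted K r l p" by blast
  define F where "F = forest l p"
  have FK: "F \<subseteq> K" unfolding F_def by (rule forest_subset[OF tree])
  have fgF: "fgraph F" by (rule fgraph_subset[OF K FK])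
  \<comment> \<open>In a breadth-first search tree all neighbours of the root are its children, so
    \<open>v0\<close> keeps its degree of at least four in \<open>F\<close>.\<close>
  have star: "e \<in> F" if e: "e \<in> K" "v0 \<in> e" for e
  proof -
    obtain c where c: "e = {v0, c}" "v0 \<noteq> c" using fgraph_edgeE[OF K e] by metis
    have "v0 \<in> \<Union>K" "c \<in> \<Union>K" using e c by auto
    then have rv: "r v0 = v0" "r c = v0" unfolding r_def by auto
    have l0: "l v = 0 \<longleftrightarrow> r v = v" for v using tree unfolding rooted_def by blast
    have "{c, v0} \<in> K" using e(1) c(1) by (simp add: insert_commute)
    then have "l c \<le> Suc (l v0)" using tree unfolding rooted_def by blast
    moreover have "l v0 = 0" "l c \<noteq> 0" using l0 rv c(2) by auto
    moreover note par = rooted_parent[OF tree \<open>l c \<noteq> 0\<close>]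
    ultimately have "l (p c) = 0" by simp
    then have "p c = v0" using l0 par rv by simp
    then show ?thesis using c(1) \<open>l c \<noteq> 0\<close> unfolding F_def forest_def by (auto simp: insert_commute)
  qed
  have fgKF: "fgraph (K - F)" by (rule fgraph_subset[OF K]) blast
  obtain R where R: "R \<subseteq> K - F" "splits 42 (K - F - R)" "\<forall>v. degree R v \<le> 24"
    using almost_decomposition[OF fgKF] by (elim exE conjE) (rule that)
  have fgR: "fgraph R" by (rule fgraph_subset[OF fgKF R(1)])
  have "\<exists>M\<subseteq>R. splits (3 * 24 + 1) (R - M) \<and> (\<forall>v. degree M v \<le> 1)"
    by (rule bounded_degree_splits[OF fgR]) (use R(3) in blast)
  then obtain M where M: "M \<subseteq> R" "splits 73 (R - M)" "\<forall>v. degree M v \<le> 1" by auto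
  have fgM: "fgraph M" by (rule fgraph_subset[OF fgR M(1)])
  \<comment> \<open>The tree lends the leftover matching the connectedness and the vertex of degree
    four that \<open>even_remainder\<close> requires.\<close>
  let ?L = "F \<union> M"
  have fgL: "fgraph ?L" by (rule fgraph_Un[OF fgF fgM])
  have LK: "?L \<subseteq> K" using FK M(1) R(1) by blast
  have "\<exists>H \<alpha>. H \<subseteq> ?L \<and> irregular H \<and> (\<forall>e\<in>?L - H. \<alpha> e \<in> e) \<and> (\<forall>v. even (card (out (?L - H) \<alpha> v)))"
  proof (rule even_remainder[OF fgL])
    show "(u, v0) \<in> (adj ?L)\<^sup>*" if "u \<in> \<Union>?L" for u
    proof -
      have "u \<in> \<Union>K" using that LK by blast
      then have "(u, v0) \<in> (adj F)\<^sup>*" using forest_reach[OF tree, of u] unfolding F_def r_def by simp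
      moreover have "adj F \<subseteq> adj ?L" unfolding adj_def by auto
      ultimately show ?thesis using rtrancl_mono by blast
    qed
    have "{e \<in> K. v0 \<in> e} = {e \<in> F. v0 \<in> e}" using star FK by blast
    then have "degree F v0 = degree K v0" using degree_cong by metis
    moreover have "degree F v0 \<le> degree ?L v0" using fgL by (intro degree_mono) (auto simp: fgraph_def)
    ultimately show "4 \<le> degree ?L v0" using deg by linarith
  qed
  then obtain H \<alpha> where H: "H \<subseteq> ?L" "irregular H" and \<alpha>: "\<forall>e\<in>?L - H. \<alpha> e \<in> e" "\<forall>v. even (card (out (?L - H) \<alpha> v))"
    by (elim exE conjE) (rule that)
  have "splits 12 (?L - H)"
  proof (rule forest_matching_splits[OF tree K fgM])
    show "degree M v \<le> 1" for v using M(3) by blast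
    show "M \<inter> forest l p = {}" using M(1) R(1) unfolding F_def by blast
    show "?L - H \<subseteq> forest l p \<union> M" unfolding F_def by blast
    show "\<forall>e\<in>?L - H. \<alpha> e \<in> e" by (rule \<alpha>(1))
    show "even (card (out (?L - H) \<alpha> v))" for v using \<alpha>(2) by blast
  qed
  then have "splits (42 + 73 + (1 + 12)) ((K - F - R) \<union> (R - M) \<union> (H \<union> (?L - H)))"
    using R(1,2) M(1,2) H by (intro splits_Un splits_irregular) auto
  moreover have "(K - F - R) \<union> (R - M) \<union> (H \<union> (?L - H)) = K" using FK R(1) M(1) H(1) by blast
  ultimately show ?thesis by simp
qed

lemma locally_irregular_Union: "locally_irregular (\<Union>X) X \<longleftrightarrow> irregular X"
  unfolding locally_irregular_def irregular_def by auto

text \<open>Components are vertex-disjoint and reuse the same colours. A class of the given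
  colouring keeps its degrees when restricted to a component, so it stays irregular there.\<close>

lemma decomposable_splits:
  assumes E: "fgraph E" and "decomposable E"
  shows "splits 128 E"
proof -
  obtain c where "locally_irregular_edge_colouring E c" using assms(2) unfolding decomposable_def by blast
  then have c: "\<forall>i. irregular {e \<in> E. c e = i}"
    unfolding locally_irregular_edge_colouring_def colour_class_def locally_irregular_Union .
  obtain r where r: "\<forall>v. (v, r v) \<in> (adj E)\<^sup>*" "\<forall>u v. {u, v} \<in> E \<longrightarrow> r u = r v"
    using component_representatives[of E] by blast
  define K where "K i = {e \<in> E. \<forall>v\<in>e. r v = i}" for i
  have KE: "K i \<subseteq> E" for i unfolding K_def by blast
  have fgK: "fgraph (K i)" for i by (rule fgraph_subset[OF E KE])
  have in_K: "e \<in> K (r v)" if h: "e \<in> E" "v \<in> e" for e v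
  proof -
    obtain u where "e = {v, u}" using fgraph_edgeE[OF E h] by metis
    then show ?thesis using r(2) h(1) unfolding K_def by auto
  qed
  have walk: "r v = r u \<and> (u, v) \<in> (adj (K (r u)))\<^sup>*" if "(u, v) \<in> (adj E)\<^sup>*" for u v
    using that
  proof (induction rule: rtrancl_induct)
    case base then show ?case by simp
  next
    case (step y z)
    then have yz: "{y, z} \<in> E" unfolding adj_def by simp
    then have "{y, z} \<in> K (r u)" using in_K[of "{y, z}" y] step.IH by simp
    then have "(y, z) \<in> adj (K (r u))" unfolding adj_def by simp
    moreover have "r z = r u" using r(2) yz step.IH by auto
    ultimately show ?case using step.IH by (auto intro: rtrancl_into_rtrancl)
  qed
  have "splits 128 (K i)" for i
  proof (cases "\<exists>v0. degree (K i) v0 \<ge> 4")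
    case True
    then obtain v0 where v0: "degree (K i) v0 \<ge> 4" by blast
    show ?thesis
    proof (rule connected_splits[OF fgK _ v0])
      fix u assume u: "u \<in> \<Union>(K i)"
      have "degree (K i) v0 \<noteq> 0" using v0 by simp
      moreover have "finite (K i)" using fgK unfolding fgraph_def by blast
      ultimately have "v0 \<in> \<Union>(K i)" using degree_eq_0[of "K i" v0] by simp
      then have "r v0 = i" "r u = i" using u unfolding K_def by auto
      then have "(u, v0) \<in> (adj E)\<^sup>*"
        using r(1)[rule_format, of u] adj_rtrancl_sym[OF r(1)[rule_format, of v0]] by (simp add: rtrancl_trans)
      then show "(u, v0) \<in> (adj (K i))\<^sup>*" using walk \<open>r u = i\<close> by blast
    qed
  next
    case False
    have "splits 40 (K i)"
    proof (rule subcubic_splits[OF fgK])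
      show "degree (K i) v \<le> 3" for v using False by (metis not_less_eq_eq numeral_3_eq_3 eval_nat_numeral(2) semiring_norm(26,27))
      show "irregular {e \<in> K i. c e = k}" for k
      proof (rule liI)
        fix u v assume uv: "{u, v} \<in> {e \<in> K i. c e = k}"
        have "degree {e \<in> K i. c e = k} w = degree {e \<in> E. c e = k} w" if "w \<in> {u, v}" for w
        proof (rule degree_cong)
          have "r w = i" using uv that unfolding K_def by auto
          then show "{e \<in> {e \<in> K i. c e = k}. w \<in> e} = {e \<in> {e \<in> E. c e = k}. w \<in> e}"
            using in_K[of _ w] KE by auto
        qed
        moreover have "degree {e \<in> E. c e = k} u \<noteq> degree {e \<in> E. c e = k} v"
          using c[rule_format, of k] uv KE[of i] unfolding irregular_def by blast
        ultimately show "degree {e \<in> K i. c e = k} u \<noteq> degree {e \<in> K i. c e = k} v" by simp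
      qed
    qed
    then show ?thesis by (rule splits_mono) simp
  qed
  then have "splits 128 (\<Union>i\<in>UNIV. K i)"
  proof (rule splits_vertex_disjoint)
    show "i = j" if "e \<in> K i" "f \<in> K j" "e \<inter> f \<noteq> {}" for i j e f using that unfolding K_def by auto
    show "{} \<notin> K i" for i by (rule fgraph_empty_notin[OF fgK])
  qed
  moreover have "(\<Union>i\<in>UNIV. K i) = E"
  proof
    show "E \<subseteq> (\<Union>i\<in>UNIV. K i)"
    proof
      fix e assume e: "e \<in> E"
      then obtain u v where "e = {u, v}" using fgraph_edgeE2[OF E] by metis
      then show "e \<in> (\<Union>i\<in>UNIV. K i)" using in_K[OF e, of u] by blast
    qed
  qed (use KE in blast)
  ultimately show ?thesis by simp
qed

theorem theorem23:
  fixes V :: "'a set" and E :: "'a set set"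
  assumes "simple_graph V E"
    and "decomposable E"
  shows "irregular_chromatic_index E \<le> 328"
proof -
  have "E \<subseteq> Pow V" "finite V" "\<forall>e\<in>E. card e = 2" using assms(1) unfolding simple_graph_def by auto
  then have "fgraph E" unfolding fgraph_def using finite_subset by blast
  from decomposable_splits[OF this assms(2)] obtain c :: "'a set \<Rightarrow> nat"
    where c: "\<forall>e\<in>E. c e < 128" "\<forall>i. irregular {e \<in> E. c e = i}"
    unfolding splits_def by (elim exE conjE) (rule that)
  have "locally_irregular_edge_colouring E c"
    unfolding locally_irregular_edge_colouring_def colour_class_def locally_irregular_Union using c(2) .
  then have "irregular_chromatic_index E \<le> card (c ` E)"
    unfolding irregular_chromatic_index_def by (intro Least_le) blast
  also have "\<dots> \<le> card {..<128::nat}" using c(1) by (intro card_mono) auto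
  finally show ?thesis by simp
qed

end
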